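(* Let $d\ge 1$ be an integer and let $0<\alpha<d$. Let $\Omega^{*}$ be a ball in $\mathbb{R}^d$. Then $\Omega^*$ is a maximiser of the first eigenvalue of $\mathcal{R}_{\alpha,\Omega}$ among all sets of the given volume: for every measurable set $\Omega\subset\mathbb{R}^d$ with $|\Omega|=|\Omega^{*}|$, $$0<\lambda_1(\Omega)\le\lambda_1(\Omega^{*}).$$
   Context: $|\cdot|$ denotes Lebesgue measure on $\mathbb{R}^d$. For a measurable set $\Omega\subset\mathbb{R}^d$ of finite Lebesgue measure and $0<\alpha<d$, the Riesz potential operator $\mathcal{R}_{\alpha,\Omega}$ on $L^2(\Omega)$ is $$(\mathcal{R}_{\alpha,\Omega}f)(x)=\int_{\Omega}c_{\alpha,d}|x-y|^{\alpha-d}f(y)\,dy,\qquad f\in L^2(\Omega),$$ where $c_{\alpha,d}=2^{\alpha-d}\pi^{-d/2}\,\Gamma(\alpha/2)/\Gamma((d-\alpha)/2)>0$. It is a compact, self-adjoint, nonnegative operator on $L^2(\Omega)$, and $\lambda_1(\Omega)$ denotes its largest eigenvalue. *)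

theory Defs
  imports "HOL-Analysis.Analysis"
begin

definition riesz_const :: "real \<Rightarrow> real \<Rightarrow> real" where
  "riesz_const \<alpha> d =
     2 powr (\<alpha> - d) * pi powr (- d / 2) * Gamma (\<alpha> / 2) / Gamma ((d - \<alpha>) / 2)"

(* L^2 is represented by functions on the whole space, of which only the restriction to Omega
   matters. Functions are not identified modulo null sets; equality in L^2 is equality almost
   everywhere and is written out where it is needed. *)
definition L2_on :: "(real ^ 'n) set \<Rightarrow> (real ^ 'n \<Rightarrow> complex) set" where
  "L2_on \<Omega> = {f. f \<in> borel_measurable (lebesgue_on \<Omega>) \<and>
                  integrable (lebesgue_on \<Omega>) (\<lambda>x. (norm (f x))\<^sup>2)}"

(* For f in L^2 and Omega of finite measure the integral converges absolutely for almost every x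
   in Omega. At the remaining points the Bochner integral is 0 by convention. The kernel at x = y
   is 0 because 0 powr a = 0. Neither convention affects the class of the result in L^2. *)
definition riesz_potential ::
  "real \<Rightarrow> (real ^ 'n) set \<Rightarrow> (real ^ 'n \<Rightarrow> complex) \<Rightarrow> real ^ 'n \<Rightarrow> complex" where
  "riesz_potential \<alpha> \<Omega> f x =
     (LINT y | lebesgue_on \<Omega>.
        complex_of_real (riesz_const \<alpha> (real CARD('n)) *
          norm (x - y) powr (\<alpha> - real CARD('n))) * f y)"

definition riesz_eigenvalue :: "real \<Rightarrow> (real ^ 'n) set \<Rightarrow> complex \<Rightarrow> bool" where
  "riesz_eigenvalue \<alpha> \<Omega> \<mu> \<longleftrightarrow>
     (\<exists>f \<in> L2_on \<Omega>. \<not> (AE x in lebesgue_on \<Omega>. f x = 0) \<and>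
        (AE x in lebesgue_on \<Omega>. riesz_potential \<alpha> \<Omega> f x = \<mu> * f x))"

(* The operator is self-adjoint, so its eigenvalues are real. GREATEST picks the maximum and is
   an unspecified number if there is none, so proving anything about it requires existence. *)
definition riesz_lambda1 :: "real \<Rightarrow> (real ^ 'n) set \<Rightarrow> real" where
  "riesz_lambda1 \<alpha> \<Omega> = (GREATEST l. riesz_eigenvalue \<alpha> \<Omega> (complex_of_real l))"

end

theory Submission
  imports Defs "HOL-Complex_Analysis.Great_Picard"
begin

text \<open>Since the kernel is nonnegative and symmetric, the largest eigenvalue on \<open>\<Omega>\<close> is the supremum of the
  quotient of the energy of \<open>f\<close>, which is the double integral of \<open>f x * f y * k (x - y)\<close>, and the integral of
  \<open>f\<^sup>2\<close> over nonnegative \<open>f\<close> vanishing outside \<open>\<Omega>\<close>; it is attained because the operator is compact.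
  Polarization in a hyperplane preserves the integral of \<open>f\<^sup>2\<close> and does not decrease the energy, since \<open>k\<close>
  decreases with the distance. Hence the supremum does not decrease when the set is polarized. By finitely
  many polarizations a bounded set of volume at most that of the ball is moved into the ball up to a set of
  arbitrarily small measure, and such a set changes the supremum only a little. No symmetric decreasing
  rearrangement of functions is needed.\<close>


text \<open>Two points need quantitative control. \<open>GREATEST\<close> says nothing unless a
  largest eigenvalue exists, and a maximising sequence must be shown not to lose its mass in the
  limit: the kernel is cut at a small distance, the cut operator smooths, and the rest has small
  integral because \<beta> = d - \<alpha> is below d. On the geometric side, a limit of polarized
  sets would call for a compactness argument. Instead each polarization removes from the outside of
  the ball at least a volume \<open>g\<close> that depends only on the dimension, the radii
  \<open>r\<close> and \<open>R\<close> and the target \<open>\<delta>\<close>, so the number of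
  steps is bounded in advance. This \<open>g\<close> comes from averaging over the reflection
  vector, and the map from \<open>v\<close> to the reflection of a fixed point is then controlled
  through its Lipschitz constant; hence the opening section. The eigenvalue bound is phrased as
  \<open>qbound\<close>, a statement on all functions supported in a set, and is pulled back from
  the polarized set to the original one. Since \<open>R\<close> must be finite, unbounded sets are
  exhausted by bounded ones.\<close>

section \<open>Lipschitz images and isometric involutions\<close>

text \<open>Vitali: up to a null set, \<open>U\<close> is a countable disjoint union of balls. Each
  goes into a closed ball whose radius has grown by the factor \<open>L\<close>, and null sets go to
  null sets. Balls have an exact volume, so no dimensional factor is lost; the constant 1 for
  isometries depends on this. A Borel set \<open>T\<close> inside the image keeps the measurability
  of images out of the statement.\<close>

lemma emeasure_Lipschitz_image_open:
  fixes f :: "'a::euclidean_space \<Rightarrow> 'a"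
  assumes "open U" and T: "T \<in> sets borel" "T \<subseteq> f ` U"
    and L: "0 < L" "\<And>x y. x \<in> U \<Longrightarrow> y \<in> U \<Longrightarrow> norm (f x - f y) \<le> L * norm (x - y)"
  shows "emeasure lborel T \<le> ennreal (L ^ DIM('a)) * emeasure lborel U"
proof -
  define K where "K = {p :: 'a \<times> real. 0 < snd p \<and> ball (fst p) (snd p) \<subseteq> U}"
  obtain C where C: "countable C" "C \<subseteq> K"
     "pairwise (\<lambda>i j. disjnt (ball (fst i) (snd i)) (ball (fst j) (snd j))) C"
     "negligible (U - (\<Union>i \<in> C. ball (fst i) (snd i)))"
  proof (rule Vitali_covering_theorem_balls[of U K fst snd])
    fix x and d :: real assume "x \<in> U" "0 < d"
    obtain e where "e > 0" "ball x e \<subseteq> U" using \<open>open U\<close> \<open>x \<in> U\<close> openE by blast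
    then have "ball x (min e (d/2)) \<subseteq> U" by auto
    then show "\<exists>i. i \<in> K \<and> x \<in> ball (fst i) (snd i) \<and> snd i < d"
      using \<open>e > 0\<close> \<open>0 < d\<close> by (intro exI[of _ "(x, min e (d/2))"]) (auto simp: K_def)
  qed
  define N where "N = U - (\<Union>i \<in> C. ball (fst i) (snd i))"
  have NU: "N \<subseteq> U" by (auto simp: N_def)
  have neg: "negligible (f ` N)"
  proof (rule negligible_locally_Lipschitz_image)
    show "negligible N" using C by (simp add: N_def)
    fix x assume "x \<in> N"
    then show "\<exists>T B. open T \<and> x \<in> T \<and> (\<forall>y \<in> N \<inter> T. norm (f y - f x) \<le> B * norm (y - x))"
      using L(2) NU \<open>open U\<close> by (intro exI[of _ U] exI[of _ L]) auto
  qed simp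
  let ?W = "\<Union>i \<in> C. cball (f (fst i)) (L * snd i)"
  have W: "?W \<in> sets lborel" using C(1) by (intro sets.countable_UN') auto
  have TW: "T \<subseteq> ?W \<union> f ` N"
  proof
    fix y assume "y \<in> T"
    then obtain x where x: "x \<in> U" "y = f x" using T by auto
    show "y \<in> ?W \<union> f ` N"
    proof (cases "x \<in> N")
      case False
      then obtain i where i: "i \<in> C" "x \<in> ball (fst i) (snd i)" using x by (auto simp: N_def)
      then have "fst i \<in> ball (fst i) (snd i)" "ball (fst i) (snd i) \<subseteq> U"
        using C(2) by (auto simp: K_def simp del: mem_ball)
      then have "fst i \<in> U" by blast
      then have "norm (f (fst i) - f x) \<le> L * norm (fst i - x)" using L(2) x by auto
      also have "\<dots> \<le> L * snd i" using i L(1) by (auto simp: dist_norm)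
      finally show ?thesis using i x by (auto simp: dist_norm)
    qed (use x in auto)
  qed
  have cnt: "emeasure lborel (cball (f (fst i)) (L * snd i)) =
      ennreal (L ^ DIM('a)) * emeasure lborel (ball (fst i) (snd i))" if "i \<in> C" for i
  proof -
    have "0 < snd i" using that C(2) by (auto simp: K_def)
    then show ?thesis using L(1)
      by (simp add: emeasure_cball emeasure_ball power_mult_distrib mult.assoc mult.left_commute
            flip: ennreal_mult')
  qed
  have "emeasure lborel T = emeasure lebesgue T" using T by simp
  also have "\<dots> \<le> emeasure lebesgue (?W \<union> f ` N)"
    using TW W neg by (intro emeasure_mono sets.Un) (auto simp: negligible_iff_null_sets)
  also have "\<dots> = emeasure lborel ?W"
    using W neg by (simp add: emeasure_Un_null_set negligible_iff_null_sets)
  also have "\<dots> \<le> (\<integral>\<^sup>+ i. emeasure lborel (cball (f (fst i)) (L * snd i)) \<partial>count_space C)"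
  proof -
    have "emeasure lborel ?W = (\<integral>\<^sup>+ x. indicator ?W x \<partial>lborel)" using W by simp
    also have "\<dots> \<le> (\<integral>\<^sup>+ x. (\<integral>\<^sup>+ i. indicator (cball (f (fst i)) (L * snd i)) x \<partial>count_space C) \<partial>lborel)"
    proof (rule nn_integral_mono)
      fix x
      show "indicator ?W x \<le> (\<integral>\<^sup>+ i. indicator (cball (f (fst i)) (L * snd i)) x \<partial>count_space C)"
      proof (cases "x \<in> ?W")
        case True
        then obtain i where i: "i \<in> C" "x \<in> cball (f (fst i)) (L * snd i)" by blast
        show ?thesis
          using nn_integral_ge_point[OF i(1), of "\<lambda>i. indicator (cball (f (fst i)) (L * snd i)) x"] i(2) True
          by simp
      qed simp
    qed
    also have "\<dots> = (\<integral>\<^sup>+ i. (\<integral>\<^sup>+ x. indicator (cball (f (fst i)) (L * snd i)) x \<partial>lborel) \<partial>count_space C)"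
      using C(1) by (rule nn_integral_count_space_nn_integral) (rule borel_measurable_indicator, simp)
    also have "\<dots> = (\<integral>\<^sup>+ i. emeasure lborel (cball (f (fst i)) (L * snd i)) \<partial>count_space C)"
      by (intro nn_integral_cong nn_integral_indicator) simp
    finally show ?thesis .
  qed
  also have "\<dots> = (\<integral>\<^sup>+ i. ennreal (L ^ DIM('a)) * emeasure lborel (ball (fst i) (snd i)) \<partial>count_space C)"
    by (intro nn_integral_cong) (use cnt in auto)
  also have "\<dots> = ennreal (L ^ DIM('a)) * (\<integral>\<^sup>+ i. emeasure lborel (ball (fst i) (snd i)) \<partial>count_space C)"
    by (simp add: nn_integral_cmult)
  also have "(\<integral>\<^sup>+ i. emeasure lborel (ball (fst i) (snd i)) \<partial>count_space C) =
      emeasure lborel (\<Union>i\<in>C. ball (fst i) (snd i))"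
    using C by (intro emeasure_UN_countable[symmetric])
      (auto simp: disjoint_family_on_def pairwise_def disjnt_def)
  also have "\<dots> \<le> emeasure lborel U"
    using \<open>open U\<close> C(2) by (intro emeasure_mono) (auto simp: K_def simp del: mem_ball)
  finally show ?thesis by (simp add: mult_left_mono)
qed

text \<open>Outer regularity reduces this to the open case: an open \<open>V\<close> around
  \<open>S\<close> exceeds it by arbitrarily little volume.\<close>

lemma emeasure_Lipschitz_image:
  fixes f :: "'a::euclidean_space \<Rightarrow> 'a"
  assumes "open U" and S: "S \<in> sets borel" "S \<subseteq> U" and T: "T \<in> sets borel" "T \<subseteq> f ` S"
    and L: "0 < L" "\<And>x y. x \<in> U \<Longrightarrow> y \<in> U \<Longrightarrow> norm (f x - f y) \<le> L * norm (x - y)"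
  shows "emeasure lborel T \<le> ennreal (L ^ DIM('a)) * emeasure lborel S"
proof (cases "emeasure lborel S = \<infinity>")
  case True
  then show ?thesis using L by (simp add: ennreal_mult_top)
next
  case False
  have "emeasure lborel T \<le> ennreal (L ^ DIM('a)) * emeasure lborel S + ennreal e" if "0 < e" for e
  proof -
    have pos: "0 < e / L ^ DIM('a)" using that L by simp
    have "S \<in> sets lebesgue" using S by simp
    then obtain V where V: "open V" "S \<subseteq> V"
        and Vm: "emeasure lebesgue (V - S) < ennreal (e / L ^ DIM('a))"
      using sets_lebesgue_outer_open pos by metis
    have "emeasure lborel T \<le> ennreal (L ^ DIM('a)) * emeasure lborel (U \<inter> V)"
    proof (rule emeasure_Lipschitz_image_open[of _ _ f])
      show "T \<subseteq> f ` (U \<inter> V)" using T(2) S(2) V(2) by blast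
    qed (use assms V in auto)
    also have "\<dots> \<le> ennreal (L ^ DIM('a)) * (emeasure lborel S + ennreal (e / L ^ DIM('a)))"
    proof (rule mult_left_mono)
      have "emeasure lborel (U \<inter> V) \<le> emeasure lborel (S \<union> (V - S))"
        using V S by (intro emeasure_mono) auto
      also have "\<dots> \<le> emeasure lborel S + emeasure lborel (V - S)"
        using V S by (intro emeasure_subadditive) auto
      also have "\<dots> \<le> emeasure lborel S + ennreal (e / L ^ DIM('a))"
        using Vm V S by (intro add_left_mono) simp
      finally show "emeasure lborel (U \<inter> V) \<le> emeasure lborel S + ennreal (e / L ^ DIM('a))" .
    qed simp
    also have "\<dots> = ennreal (L ^ DIM('a)) * emeasure lborel S + ennreal (L ^ DIM('a)) * ennreal (e / L ^ DIM('a))"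
      by (rule distrib_left)
    also have "ennreal (L ^ DIM('a)) * ennreal (e / L ^ DIM('a)) = ennreal e"
      using L(1) that by (subst ennreal_mult'[symmetric]) auto
    finally show ?thesis .
  qed
  then show ?thesis by (rule ennreal_le_epsilon)
qed

text \<open>An isometry does not increase volume, and applying this to the involution twice gives equality.\<close>

lemma distr_lborel_isometric_involution:
  fixes f :: "'a::euclidean_space \<Rightarrow> 'a"
  assumes inv: "\<And>x. f (f x) = x" and iso: "\<And>x y. norm (f x - f y) = norm (x - y)"
  shows "distr lborel borel f = lborel"
proof -
  have cont: "continuous_on UNIV f"
    by (rule lipschitz_on_continuous_on[of 1]) (auto simp: lipschitz_on_def dist_norm iso)
  have m[measurable]: "f \<in> borel_measurable borel" using cont by (rule borel_measurable_continuous_onI)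
  show ?thesis
  proof (rule measure_eqI)
    fix A assume "A \<in> sets (distr lborel borel f)"
    then have A[measurable]: "A \<in> sets borel" by simp
    have A': "f -` A \<in> sets borel" using measurable_sets[OF m A] by simp
    have im: "f ` A = f -` A" using inv by (auto simp: image_iff) metis
    have "emeasure lborel (f -` A) \<le> ennreal (1 ^ DIM('a)) * emeasure lborel A"
      using im A' by (intro emeasure_Lipschitz_image[of UNIV _ _ f]) (auto simp: iso)
    moreover have "f ` (f -` A) = A" using inv by (auto simp: image_iff) metis
    then have "emeasure lborel A \<le> ennreal (1 ^ DIM('a)) * emeasure lborel (f -` A)"
      using A' by (intro emeasure_Lipschitz_image[of UNIV _ _ f]) (auto simp: iso)
    ultimately show "emeasure (distr lborel borel f) A = emeasure lborel A"
      by (simp add: emeasure_distr)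
  qed simp
qed

section \<open>The Riesz kernel\<close>

lemma nn_integral_isometric_involution:
  fixes f :: "'a::euclidean_space \<Rightarrow> 'a"
  assumes inv: "\<And>x. f (f x) = x" and iso: "\<And>x y. norm (f x - f y) = norm (x - y)"
    and g: "g \<in> borel_measurable borel"
  shows "(\<integral>\<^sup>+ x. g (f x) \<partial>lborel) = (\<integral>\<^sup>+ x. g x \<partial>lborel)"
proof -
  have "f \<in> borel_measurable borel"
    by (intro borel_measurable_continuous_onI lipschitz_on_continuous_on[of 1])
      (auto simp: lipschitz_on_def dist_norm iso)
  then have "(\<integral>\<^sup>+ x. g x \<partial>distr lborel borel f) = (\<integral>\<^sup>+ x. g (f x) \<partial>lborel)"
    using g by (intro nn_integral_distr) auto
  then show ?thesis by (simp add: distr_lborel_isometric_involution[OF inv iso])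
qed

lemma nn_integral_reflect_translate:
  fixes g :: "'a::euclidean_space \<Rightarrow> ennreal"
  assumes "g \<in> borel_measurable borel"
  shows "(\<integral>\<^sup>+ y. g (x - y) \<partial>lborel) = (\<integral>\<^sup>+ y. g y \<partial>lborel)"
  by (rule nn_integral_isometric_involution[where f="\<lambda>y. x - y"]) (use assms in \<open>auto simp: norm_minus_commute\<close>)

text \<open>In the application \<beta> is d - \<alpha>. The condition \<beta> < d makes the kernel
  locally integrable, and 0 < \<beta> makes it decrease with the distance.\<close>

locale riesz_kernel =
  fixes C \<beta> :: real and k :: "'a::euclidean_space \<Rightarrow> real"
  assumes C_pos: "0 < C" and \<beta>_pos: "0 < \<beta>" and \<beta>_less: "\<beta> < real DIM('a)"
    and k_def: "k = (\<lambda>z. C * norm z powr - \<beta>)"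
begin

text \<open>Capping the kernel at its value on the sphere of radius \<open>\<rho>\<close> keeps it
  Lipschitz; replacing it by 0 there would create a jump.\<close>

definition k_trunc :: "real \<Rightarrow> 'a \<Rightarrow> real" where
  "k_trunc \<rho> z = C * max \<rho> (norm z) powr - \<beta>"

definition k_near :: "real \<Rightarrow> 'a \<Rightarrow> real" where
  "k_near \<rho> z = k z * indicator (ball 0 \<rho>) z"

definition near :: "real \<Rightarrow> ennreal" where
  "near \<rho> = (\<integral>\<^sup>+ z. ennreal (k_near \<rho> z) \<partial>lborel)"

lemma k_eq: "k z = C * norm z powr - \<beta>"
  by (simp add: k_def)

lemma k_measurable [measurable]: "k \<in> borel_measurable borel"
  unfolding k_def by measurable

lemma k_trunc_measurable [measurable]: "k_trunc \<rho> \<in> borel_measurable borel"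
  unfolding k_trunc_def[abs_def] by measurable

lemma k_near_measurable [measurable]: "k_near \<rho> \<in> borel_measurable borel"
  unfolding k_near_def[abs_def] by (intro borel_measurable_times borel_measurable_indicator k_measurable) auto

lemma k_nonneg [simp]: "0 \<le> k z"
  using C_pos by (simp add: k_def)

lemma k_0 [simp]: "k 0 = 0"
  by (simp add: k_def)

lemma k_pos: "z \<noteq> 0 \<Longrightarrow> 0 < k z"
  using C_pos by (simp add: k_def)

lemma k_commute: "k (x - y) = k (y - x)"
  by (simp add: k_def norm_minus_commute)

text \<open>\<open>0 powr a\<close> is 0, so \<open>k\<close> vanishes at the origin, where the
  kernel should be infinite. Monotonicity therefore needs \<open>z \<noteq> 0\<close>, and its users
  remove the diagonal as a null set.\<close>

lemma k_antimono: "z \<noteq> 0 \<Longrightarrow> norm z \<le> norm w \<Longrightarrow> k w \<le> k z"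
  using C_pos \<beta>_pos by (auto simp: k_def intro!: mult_left_mono powr_mono2')

lemma k_trunc_nonneg [simp]: "0 \<le> k_trunc \<rho> z"
  using C_pos by (simp add: k_trunc_def)

lemma k_near_nonneg [simp]: "0 \<le> k_near \<rho> z"
  by (simp add: k_near_def)

lemma k_trunc_le: "0 < \<rho> \<Longrightarrow> k_trunc \<rho> z \<le> C * \<rho> powr - \<beta>"
  using C_pos \<beta>_pos by (auto simp: k_trunc_def intro!: mult_left_mono powr_mono2')

lemma k_trunc_antimono: "0 < \<rho> \<Longrightarrow> \<rho> \<le> \<sigma> \<Longrightarrow> k_trunc \<sigma> z \<le> k_trunc \<rho> z"
  using C_pos \<beta>_pos by (auto simp: k_trunc_def intro!: mult_left_mono powr_mono2')

lemma k_trunc_le_k: "0 < \<rho> \<Longrightarrow> z \<noteq> 0 \<Longrightarrow> k_trunc \<rho> z \<le> k z"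
  using C_pos \<beta>_pos by (auto simp: k_trunc_def k_def intro!: mult_left_mono powr_mono2')

lemma k_trunc_eq_k: "\<rho> \<le> norm z \<Longrightarrow> k_trunc \<rho> z = k z"
  by (simp add: k_trunc_def k_def max_def)

lemma k_le_k_trunc_plus_k_near: "k z \<le> k_trunc \<rho> z + k_near \<rho> z"
proof (cases "norm z < \<rho>")
  case True
  then show ?thesis using k_trunc_nonneg[of \<rho> z] by (simp add: k_near_def)
next
  case False
  then show ?thesis by (simp add: k_trunc_eq_k)
qed

text \<open>Mean value inequality for \<open>u powr - \<beta>\<close> on \<open>{\<rho>..}\<close>,
  where the derivative is largest at \<open>\<rho>\<close>, together with the fact that
  \<open>max \<rho> (norm z)\<close> is 1-Lipschitz in \<open>z\<close>.\<close>

lemma k_trunc_Lipschitz: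
  assumes "0 < \<rho>"
  shows "\<bar>k_trunc \<rho> z - k_trunc \<rho> w\<bar> \<le> C * \<beta> * \<rho> powr (- \<beta> - 1) * norm (z - w)"
proof -
  have D: "\<bar>s powr - \<beta> - t powr - \<beta>\<bar> \<le> \<beta> * \<rho> powr (- \<beta> - 1) * \<bar>s - t\<bar>" if "\<rho> \<le> s" "\<rho> \<le> t" for s t
  proof -
    have "norm (s powr - \<beta> - t powr - \<beta>) \<le> (\<beta> * \<rho> powr (- \<beta> - 1)) * norm (s - t)"
    proof (rule field_differentiable_bound[where S="{\<rho>..}" and f="\<lambda>u. u powr - \<beta>" and f'="\<lambda>u. - \<beta> * u powr (- \<beta> - 1)"])
      fix u assume "u \<in> {\<rho>..}"
      then have u: "\<rho> \<le> u" "0 < u" using assms by auto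
      then show "((\<lambda>u. u powr - \<beta>) has_field_derivative - \<beta> * u powr (- \<beta> - 1)) (at u within {\<rho>..})"
        by (intro DERIV_subset[OF has_real_derivative_powr]) auto
      have "u powr (- \<beta> - 1) \<le> \<rho> powr (- \<beta> - 1)" using u assms \<beta>_pos by (intro powr_mono2') auto
      then show "norm (- \<beta> * u powr (- \<beta> - 1)) \<le> \<beta> * \<rho> powr (- \<beta> - 1)"
        using \<beta>_pos by (simp add: abs_mult)
    qed (use that in auto)
    then show ?thesis by simp
  qed
  have "\<bar>k_trunc \<rho> z - k_trunc \<rho> w\<bar> = C * \<bar>max \<rho> (norm z) powr - \<beta> - max \<rho> (norm w) powr - \<beta>\<bar>"
    using C_pos by (simp add: k_trunc_def abs_mult flip: right_diff_distrib)
  also have "\<dots> \<le> C * (\<beta> * \<rho> powr (- \<beta> - 1) * \<bar>max \<rho> (norm z) - max \<rho> (norm w)\<bar>)"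
    using C_pos by (intro mult_left_mono D) auto
  also have "\<dots> \<le> C * (\<beta> * \<rho> powr (- \<beta> - 1) * norm (z - w))"
  proof -
    have "\<bar>max \<rho> (norm z) - max \<rho> (norm w)\<bar> \<le> norm (z - w)"
      using norm_triangle_ineq3[of z w] by (simp add: max_def abs_if split: if_splits)
    then show ?thesis using C_pos \<beta>_pos by (intro mult_left_mono) auto
  qed
  finally show ?thesis by (simp add: mult.assoc)
qed

text \<open>Dyadic shells: between the radii \<open>(1/2) ^ Suc j\<close> and
  \<open>(1/2) ^ j\<close> the kernel is at most its value at the inner radius. Times the volume of
  the outer ball this is a multiple of \<open>q ^ j\<close>, and \<open>q < 1\<close> is exactly
  \<beta> < d.\<close>

lemma near_1_finite: "near 1 < \<infinity>"
proof -
  define q where "q = (1/2 :: real) powr (real DIM('a) - \<beta>)"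
  define \<omega> where "\<omega> = measure lborel (ball (0::'a) 1)"
  have q: "0 < q" "q < 1"
    using \<beta>_less powr_less_mono'[of "1/2" 0 "real DIM('a) - \<beta>"] by (auto simp: q_def)
  let ?t = "\<lambda>j z. ennreal (C * ((1/2) ^ Suc j) powr - \<beta>) * indicator (ball (0::'a) ((1/2) ^ j)) z"
  have single: "sum u {j} = u j" for u :: "nat \<Rightarrow> ennreal" and j by simp
  have pw: "ennreal (k_near 1 z) \<le> (\<Sum>j. ?t j z)" for z
  proof (cases "z \<noteq> 0 \<and> norm z < 1")
    case True
    then obtain m where "(1/2) ^ m < norm z"
      using real_arch_pow_inv[of "norm z" "1/2"] by auto
    then have ex: "\<exists>m. (1/2) ^ m \<le> norm z" by (auto intro: less_imp_le)
    \<comment> \<open>The least such exponent determines the shell of \<open>z\<close>; it is not 0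
      because \<open>norm z < 1\<close>.\<close>
    define n where "n = (LEAST m. (1/2) ^ m \<le> norm z)"
    have n: "(1/2) ^ n \<le> norm z" unfolding n_def using ex by (rule LeastI_ex)
    have "n \<noteq> 0" using n True by (cases n) auto
    then obtain j where j: "n = Suc j" by (cases n) auto
    have "\<not> (1/2) ^ j \<le> norm z" using not_less_Least[of j "\<lambda>m. (1/2) ^ m \<le> norm z"] j n_def by auto
    then have zj: "norm z < (1/2) ^ j" by simp
    have "k_near 1 z = C * norm z powr - \<beta>" using True by (simp add: k_near_def k_eq)
    also have "\<dots> \<le> C * ((1/2) ^ Suc j) powr - \<beta>"
      using n j C_pos \<beta>_pos by (intro mult_left_mono powr_mono2') auto
    finally have "ennreal (k_near 1 z) \<le> ?t j z" using zj by (simp add: ennreal_leI)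
    also have "\<dots> = sum (\<lambda>j. ?t j z) {j}" by (rule single[symmetric])
    also have "\<dots> \<le> (\<Sum>j. ?t j z)" by (rule sum_le_suminf) auto
    finally show ?thesis .
  qed (auto simp: k_near_def)
  have "near 1 \<le> (\<integral>\<^sup>+ z. (\<Sum>j. ?t j z) \<partial>lborel)"
    unfolding near_def by (intro nn_integral_mono pw)
  also have "\<dots> = (\<Sum>j. \<integral>\<^sup>+ z. ?t j z \<partial>lborel)"
    by (rule nn_integral_suminf)
      (intro borel_measurable_times_ennreal borel_measurable_const borel_measurable_indicator, simp)
  also have "\<dots> = (\<Sum>j. ennreal (C * 2 powr \<beta> * \<omega> * q ^ j))"
  proof (rule suminf_cong)
    fix j
    have fin: "emeasure lborel (ball (0::'a) ((1/2) ^ j)) = ennreal (\<omega> * ((1/2) ^ j) ^ DIM('a))"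
      using content_ball_conv_unit_ball[of "(1/2)^j" "0::'a"]
        emeasure_lborel_ball_finite[of "0::'a" "(1/2)^j"]
      by (subst emeasure_eq_ennreal_measure) (auto simp: \<omega>_def)
    have pw: "((1/2) ^ Suc j) powr - \<beta> * ((1/2::real) ^ j) ^ DIM('a) = 2 powr \<beta> * q ^ j"
    proof -
      have half: "(1/2) ^ m = (2::real) powr - real m" for m
        by (simp add: powr_minus powr_realpow power_one_over inverse_eq_divide)
      have "((1/2) ^ Suc j) powr - \<beta> = (2::real) powr (\<beta> * Suc j)"
        by (simp only: half powr_powr) (simp add: algebra_simps)
      moreover have "((1/2::real) ^ j) ^ DIM('a) = 2 powr - (real j * DIM('a))"
        by (subst power_mult[symmetric]) (simp only: half of_nat_mult)
      moreover have "q ^ j = 2 powr - (real j * (DIM('a) - \<beta>))"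
        using q by (simp add: q_def powr_realpow[symmetric] powr_powr powr_divide powr_minus inverse_eq_divide mult.commute)
      ultimately show ?thesis by (simp add: powr_add[symmetric] algebra_simps)
    qed
    have "(\<integral>\<^sup>+ z. ?t j z \<partial>lborel) = ennreal (C * ((1/2) ^ Suc j) powr - \<beta>) * ennreal (\<omega> * ((1/2) ^ j) ^ DIM('a))"
      by (subst nn_integral_cmult_indicator) (simp_all add: fin del: power_Suc)
    also have "\<dots> = ennreal (C * \<omega> * (((1/2) ^ Suc j) powr - \<beta> * ((1/2::real) ^ j) ^ DIM('a)))"
      using C_pos by (subst ennreal_mult[symmetric]) (auto simp: \<omega>_def mult_ac)
    finally show "(\<integral>\<^sup>+ z. ?t j z \<partial>lborel) = ennreal (C * 2 powr \<beta> * \<omega> * q ^ j)"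
      unfolding pw by (simp add: mult_ac)
  qed
  also have "\<dots> < \<infinity>"
  proof -
    have "summable (\<lambda>j. C * 2 powr \<beta> * \<omega> * q ^ j)" using q by (intro summable_mult summable_geometric) auto
    then have "(\<Sum>j. ennreal (C * 2 powr \<beta> * \<omega> * q ^ j)) = ennreal (\<Sum>j. C * 2 powr \<beta> * \<omega> * q ^ j)"
      using q C_pos by (intro suminf_ennreal2) (auto simp: \<omega>_def)
    then show ?thesis by simp
  qed
  finally show ?thesis .
qed

lemma near_tendsto_0: "(\<lambda>n. near (inverse (real (Suc n)))) \<longlonglongrightarrow> 0"
proof -
  have "(\<lambda>n. \<integral>\<^sup>+ z. ennreal (k_near (inverse (real (Suc n))) z) \<partial>lborel) \<longlonglongrightarrow> (\<integral>\<^sup>+ z. 0 \<partial>(lborel :: 'a measure))"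
  proof (rule nn_integral_dominated_convergence[where w="\<lambda>z. ennreal (k_near 1 z)"])
    show "AE z in lborel. ennreal (k_near (inverse (real (Suc j))) z) \<le> ennreal (k_near 1 z)" for j
    proof (intro AE_I2 ennreal_leI)
      fix z :: 'a
      have "inverse (real (Suc j)) \<le> 1" by (simp add: field_simps)
      then show "k_near (inverse (real (Suc j))) z \<le> k_near 1 z" by (auto simp: k_near_def indicator_def)
    qed
    show "AE z in lborel. (\<lambda>i. ennreal (k_near (inverse (real (Suc i))) z)) \<longlonglongrightarrow> 0"
    proof (intro AE_I2)
      fix z :: 'a
      show "(\<lambda>i. ennreal (k_near (inverse (real (Suc i))) z)) \<longlonglongrightarrow> 0"
      proof (cases "z = 0")
        case False
        then have "eventually (\<lambda>i. inverse (real (Suc i)) < norm z) sequentially"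
          using LIMSEQ_inverse_real_of_nat order_tendstoD(2)[of _ 0 sequentially "norm z"] by auto
        then have "eventually (\<lambda>i. ennreal (k_near (inverse (real (Suc i))) z) = 0) sequentially"
          by eventually_elim (simp add: k_near_def)
        then show ?thesis by (rule tendsto_eventually)
      qed (simp add: k_near_def)
    qed
    show "(\<integral>\<^sup>+ z. ennreal (k_near 1 z) \<partial>lborel) < \<infinity>" using near_1_finite by (simp add: near_def)
  qed auto
  then show ?thesis by (simp add: near_def)
qed

lemma near_small:
  assumes "0 < e"
  obtains \<rho> where "0 < \<rho>" "near \<rho> < ennreal e"
proof -
  have "eventually (\<lambda>n. near (inverse (real (Suc n))) < ennreal e) sequentially"
    using near_tendsto_0 assms by (intro order_tendstoD(2)[of _ 0]) auto
  then obtain n where "near (inverse (real (Suc n))) < ennreal e"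
    by (auto simp: eventually_sequentially)
  then show ?thesis by (intro that[of "inverse (real (Suc n))"]) auto
qed

lemma k_near_integral: "(\<integral>\<^sup>+ y. ennreal (k_near \<rho> (x - y)) \<partial>lborel) = near \<rho>"
  unfolding near_def using nn_integral_reflect_translate[of "\<lambda>z. ennreal (k_near \<rho> z)" x] by simp

text \<open>Within distance \<open>\<rho>\<close> the full mass \<open>near \<rho>\<close> is paid,
  whatever \<open>D\<close> is; beyond it the kernel is at most
  \<open>C * \<rho> powr - \<beta>\<close>.\<close>

lemma k_integral_le:
  assumes [measurable]: "D \<in> sets borel" and "0 < \<rho>"
  shows "(\<integral>\<^sup>+ y. ennreal (k (x - y)) * indicator D y \<partial>lborel) \<le> near \<rho> + ennreal (C * \<rho> powr - \<beta>) * emeasure lborel D"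
proof -
  have "(\<integral>\<^sup>+ y. ennreal (k (x - y)) * indicator D y \<partial>lborel) \<le>
      (\<integral>\<^sup>+ y. ennreal (k_near \<rho> (x - y)) + ennreal (C * \<rho> powr - \<beta>) * indicator D y \<partial>lborel)"
  proof (rule nn_integral_mono)
    fix y
    have "k (x - y) \<le> k_near \<rho> (x - y) + C * \<rho> powr - \<beta>"
      using k_le_k_trunc_plus_k_near[of "x - y" \<rho>] k_trunc_le[OF assms(2), of "x - y"] by simp
    then show "ennreal (k (x - y)) * indicator D y \<le> ennreal (k_near \<rho> (x - y)) + ennreal (C * \<rho> powr - \<beta>) * indicator D y"
      using C_pos by (auto simp: indicator_def simp flip: ennreal_plus intro!: ennreal_leI)
  qed
  also have "\<dots> = near \<rho> + ennreal (C * \<rho> powr - \<beta>) * emeasure lborel D"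
    by (simp add: nn_integral_add nn_integral_cmult k_near_integral)
  finally show ?thesis .
qed

lemma k_integral_bounded:
  assumes "D \<in> sets borel" "emeasure lborel D < \<infinity>"
  obtains c where "0 < c" "\<And>x. (\<integral>\<^sup>+ y. ennreal (k (x - y)) * indicator D y \<partial>lborel) \<le> ennreal c"
proof -
  have f: "near 1 + ennreal (C * 1 powr - \<beta>) * emeasure lborel D < \<infinity>"
    using near_1_finite assms by (simp add: ennreal_mult_less_top)
  define c where "c = enn2real (near 1 + ennreal (C * 1 powr - \<beta>) * emeasure lborel D) + 1"
  have "near 1 + ennreal (C * 1 powr - \<beta>) * emeasure lborel D \<le> ennreal c"
    (is "?X \<le> _")
  proof -
    have "?X = ennreal (enn2real ?X)" using f by (simp add: less_top)
    also have "\<dots> \<le> ennreal c" unfolding c_def by (intro ennreal_leI) simp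
    finally show ?thesis .
  qed
  moreover have "0 < c" by (simp add: c_def add_nonneg_pos)
  ultimately show ?thesis using that[of c] k_integral_le[OF assms(1), of 1] by (meson order_trans zero_less_one)
qed

text \<open>Absolute continuity, uniform in \<open>x\<close>: first \<open>\<rho>\<close> is chosen
  so that the near part costs at most \<open>e / 2\<close>, then \<open>\<delta>\<close> against the
  now fixed bound of the far part.\<close>

lemma k_integral_small:
  assumes "0 < e"
  obtains \<delta> where "0 < \<delta>" "\<And>D x. D \<in> sets borel \<Longrightarrow> emeasure lborel D \<le> ennreal \<delta> \<Longrightarrow>
      (\<integral>\<^sup>+ y. ennreal (k (x - y)) * indicator D y \<partial>lborel) \<le> ennreal e"
proof -
  obtain \<rho> where \<rho>: "0 < \<rho>" "near \<rho> < ennreal (e/2)" using near_small[of "e/2"] assms by auto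
  define c where "c = C * \<rho> powr - \<beta>"
  have c: "0 < c" using C_pos \<rho> by (simp add: c_def)
  show ?thesis
  proof (rule that[of "e / (2 * c)"])
    fix D x assume D: "(D::'a set) \<in> sets borel" "emeasure lborel D \<le> ennreal (e / (2 * c))"
    have "(\<integral>\<^sup>+ y. ennreal (k (x - y)) * indicator D y \<partial>lborel) \<le> near \<rho> + ennreal c * emeasure lborel D"
      unfolding c_def by (rule k_integral_le[OF D(1) \<rho>(1)])
    also have "\<dots> \<le> ennreal (e/2) + ennreal c * ennreal (e / (2 * c))"
      using \<rho> D by (intro add_mono mult_left_mono) auto
    also have "\<dots> = ennreal e"
      using c assms by (auto simp flip: ennreal_mult ennreal_plus)
    finally show "(\<integral>\<^sup>+ y. ennreal (k (x - y)) * indicator D y \<partial>lborel) \<le> ennreal e" .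
  qed (use assms c in auto)
qed

end

section \<open>The operator on bounded functions\<close>

text \<open>A product of \<open>f\<close> and \<open>g\<close> is at most \<open>s / 2\<close> times
  the square of the first plus \<open>1 / (2 * s)\<close> times the square of the second. In each of
  the two terms one variable occurs only in the kernel and is integrated out. The free weight
  \<open>s\<close> decides which function pays for a cross term.\<close>

lemma weighted_Schur:
  fixes f g :: "'a::euclidean_space \<Rightarrow> real" and K :: "'a \<Rightarrow> 'a \<Rightarrow> real"
  assumes [measurable]: "f \<in> borel_measurable borel" "g \<in> borel_measurable borel"
      "(\<lambda>(x, y). K x y) \<in> borel_measurable (borel \<Otimes>\<^sub>M borel)"
    and K0: "\<And>x y. 0 \<le> K x y" and f0: "\<And>x. 0 \<le> f x" and g0: "\<And>x. 0 \<le> g x" and s: "0 < s"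
    and c1: "\<And>x. (\<integral>\<^sup>+ y. ennreal (K x y) \<partial>lborel) \<le> c1"
    and c2: "\<And>y. (\<integral>\<^sup>+ x. ennreal (K x y) \<partial>lborel) \<le> c2"
  shows "(\<integral>\<^sup>+ x. \<integral>\<^sup>+ y. ennreal (f x * g y * K x y) \<partial>lborel \<partial>lborel) \<le>
    ennreal (s / 2) * c1 * (\<integral>\<^sup>+ x. ennreal ((f x)\<^sup>2) \<partial>lborel) +
    ennreal (1 / (2 * s)) * c2 * (\<integral>\<^sup>+ x. ennreal ((g x)\<^sup>2) \<partial>lborel)"
proof -
  let ?F = "\<lambda>x y. ennreal (s / 2) * ennreal ((f x)\<^sup>2) * ennreal (K x y)"
  let ?G = "\<lambda>x y. ennreal (1 / (2 * s)) * ennreal ((g y)\<^sup>2) * ennreal (K x y)"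
  have [measurable]: "(\<lambda>(x, y). K x y) \<in> borel_measurable (lborel \<Otimes>\<^sub>M lborel)"
    using assms(3) by (simp cong: measurable_cong_sets)
  have pw: "ennreal (f x * g y * K x y) \<le>
      ?F x y + ?G x y" for x y
  proof -
    have "0 \<le> (s * f x - g y)\<^sup>2 / (2 * s)" using s by simp
    also have "(s * f x - g y)\<^sup>2 / (2 * s) = s / 2 * (f x)\<^sup>2 + 1 / (2 * s) * (g y)\<^sup>2 - f x * g y"
      using s by (simp add: power2_diff field_simps power2_eq_square)
    finally have "f x * g y * K x y \<le> (s / 2 * (f x)\<^sup>2 + 1 / (2 * s) * (g y)\<^sup>2) * K x y"
      using K0 by (intro mult_right_mono) auto
    then have "ennreal (f x * g y * K x y) \<le> ennreal (s / 2 * (f x)\<^sup>2 * K x y + 1 / (2 * s) * (g y)\<^sup>2 * K x y)"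
      by (intro ennreal_leI) (simp add: distrib_right)
    also have "\<dots> = ?F x y + ?G x y"
      using s K0 by (subst ennreal_plus) (simp_all only: ennreal_mult zero_le_power2 mult_nonneg_nonneg
        divide_nonneg_nonneg zero_le_one less_imp_le zero_le_numeral zero_le_divide_iff zero_le_mult_iff simp_thms)
    finally show ?thesis .
  qed
  have "(\<integral>\<^sup>+ x. \<integral>\<^sup>+ y. ennreal (f x * g y * K x y) \<partial>lborel \<partial>lborel) \<le>
     (\<integral>\<^sup>+ x. \<integral>\<^sup>+ y. ?F x y + ?G x y \<partial>lborel \<partial>lborel)"
    by (intro nn_integral_mono pw)
  also have "\<dots> = (\<integral>\<^sup>+ x. \<integral>\<^sup>+ y. ?F x y \<partial>lborel \<partial>lborel) +
     (\<integral>\<^sup>+ x. \<integral>\<^sup>+ y. ?G x y \<partial>lborel \<partial>lborel)"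
    by (simp add: nn_integral_add)
  also have "(\<integral>\<^sup>+ x. \<integral>\<^sup>+ y. ?G x y \<partial>lborel \<partial>lborel) =
     (\<integral>\<^sup>+ y. \<integral>\<^sup>+ x. ?G x y \<partial>lborel \<partial>lborel)"
    by (rule lborel_pair.Fubini'[symmetric]) measurable
  also have "\<dots> = (\<integral>\<^sup>+ y. ennreal (1 / (2 * s)) * ennreal ((g y)\<^sup>2) * (\<integral>\<^sup>+ x. ennreal (K x y) \<partial>lborel) \<partial>lborel)"
    by (simp add: nn_integral_cmult)
  also have "\<dots> \<le> (\<integral>\<^sup>+ y. ennreal (1 / (2 * s)) * ennreal ((g y)\<^sup>2) * c2 \<partial>lborel)"
    by (intro nn_integral_mono mult_left_mono c2) auto
  also have "\<dots> = ennreal (1 / (2 * s)) * c2 * (\<integral>\<^sup>+ x. ennreal ((g x)\<^sup>2) \<partial>lborel)"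
    by (simp add: nn_integral_cmult nn_integral_multc ac_simps)
  also have "(\<integral>\<^sup>+ x. \<integral>\<^sup>+ y. ?F x y \<partial>lborel \<partial>lborel) =
     (\<integral>\<^sup>+ x. ennreal (s / 2) * ennreal ((f x)\<^sup>2) * (\<integral>\<^sup>+ y. ennreal (K x y) \<partial>lborel) \<partial>lborel)"
    by (simp add: nn_integral_cmult)
  also have "\<dots> \<le> (\<integral>\<^sup>+ x. ennreal (s / 2) * ennreal ((f x)\<^sup>2) * c1 \<partial>lborel)"
    by (intro nn_integral_mono mult_left_mono c1) auto
  also have "\<dots> = ennreal (s / 2) * c1 * (\<integral>\<^sup>+ x. ennreal ((f x)\<^sup>2) \<partial>lborel)"
    by (simp add: nn_integral_cmult nn_integral_multc ac_simps)
  finally show ?thesis by (simp add: add_mono)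
qed

locale riesz_set = riesz_kernel C \<beta> k for C \<beta> and k :: "'a::euclidean_space \<Rightarrow> real" +
  fixes A :: "'a set"
  assumes A [measurable]: "A \<in> sets borel" and A_fin: "emeasure lborel A < \<infinity>"
begin

text \<open>Bounded functions stand in for the space L2: since \<open>A\<close> has finite measure,
  all integrals below converge absolutely and \<open>T f\<close> is defined at every point.
  Unbounded functions are reached by monotone limits in \<open>qbound_M\<close>.\<close>

definition bdd :: "('a \<Rightarrow> real) \<Rightarrow> bool" where
  "bdd f \<longleftrightarrow> f \<in> borel_measurable borel \<and> (\<exists>b. \<forall>x. \<bar>f x\<bar> \<le> b) \<and> (\<forall>x. x \<notin> A \<longrightarrow> f x = 0)"

definition T :: "('a \<Rightarrow> real) \<Rightarrow> 'a \<Rightarrow> real" where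
  "T f x = (LINT y|lborel. k (x - y) * f y)"

definition Q :: "('a \<Rightarrow> real) \<Rightarrow> ('a \<Rightarrow> real) \<Rightarrow> real" where
  "Q f g = (LINT x|lborel. f x * T g x)"

text \<open>Any bound uniform in \<open>x\<close> would serve; fixing one by choice keeps it out of
  the later statements.\<close>

definition k_mass :: real where
  "k_mass = (SOME c. 0 < c \<and> (\<forall>x. (\<integral>\<^sup>+ y. ennreal (k (x - y)) * indicator A y \<partial>lborel) \<le> ennreal c))"

lemma k_mass_pos: "0 < k_mass" and k_mass: "(\<integral>\<^sup>+ y. ennreal (k (x - y)) * indicator A y \<partial>lborel) \<le> ennreal k_mass"
proof -
  have "\<exists>c. 0 < c \<and> (\<forall>x. (\<integral>\<^sup>+ y. ennreal (k (x - y)) * indicator A y \<partial>lborel) \<le> ennreal c)"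
    using k_integral_bounded[OF A A_fin] by metis
  from someI_ex[OF this]
  show "0 < k_mass" and "(\<integral>\<^sup>+ y. ennreal (k (x - y)) * indicator A y \<partial>lborel) \<le> ennreal k_mass"
    by (auto simp: k_mass_def)
qed

lemma bdd_measurable: "bdd f \<Longrightarrow> f \<in> borel_measurable borel"
  by (simp add: bdd_def)

lemma bdd_outside: "bdd f \<Longrightarrow> x \<notin> A \<Longrightarrow> f x = 0"
  by (simp add: bdd_def)

lemma bdd_bound: assumes "bdd f" obtains b where "0 < b" "\<And>x. \<bar>f x\<bar> \<le> b * indicator A x"
proof -
  obtain b where b: "\<forall>x. \<bar>f x\<bar> \<le> b" using assms by (auto simp: bdd_def)
  have "0 \<le> b" using b[rule_format, of undefined] by simp
  have "\<bar>f x\<bar> \<le> (b + 1) * indicator A x" for x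
  proof (cases "x \<in> A")
    case True then show ?thesis using b[rule_format, of x] by simp
  next
    case False then show ?thesis using assms by (simp add: bdd_outside)
  qed
  with \<open>0 \<le> b\<close> show ?thesis by (intro that[of "b + 1"]) auto
qed

lemma bddI: assumes "f \<in> borel_measurable borel" "\<And>x. \<bar>f x\<bar> \<le> b * indicator A x" shows "bdd f"
proof -
  have "\<bar>f x\<bar> \<le> \<bar>b\<bar>" for x using assms(2)[of x] by (cases "x \<in> A") auto
  moreover have "f x = 0" if "x \<notin> A" for x using assms(2)[of x] that by simp
  ultimately show ?thesis using assms(1) by (auto simp: bdd_def)
qed

lemma indicator_integrable: "integrable lborel (indicator A :: 'a \<Rightarrow> real)"
  using A_fin by (intro integrable_real_indicator) auto

lemma bdd_integrable: assumes "bdd f" shows "integrable lborel f"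
proof -
  obtain b where b: "0 < b" "\<And>x. \<bar>f x\<bar> \<le> b * indicator A x" using bdd_bound[OF assms] by blast
  show ?thesis
  proof (rule Bochner_Integration.integrable_bound[OF integrable_mult_right[OF indicator_integrable, of b]])
    show "AE x in lborel. norm (f x) \<le> norm (b * indicator A x)"
      using b by (intro AE_I2) (auto simp: abs_mult)
  qed (use bdd_measurable[OF assms] in simp)
qed

lemma bdd_mult: assumes "bdd f" "bdd g" shows "bdd (\<lambda>x. f x * g x)"
proof -
  obtain b where b: "0 < b" "\<And>x. \<bar>f x\<bar> \<le> b * indicator A x" using bdd_bound[OF assms(1)] by blast
  obtain c where c: "0 < c" "\<And>x. \<bar>g x\<bar> \<le> c * indicator A x" using bdd_bound[OF assms(2)] by blast
  show ?thesis
  proof (rule bddI[of _ "b * c"])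
    fix x
    have "\<bar>f x * g x\<bar> \<le> (b * indicator A x) * (c * indicator A x)"
      unfolding abs_mult using b c by (intro mult_mono) auto
    then show "\<bar>f x * g x\<bar> \<le> b * c * indicator A x" by (auto simp: indicator_def split: if_splits)
  qed (use bdd_measurable[OF assms(1)] bdd_measurable[OF assms(2)] in simp)
qed

lemma bdd_square: "bdd f \<Longrightarrow> bdd (\<lambda>x. (f x)\<^sup>2)"
  using bdd_mult[of f f] by (simp add: power2_eq_square)

lemma bdd_lin: assumes "bdd f" "bdd g" shows "bdd (\<lambda>x. a * f x + d * g x)"
proof -
  obtain b where b: "0 < b" "\<And>x. \<bar>f x\<bar> \<le> b * indicator A x" using bdd_bound[OF assms(1)] by blast
  obtain c where c: "0 < c" "\<And>x. \<bar>g x\<bar> \<le> c * indicator A x" using bdd_bound[OF assms(2)] by blast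
  show ?thesis
  proof (rule bddI[of _ "\<bar>a\<bar> * b + \<bar>d\<bar> * c"])
    fix x
    have "\<bar>a * f x + d * g x\<bar> \<le> \<bar>a\<bar> * \<bar>f x\<bar> + \<bar>d\<bar> * \<bar>g x\<bar>"
      by (metis abs_mult abs_triangle_ineq)
    also have "\<dots> \<le> \<bar>a\<bar> * (b * indicator A x) + \<bar>d\<bar> * (c * indicator A x)"
      using b c by (intro add_mono mult_left_mono) auto
    finally show "\<bar>a * f x + d * g x\<bar> \<le> (\<bar>a\<bar> * b + \<bar>d\<bar> * c) * indicator A x" by (simp add: algebra_simps)
  qed (use bdd_measurable[OF assms(1)] bdd_measurable[OF assms(2)] in simp)
qed

lemma bdd_scale: "bdd f \<Longrightarrow> bdd (\<lambda>x. a * f x)"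
  using bdd_lin[of f f a 0] by simp

lemma bdd_abs: "bdd f \<Longrightarrow> bdd (\<lambda>x. \<bar>f x\<bar>)"
  by (auto simp: bdd_def intro!: borel_measurable_abs)

lemma bdd_indicator: "bdd (indicator A)"
  by (rule bddI[of _ 1]) auto

lemma k_indicator_integrable: "integrable lborel (\<lambda>y. k (x - y) * indicator A y)"
  and k_indicator_integral_le: "(LINT y|lborel. k (x - y) * indicator A y) \<le> k_mass"
proof -
  have eq: "(\<integral>\<^sup>+ y. ennreal (k (x - y) * indicator A y) \<partial>lborel) = (\<integral>\<^sup>+ y. ennreal (k (x - y)) * indicator A y \<partial>lborel)"
    by (intro nn_integral_cong) (auto simp: indicator_def)
  show int: "integrable lborel (\<lambda>y. k (x - y) * indicator A y)"
    using k_mass[of x] by (intro integrableI_nonneg) (auto simp: eq intro: order_le_less_trans)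
  have "ennreal (LINT y|lborel. k (x - y) * indicator A y) \<le> ennreal k_mass"
    using nn_integral_eq_integral[OF int] k_mass[of x] eq by simp
  then show "(LINT y|lborel. k (x - y) * indicator A y) \<le> k_mass"
    using k_mass_pos by (subst (asm) ennreal_le_iff) auto
qed

lemma k_times_integrable: assumes "bdd f" shows "integrable lborel (\<lambda>y. k (x - y) * f y)"
proof -
  obtain b where b: "0 < b" "\<And>x. \<bar>f x\<bar> \<le> b * indicator A x" using bdd_bound[OF assms] by blast
  have [measurable]: "f \<in> borel_measurable borel" using assms by (rule bdd_measurable)
  show ?thesis
  proof (rule Bochner_Integration.integrable_bound[OF integrable_mult_right[OF k_indicator_integrable, of b]])
    show "AE y in lborel. norm (k (x - y) * f y) \<le> norm (b * (k (x - y) * indicator A y))"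
    proof (rule AE_I2)
      fix y
      have "k (x - y) * \<bar>f y\<bar> \<le> k (x - y) * (b * indicator A y)" using b by (intro mult_left_mono) auto
      then show "norm (k (x - y) * f y) \<le> norm (b * (k (x - y) * indicator A y))"
        using b(1) by (simp add: abs_mult mult.left_commute)
    qed
  qed simp
qed

lemma T_bound: assumes "\<And>x. \<bar>f x\<bar> \<le> b * indicator A x" "bdd f" "0 \<le> b" shows "\<bar>T f x\<bar> \<le> b * k_mass"
proof -
  have "\<bar>T f x\<bar> \<le> (LINT y|lborel. \<bar>k (x - y) * f y\<bar>)" unfolding T_def by (rule integral_abs_bound)
  also have "\<dots> \<le> (LINT y|lborel. b * (k (x - y) * indicator A y))"
  proof (intro integral_mono integrable_abs k_times_integrable assms bdd_indicator integrable_mult_right k_indicator_integrable)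
    fix y
    have "k (x - y) * \<bar>f y\<bar> \<le> k (x - y) * (b * indicator A y)" using assms by (intro mult_left_mono) auto
    then show "\<bar>k (x - y) * f y\<bar> \<le> b * (k (x - y) * indicator A y)"
      by (simp add: abs_mult mult.left_commute)
  qed
  also have "\<dots> = b * (LINT y|lborel. k (x - y) * indicator A y)" by simp
  also have "\<dots> \<le> b * k_mass" using k_indicator_integral_le assms(3) by (intro mult_left_mono)
  finally show ?thesis .
qed

lemma T_measurable: assumes "bdd f" shows "T f \<in> borel_measurable borel"
proof -
  have [measurable]: "f \<in> borel_measurable borel" using assms by (rule bdd_measurable)
  show ?thesis unfolding T_def[abs_def] by measurable
qed

lemma T_lin: "bdd f \<Longrightarrow> bdd g \<Longrightarrow> T (\<lambda>y. a * f y + b * g y) x = a * T f x + b * T g x"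
proof -
  assume fg: "bdd f" "bdd g"
  have "T (\<lambda>y. a * f y + b * g y) x = (LINT y|lborel. a * (k (x - y) * f y) + b * (k (x - y) * g y))"
    unfolding T_def by (intro Bochner_Integration.integral_cong) (auto simp: algebra_simps)
  also have "\<dots> = a * T f x + b * T g x" unfolding T_def
    using fg by (subst Bochner_Integration.integral_add) (auto intro!: integrable_mult_right k_times_integrable)
  finally show ?thesis .
qed

lemma T_nonneg: "(\<And>y. 0 \<le> f y) \<Longrightarrow> 0 \<le> T f x"
  unfolding T_def by (intro Bochner_Integration.integral_nonneg) auto

lemma T_abs: "bdd f \<Longrightarrow> \<bar>T f x\<bar> \<le> T (\<lambda>y. \<bar>f y\<bar>) x"
  unfolding T_def using integral_abs_bound[of lborel "\<lambda>y. k (x - y) * f y"] by (simp add: abs_mult)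

lemma bdd_T: assumes "bdd f" shows "bdd (\<lambda>x. indicator A x * T f x)"
proof -
  obtain b where b: "0 < b" "\<And>x. \<bar>f x\<bar> \<le> b * indicator A x" using bdd_bound[OF assms] by blast
  have [measurable]: "T f \<in> borel_measurable borel" using assms by (rule T_measurable)
  show ?thesis
    by (rule bddI[of _ "b * k_mass"]) (use b(1) in \<open>auto simp: indicator_def T_bound[OF b(2) assms] k_mass_pos less_imp_le\<close>)
qed

text \<open>\<open>T g\<close> does not vanish outside \<open>A\<close>, but the factor
  \<open>f\<close> does, so an indicator can be inserted.\<close>

lemma bdd_mult_T: "bdd f \<Longrightarrow> bdd g \<Longrightarrow> bdd (\<lambda>x. f x * T g x)"
proof -
  assume fg: "bdd f" "bdd g"
  have "(\<lambda>x. f x * T g x) = (\<lambda>x. f x * (indicator A x * T g x))"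
    using bdd_outside[OF fg(1)] by (auto simp: fun_eq_iff indicator_def)
  then show ?thesis using bdd_mult[OF fg(1) bdd_T[OF fg(2)]] by simp
qed

lemma Q_lin_right: "bdd f \<Longrightarrow> bdd g \<Longrightarrow> bdd h \<Longrightarrow> Q f (\<lambda>x. a * g x + b * h x) = a * Q f g + b * Q f h"
proof -
  assume fgh: "bdd f" "bdd g" "bdd h"
  have "Q f (\<lambda>x. a * g x + b * h x) = (LINT x|lborel. a * (f x * T g x) + b * (f x * T h x))"
    unfolding Q_def using fgh by (intro Bochner_Integration.integral_cong) (auto simp: algebra_simps T_lin)
  also have "\<dots> = a * Q f g + b * Q f h" unfolding Q_def
    using fgh by (subst Bochner_Integration.integral_add) (auto intro!: integrable_mult_right bdd_integrable bdd_mult_T)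
  finally show ?thesis .
qed

lemma Q_lin_left: "bdd f \<Longrightarrow> bdd g \<Longrightarrow> bdd h \<Longrightarrow> Q (\<lambda>x. a * g x + b * h x) f = a * Q g f + b * Q h f"
proof -
  assume fgh: "bdd f" "bdd g" "bdd h"
  have "Q (\<lambda>x. a * g x + b * h x) f = (LINT x|lborel. a * (g x * T f x) + b * (h x * T f x))"
    unfolding Q_def by (intro Bochner_Integration.integral_cong) (auto simp: algebra_simps)
  also have "\<dots> = a * Q g f + b * Q h f" unfolding Q_def
    using fgh by (subst Bochner_Integration.integral_add) (auto intro!: integrable_mult_right bdd_integrable bdd_mult_T)
  finally show ?thesis .
qed

text \<open>Fubini for a symmetric kernel. The absolute double integral is finite, being at most
  \<open>b * c\<close> times the volume of \<open>A\<close> times \<open>k_mass\<close>.\<close>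

lemma Q_commute: assumes f: "bdd f" and g: "bdd g" shows "Q f g = Q g f"
proof -
  have [measurable]: "f \<in> borel_measurable borel" "g \<in> borel_measurable borel"
    using assms by (auto intro: bdd_measurable)
  obtain b where b: "0 < b" "\<And>x. \<bar>f x\<bar> \<le> b * indicator A x" using bdd_bound[OF f] by blast
  obtain c where c: "0 < c" "\<And>x. \<bar>g x\<bar> \<le> c * indicator A x" using bdd_bound[OF g] by blast
  have int: "integrable (lborel \<Otimes>\<^sub>M lborel) (\<lambda>(x, y). f x * (k (x - y) * g y))"
  proof (rule integrableI_bounded)
    have "(\<integral>\<^sup>+ p. ennreal (norm (case p of (x, y) \<Rightarrow> f x * (k (x - y) * g y))) \<partial>(lborel \<Otimes>\<^sub>M lborel)) =
        (\<integral>\<^sup>+ x. \<integral>\<^sup>+ y. ennreal (norm (f x * (k (x - y) * g y))) \<partial>lborel \<partial>lborel)"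
      by (subst lborel.nn_integral_fst[symmetric]) auto
    also have "\<dots> \<le> (\<integral>\<^sup>+ x. ennreal (b * c) * indicator A x * ennreal k_mass \<partial>lborel)"
    proof (rule nn_integral_mono)
      fix x
      have "(\<integral>\<^sup>+ y. ennreal (norm (f x * (k (x - y) * g y))) \<partial>lborel) \<le>
          (\<integral>\<^sup>+ y. ennreal (b * c) * indicator A x * (ennreal (k (x - y)) * indicator A y) \<partial>lborel)"
      proof (rule nn_integral_mono)
        fix y
        have "\<bar>f x\<bar> * (k (x - y) * \<bar>g y\<bar>) \<le> (b * indicator A x) * (k (x - y) * (c * indicator A y))"
          using b c by (intro mult_mono mult_left_mono) auto
        then show "ennreal (norm (f x * (k (x - y) * g y))) \<le> ennreal (b * c) * indicator A x * (ennreal (k (x - y)) * indicator A y)"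
          using b(1) c(1) bdd_outside[OF f, of x] bdd_outside[OF g, of y]
          by (cases "x \<in> A"; cases "y \<in> A") (auto simp: abs_mult mult_ac simp flip: ennreal_mult intro!: ennreal_leI)
      qed
      also have "\<dots> = ennreal (b * c) * indicator A x * (\<integral>\<^sup>+ y. (ennreal (k (x - y)) * indicator A y) \<partial>lborel)"
        by (simp add: nn_integral_cmult)
      also have "\<dots> \<le> ennreal (b * c) * indicator A x * ennreal k_mass" by (intro mult_left_mono k_mass) auto
      finally show "(\<integral>\<^sup>+ y. ennreal (norm (f x * (k (x - y) * g y))) \<partial>lborel) \<le> ennreal (b * c) * indicator A x * ennreal k_mass" .
    qed
    also have "\<dots> = ennreal (b * c) * emeasure lborel A * ennreal k_mass"
      by (simp add: nn_integral_cmult nn_integral_multc)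
    also have "\<dots> < \<infinity>" using A_fin by (simp add: ennreal_mult_less_top)
    finally show "(\<integral>\<^sup>+ p. ennreal (norm (case p of (x, y) \<Rightarrow> f x * (k (x - y) * g y))) \<partial>(lborel \<Otimes>\<^sub>M lborel)) < \<infinity>" .
  qed measurable
  have "Q f g = (LINT x|lborel. LINT y|lborel. f x * (k (x - y) * g y))"
    by (simp add: Q_def T_def)
  also have "\<dots> = (LINT y|lborel. LINT x|lborel. f x * (k (x - y) * g y))"
    by (rule lborel_pair.Fubini_integral[OF int, symmetric])
  also have "\<dots> = (LINT y|lborel. LINT x|lborel. g y * (k (y - x) * f x))"
    by (intro Bochner_Integration.integral_cong refl) (simp add: k_commute mult_ac)
  also have "\<dots> = Q g f" by (simp add: Q_def T_def)
  finally show ?thesis .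
qed

lemma Q_abs: assumes "bdd f" shows "\<bar>Q f f\<bar> \<le> Q (\<lambda>x. \<bar>f x\<bar>) (\<lambda>x. \<bar>f x\<bar>)"
proof -
  have "\<bar>Q f f\<bar> \<le> (LINT x|lborel. \<bar>f x * T f x\<bar>)" unfolding Q_def by (rule integral_abs_bound)
  also have "\<dots> \<le> (LINT x|lborel. \<bar>f x\<bar> * T (\<lambda>x. \<bar>f x\<bar>) x)"
    using assms by (intro integral_mono integrable_abs bdd_integrable bdd_mult_T bdd_abs)
      (auto simp: abs_mult intro!: mult_left_mono T_abs)
  finally show ?thesis by (simp add: Q_def)
qed

text \<open>Passage to extended nonnegative integrals, in which Schur's test and polarization work
  free of integrability conditions.\<close>

lemma Q_nn_integral: assumes "bdd f" "\<And>x. 0 \<le> f x"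
  shows "ennreal (Q f f) = (\<integral>\<^sup>+ x. \<integral>\<^sup>+ y. ennreal (f x * f y * k (x - y)) \<partial>lborel \<partial>lborel)"
proof -
  have "(\<integral>\<^sup>+ y. ennreal (f x * f y * k (x - y)) \<partial>lborel) = ennreal (f x * T f x)" for x
  proof -
    have "(\<integral>\<^sup>+ y. ennreal (f x * f y * k (x - y)) \<partial>lborel) = (\<integral>\<^sup>+ y. ennreal (f x * (k (x - y) * f y)) \<partial>lborel)"
      by (simp add: mult_ac)
    also have "\<dots> = ennreal (LINT y|lborel. f x * (k (x - y) * f y))"
      using assms by (intro nn_integral_eq_integral integrable_mult_right k_times_integrable) auto
    finally show ?thesis by (simp add: T_def)
  qed
  then have "(\<integral>\<^sup>+ x. \<integral>\<^sup>+ y. ennreal (f x * f y * k (x - y)) \<partial>lborel \<partial>lborel) = (\<integral>\<^sup>+ x. ennreal (f x * T f x) \<partial>lborel)"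
    by simp
  also have "\<dots> = ennreal (Q f f)" unfolding Q_def
    using assms by (intro nn_integral_eq_integral bdd_integrable bdd_mult_T) (auto intro!: AE_I2 mult_nonneg_nonneg T_nonneg)
  finally show ?thesis ..
qed

lemma square_nn_integral: "bdd f \<Longrightarrow> (\<integral>\<^sup>+ x. ennreal ((f x)\<^sup>2) \<partial>lborel) = ennreal (LINT x|lborel. (f x)\<^sup>2)"
  by (intro nn_integral_eq_integral bdd_integrable bdd_square) auto

text \<open>The constraint is an inequality, so that the zero function is admissible and the
  supremum runs over a nonempty set. By \<open>Q_abs\<close>, functions that change sign would not
  raise it.\<close>

definition M :: real where
  "M = Sup {Q f f | f. bdd f \<and> (\<forall>x. 0 \<le> f x) \<and> (LINT x|lborel. (f x)\<^sup>2) \<le> 1}"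

lemma Q_le_k_mass: assumes "bdd f" "\<And>x. 0 \<le> f x" shows "Q f f \<le> k_mass * (LINT x|lborel. (f x)\<^sup>2)"
proof -
  have [measurable]: "f \<in> borel_measurable borel" using assms by (auto intro: bdd_measurable)
  \<comment> \<open>The kernel is cut to \<open>A\<close> in both variables, since its integral over
    the whole space diverges.\<close>
  let ?K = "\<lambda>x y. k (x - y) * indicator A x * indicator A y"
  have "ennreal (Q f f) = (\<integral>\<^sup>+ x. \<integral>\<^sup>+ y. ennreal (f x * f y * ?K x y) \<partial>lborel \<partial>lborel)"
    unfolding Q_nn_integral[OF assms]
    by (intro nn_integral_cong) (use bdd_outside[OF assms(1)] in \<open>auto simp: indicator_def\<close>)
  also have "\<dots> \<le> ennreal (1 / 2) * ennreal k_mass * (\<integral>\<^sup>+ x. ennreal ((f x)\<^sup>2) \<partial>lborel) +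
    ennreal (1 / (2 * 1)) * ennreal k_mass * (\<integral>\<^sup>+ x. ennreal ((f x)\<^sup>2) \<partial>lborel)"
  proof (rule weighted_Schur)
    show *: "(\<integral>\<^sup>+ y. ennreal (?K x y) \<partial>lborel) \<le> ennreal k_mass" for x
      by (rule order_trans[OF _ k_mass[of x]], rule nn_integral_mono) (auto simp: indicator_def)
    show "(\<integral>\<^sup>+ x. ennreal (?K x y) \<partial>lborel) \<le> ennreal k_mass" for y
      using *[of y] by (simp add: k_commute[of _ y] mult_ac)
  qed (auto simp: assms)
  also have "\<dots> = ennreal (k_mass * (LINT x|lborel. (f x)\<^sup>2))"
  proof -
    define n where "n = (LINT x|lborel. (f x)\<^sup>2)"
    have n: "0 \<le> n" by (simp add: n_def)
    have "ennreal (1 / 2) * ennreal k_mass * ennreal n = ennreal (1 / 2 * k_mass * n)"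
      using n k_mass_pos by (subst ennreal_mult', simp) (subst ennreal_mult', simp, rule refl)
    moreover have "ennreal (1 / 2 * k_mass * n) + ennreal (1 / 2 * k_mass * n) = ennreal (k_mass * n)"
      using n k_mass_pos by (subst ennreal_plus[symmetric]) auto
    ultimately show ?thesis
      by (simp only: square_nn_integral[OF assms(1)] n_def[symmetric] mult_1_right)
  qed
  finally show ?thesis using k_mass_pos by (subst (asm) ennreal_le_iff) auto
qed

lemma M_upper: assumes "bdd f" "\<And>x. 0 \<le> f x" "(LINT x|lborel. (f x)\<^sup>2) \<le> 1" shows "Q f f \<le> M"
  unfolding M_def
proof (rule cSup_upper)
  show "bdd_above {Q f f | f. bdd f \<and> (\<forall>x. 0 \<le> f x) \<and> (LINT x|lborel. (f x)\<^sup>2) \<le> 1}"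
  proof (rule bdd_aboveI[of _ k_mass], clarify)
    fix f assume "bdd f" "\<forall>x. 0 \<le> f x" "(LINT x|lborel. (f x)\<^sup>2) \<le> 1"
    then show "Q f f \<le> k_mass" using Q_le_k_mass[of f] k_mass_pos
      by (smt (verit) mult_left_le mult.commute)
  qed
qed (use assms in auto)

lemma M_approx: assumes "0 < e"
  obtains f where "bdd f" "\<And>x. 0 \<le> f x" "(LINT x|lborel. (f x)\<^sup>2) \<le> 1" "M - e < Q f f"
proof -
  let ?S = "{Q f f | f. bdd f \<and> (\<forall>x. 0 \<le> f x) \<and> (LINT x|lborel. (f x)\<^sup>2) \<le> 1}"
  have "bdd (\<lambda>x. 0)" by (rule bddI[of _ 0]) auto
  then have "?S \<noteq> {}" by force
  moreover have "M - e < Sup ?S" using assms by (simp add: M_def)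
  ultimately obtain q where "q \<in> ?S" "M - e < q" using less_cSupE by blast
  then show ?thesis using that by blast
qed

lemma M_nonneg: "0 \<le> M"
proof -
  have b: "bdd (\<lambda>x. 0)" by (rule bddI[of _ 0]) auto
  have "Q (\<lambda>x. 0) (\<lambda>x. 0) = 0" by (simp add: Q_def)
  then show ?thesis using M_upper[OF b] by simp
qed

text \<open>Scaling to square integral 1. A function of square integral 0 cannot be scaled; for it
  \<open>Q_le_k_mass\<close> already gives \<open>Q f f \<le> 0\<close>.\<close>

lemma Q_le_nonneg: assumes "bdd f" "\<And>x. 0 \<le> f x" shows "Q f f \<le> M * (LINT x|lborel. (f x)\<^sup>2)"
proof (cases "(LINT x|lborel. (f x)\<^sup>2) = 0")
  case True
  then show ?thesis using Q_le_k_mass[OF assms] by simp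
next
  case False
  define n where "n = (LINT x|lborel. (f x)\<^sup>2)"
  have n: "0 < n" using False by (simp add: n_def less_le)
  define g where "g = (\<lambda>x. inverse (sqrt n) * f x)"
  have g: "bdd g" unfolding g_def using assms(1) by (rule bdd_scale)
  have "(LINT x|lborel. (g x)\<^sup>2) = (LINT x|lborel. inverse n * (f x)\<^sup>2)"
    using n by (intro Bochner_Integration.integral_cong) (auto simp: g_def power_mult_distrib power_inverse)
  also have "\<dots> = 1" using n by (simp add: n_def)
  finally have "Q g g \<le> M" using n assms g by (intro M_upper) (auto simp: g_def)
  moreover have "Q g g = inverse n * Q f f"
  proof -
    have "Q g g = inverse (sqrt n) * (inverse (sqrt n) * Q f f)"
      using Q_lin_right[OF g assms(1) assms(1), of "inverse (sqrt n)" 0] Q_lin_left[OF assms(1) assms(1) assms(1), of "inverse (sqrt n)" 0]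
      by (simp add: g_def)
    also have "\<dots> = (inverse (sqrt n) * inverse (sqrt n)) * Q f f" by (simp only: mult.assoc)
    also have "inverse (sqrt n) * inverse (sqrt n) = inverse n" using n by (simp flip: inverse_mult_distrib)
    finally show ?thesis .
  qed
  ultimately have "inverse n * Q f f \<le> M" by simp
  then show ?thesis using n unfolding n_def[symmetric] by (simp add: field_simps)
qed

lemma abs_Q_le: assumes "bdd f" shows "\<bar>Q f f\<bar> \<le> M * (LINT x|lborel. (f x)\<^sup>2)"
  using Q_abs[OF assms] Q_le_nonneg[OF bdd_abs[OF assms]] by simp

text \<open>Tested on the indicator of \<open>A\<close>: its potential is positive everywhere, since
  \<open>k (x - y)\<close> vanishes only at \<open>y = x\<close>, which is a null set.\<close>

lemma M_pos: assumes "emeasure lborel A > 0" shows "0 < M"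
proof -
  have Tpos: "0 < T (indicator A) x" for x
  proof -
    have "T (indicator A) x \<noteq> 0"
    proof
      assume "T (indicator A) x = 0"
      then have "AE y in lborel. k (x - y) * indicator A y = 0"
        unfolding T_def using k_indicator_integrable[of x]
        by (subst (asm) integral_nonneg_eq_0_iff_AE) auto
      moreover have "AE y in lborel. y \<noteq> x" by (rule AE_lborel_singleton)
      ultimately have "AE y in lborel. y \<notin> A"
      proof eventually_elim
        case (elim y)
        then show ?case using k_pos[of "x - y"] by (auto simp: indicator_def)
      qed
      then have "emeasure lborel A = 0" by (subst (asm) AE_iff_measurable[OF _ refl]) auto
      then show False using assms by simp
    qed
    moreover have "0 \<le> T (indicator A) x" by (rule T_nonneg) simp
    ultimately show ?thesis by simp
  qed
  have "Q (indicator A) (indicator A) \<noteq> 0"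
  proof
    assume "Q (indicator A) (indicator A) = 0"
    then have "AE x in lborel. indicator A x * T (indicator A) x = 0"
      unfolding Q_def using bdd_integrable[OF bdd_mult_T[OF bdd_indicator bdd_indicator]] Tpos
      by (subst (asm) integral_nonneg_eq_0_iff_AE) (auto simp: less_imp_le)
    then have "AE y in lborel. y \<notin> A"
    proof eventually_elim
      case (elim y)
      then show ?case using Tpos[of y] by (auto simp: indicator_def split: if_splits)
    qed
    then have "emeasure lborel A = 0" by (subst (asm) AE_iff_measurable[OF _ refl]) auto
    then show False using assms by simp
  qed
  moreover have "0 \<le> Q (indicator A) (indicator A)"
    unfolding Q_def using Tpos by (intro Bochner_Integration.integral_nonneg) (auto simp: less_imp_le)
  ultimately have "0 < Q (indicator A) (indicator A)" by simp
  also have "\<dots> \<le> M * (LINT x|lborel. (indicator A x)\<^sup>2)" by (rule Q_le_nonneg[OF bdd_indicator]) auto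
  finally show ?thesis using M_nonneg by (auto simp: less_le)
qed

text \<open>The quadratic form of M - T is nonnegative, so testing it on f - r / (2 M) shows that
  an almost maximiser f is almost an eigenfunction.\<close>

lemma residual_bound:
  assumes M: "0 < M" and f: "bdd f" and f1: "(LINT x|lborel. (f x)\<^sup>2) \<le> 1"
    and r_def: "r = (\<lambda>x. M * f x - indicator A x * T f x)"
  shows "bdd r" and "(LINT x|lborel. (r x)\<^sup>2) \<le> 2 * M * (M - Q f f)"
proof -
  have "bdd (\<lambda>x. M * f x + (-1) * (indicator A x * T f x))" using f by (intro bdd_lin bdd_T)
  then show r: "bdd r" by (simp add: r_def)
  define R where "R = (LINT x|lborel. (r x)\<^sup>2)"
  \<comment> \<open>This \<open>t\<close> maximises
    \<open>2 * t * R - 2 * (t\<^sup>2 * (M * R))\<close>, the lower bound obtained below for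
    \<open>M - Q f f\<close>; the maximum is \<open>R / (2 * M)\<close>.\<close>
  define t where "t = 1 / (2 * M)"
  define p where "p = (\<lambda>x. 1 * f x + (- t) * r x)"
  have p: "bdd p" unfolding p_def using f r by (rule bdd_lin)
  have R_eq: "R = M * (LINT x|lborel. f x * r x) - Q r f"
  proof -
    have "R = (LINT x|lborel. M * (f x * r x) - r x * T f x)"
      unfolding R_def using bdd_outside[OF r] bdd_outside[OF f]
      by (intro Bochner_Integration.integral_cong refl)
        (auto simp: r_def indicator_def power2_eq_square algebra_simps)
    also have "\<dots> = M * (LINT x|lborel. f x * r x) - Q r f" unfolding Q_def
      using Bochner_Integration.integral_diff[OF integrable_mult_right[OF bdd_integrable[OF bdd_mult[OF f r]], of M]
        bdd_integrable[OF bdd_mult_T[OF r f]]] by simp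
    finally show ?thesis .
  qed
  have pp: "(LINT x|lborel. (p x)\<^sup>2) = (LINT x|lborel. (f x)\<^sup>2) - 2 * t * (LINT x|lborel. f x * r x) + t\<^sup>2 * R"
  proof -
    have "(LINT x|lborel. (p x)\<^sup>2) = (LINT x|lborel. ((f x)\<^sup>2 - 2 * t * (f x * r x)) + t\<^sup>2 * (r x)\<^sup>2)"
      by (intro Bochner_Integration.integral_cong refl) (auto simp: p_def power2_eq_square algebra_simps)
    also have "\<dots> = (LINT x|lborel. (f x)\<^sup>2 - 2 * t * (f x * r x)) + (LINT x|lborel. t\<^sup>2 * (r x)\<^sup>2)"
      using f r by (intro Bochner_Integration.integral_add Bochner_Integration.integrable_diff integrable_mult_right bdd_integrable bdd_square bdd_mult)
    also have "(LINT x|lborel. (f x)\<^sup>2 - 2 * t * (f x * r x)) = (LINT x|lborel. (f x)\<^sup>2) - (LINT x|lborel. 2 * t * (f x * r x))"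
      using f r by (intro Bochner_Integration.integral_diff integrable_mult_right bdd_integrable bdd_square bdd_mult)
    finally show ?thesis by (simp add: R_def)
  qed
  have Qp: "Q p p = Q f f - 2 * t * Q r f + t\<^sup>2 * Q r r"
  proof -
    have "Q p p = Q p f - t * Q p r" unfolding p_def[symmetric]
      using Q_lin_right[OF p f r, of 1 "- t"] by (simp add: p_def)
    also have "Q p f = Q f f - t * Q r f" using Q_lin_left[OF f f r, of 1 "- t"] by (simp add: p_def)
    also have "Q p r = Q f r - t * Q r r" using Q_lin_left[OF r f r, of 1 "- t"] by (simp add: p_def)
    finally show ?thesis using Q_commute[OF f r] by (simp add: algebra_simps power2_eq_square)
  qed
  have "Q p p \<le> M * (LINT x|lborel. (p x)\<^sup>2)" using abs_Q_le[OF p] by simp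
  moreover have "- Q r r \<le> M * R" using abs_Q_le[OF r] by (simp add: R_def)
  then have "t\<^sup>2 * - Q r r \<le> t\<^sup>2 * (M * R)" by (intro mult_left_mono) auto
  moreover have "M * (LINT x|lborel. (f x)\<^sup>2) \<le> M * 1" using M f1 by (intro mult_left_mono) auto
  ultimately have "2 * t * R - 2 * (t\<^sup>2 * (M * R)) \<le> M - Q f f"
    unfolding pp Qp R_eq by (simp add: algebra_simps)
  moreover have "2 * t * R - 2 * (t\<^sup>2 * (M * R)) = R / (2 * M)"
    using M by (simp add: t_def power2_eq_square field_simps)
  ultimately have "R / (2 * M) \<le> M - Q f f" by linarith
  then have "R \<le> (M - Q f f) * (2 * M)" using M by (subst (asm) pos_divide_le_eq) auto
  then show "(LINT x|lborel. (r x)\<^sup>2) \<le> 2 * M * (M - Q f f)"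
    by (simp add: R_def mult_ac)
qed

end

section \<open>Truncated kernels and compactness\<close>

context riesz_set
begin

definition unit_bdd :: "('a \<Rightarrow> real) \<Rightarrow> bool" where
  "unit_bdd f \<longleftrightarrow> bdd f \<and> (\<forall>x. 0 \<le> f x) \<and> (LINT x|lborel. (f x)\<^sup>2) \<le> 1"

definition L1_bound :: real where "L1_bound = (measure lborel A + 1) / 2"

text \<open>The kernel is the truncation at distance \<open>\<rho>\<close> plus a remainder of small integral. Truncated potentials
  are bounded and equi-Lipschitz; this replaces the compactness of the operator. At the origin the truncation
  is positive but \<open>k\<close> is 0, so the truncation is below \<open>k\<close> only off the diagonal.\<close>

definition T_trunc :: "real \<Rightarrow> ('a \<Rightarrow> real) \<Rightarrow> 'a \<Rightarrow> real" where
  "T_trunc \<rho> f x = (LINT y|lborel. k_trunc \<rho> (x - y) * f y)"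

definition T_near :: "real \<Rightarrow> ('a \<Rightarrow> real) \<Rightarrow> 'a \<Rightarrow> real" where
  "T_near \<rho> f x = (LINT y|lborel. k_near \<rho> (x - y) * f y)"

definition trunc_sup :: "real \<Rightarrow> real" where "trunc_sup \<rho> = C * \<rho> powr - \<beta>"

lemma L1_bound_pos: "0 < L1_bound"
  by (simp add: L1_bound_def add_nonneg_pos)

lemma trunc_sup_pos: "0 < \<rho> \<Longrightarrow> 0 < trunc_sup \<rho>"
  using C_pos by (simp add: trunc_sup_def)

lemma unit_bdd_D: "unit_bdd f \<Longrightarrow> bdd f" "unit_bdd f \<Longrightarrow> 0 \<le> f x" "unit_bdd f \<Longrightarrow> (LINT x|lborel. (f x)\<^sup>2) \<le> 1"
  by (auto simp: unit_bdd_def)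

text \<open>Cauchy-Schwarz in additive form: on \<open>A\<close>, \<open>\<bar>r x\<bar>\<close> is
  at most \<open>d / 2\<close> plus the square divided by \<open>2 * d\<close>. The choice
  \<open>d = 1\<close> gives \<open>L1_bound\<close>, and small \<open>d\<close> turns convergence
  of square integrals to 0 into convergence of integrals to 0.\<close>

lemma abs_integral_le: assumes "bdd r" "0 < d"
  shows "(LINT x|lborel. \<bar>r x\<bar>) \<le> (d * measure lborel A + (LINT x|lborel. (r x)\<^sup>2) / d) / 2"
proof -
  have "(LINT x|lborel. \<bar>r x\<bar>) \<le> (LINT x|lborel. (d/2) * indicator A x + (1 / (2*d)) * (r x)\<^sup>2)"
  proof (rule integral_mono)
    show "integrable lborel (\<lambda>x. (d/2) * indicator A x + (1 / (2*d)) * (r x)\<^sup>2)"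
      using assms by (intro bdd_integrable bdd_lin bdd_indicator bdd_square)
    show "integrable lborel (\<lambda>x. \<bar>r x\<bar>)" using assms by (intro integrable_abs bdd_integrable)
    show "\<bar>r x\<bar> \<le> (d/2) * indicator A x + (1 / (2*d)) * (r x)\<^sup>2" for x
    proof (cases "x \<in> A")
      case True
      have "0 \<le> (\<bar>r x\<bar> - d)\<^sup>2 / (2 * d)" using assms(2) by simp
      also have "\<dots> = d / 2 + 1 / (2*d) * (r x)\<^sup>2 - \<bar>r x\<bar>"
        using assms(2) by (simp add: power2_diff field_simps power2_eq_square)
      finally show ?thesis using True by simp
    qed (use bdd_outside[OF assms(1)] in simp)
  qed
  also have "\<dots> = (d/2) * measure lborel A + (1 / (2*d)) * (LINT x|lborel. (r x)\<^sup>2)"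
    using Bochner_Integration.integral_add[OF integrable_mult_right[OF indicator_integrable, of "d/2"]
        integrable_mult_right[OF bdd_integrable[OF bdd_square[OF assms(1)]], of "1 / (2*d)"]] by simp
  also have "\<dots> = (d * measure lborel A + (LINT x|lborel. (r x)\<^sup>2) / d) / 2"
    using assms(2) by (simp add: field_simps)
  finally show ?thesis .
qed

lemma unit_bdd_integral: assumes "unit_bdd f" shows "(LINT x|lborel. f x) \<le> L1_bound"
  using abs_integral_le[OF unit_bdd_D(1)[OF assms], of 1] unit_bdd_D(2,3)[OF assms] by (simp add: L1_bound_def)

lemma k_trunc_times_integrable: assumes "bdd f" "0 < \<rho>" shows "integrable lborel (\<lambda>y. k_trunc \<rho> (x - y) * f y)"
proof -
  have [measurable]: "f \<in> borel_measurable borel" using assms by (auto intro: bdd_measurable)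
  show ?thesis
  proof (rule Bochner_Integration.integrable_bound[OF integrable_mult_right[OF bdd_integrable[OF assms(1)], of "trunc_sup \<rho>"]])
    show "AE y in lborel. norm (k_trunc \<rho> (x - y) * f y) \<le> norm (trunc_sup \<rho> * f y)"
      using trunc_sup_pos[OF assms(2)] k_trunc_le[OF assms(2), folded trunc_sup_def]
      by (intro AE_I2) (auto simp: abs_mult intro!: mult_right_mono)
  qed simp
qed

lemma k_near_times_integrable: assumes "bdd f" shows "integrable lborel (\<lambda>y. k_near \<rho> (x - y) * f y)"
proof -
  have [measurable]: "f \<in> borel_measurable borel" using assms by (auto intro: bdd_measurable)
  show ?thesis
  proof (rule Bochner_Integration.integrable_bound[OF k_times_integrable[OF assms, of x]])
    have "k_near \<rho> z \<le> k z" for z by (auto simp: k_near_def indicator_def)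
    then show "AE y in lborel. norm (k_near \<rho> (x - y) * f y) \<le> norm (k (x - y) * f y)"
      by (intro AE_I2) (auto simp: abs_mult intro!: mult_right_mono)
  qed simp
qed

lemma T_trunc_measurable: assumes "bdd f" shows "T_trunc \<rho> f \<in> borel_measurable borel"
proof -
  have [measurable]: "f \<in> borel_measurable borel" using assms by (rule bdd_measurable)
  show ?thesis unfolding T_trunc_def[abs_def] by measurable
qed

lemma T_trunc_nonneg: "(\<And>y. 0 \<le> f y) \<Longrightarrow> 0 \<le> T_trunc \<rho> f x"
  unfolding T_trunc_def by (intro Bochner_Integration.integral_nonneg) auto

lemma abs_T_trunc_le: assumes "bdd f" "0 < \<rho>" shows "\<bar>T_trunc \<rho> f x\<bar> \<le> trunc_sup \<rho> * (LINT y|lborel. \<bar>f y\<bar>)"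
proof -
  have "\<bar>T_trunc \<rho> f x\<bar> \<le> (LINT y|lborel. \<bar>k_trunc \<rho> (x - y) * f y\<bar>)" unfolding T_trunc_def by (rule integral_abs_bound)
  also have "\<dots> \<le> (LINT y|lborel. trunc_sup \<rho> * \<bar>f y\<bar>)"
    using assms k_trunc_le[OF assms(2)] unfolding trunc_sup_def
    by (intro integral_mono integrable_abs k_trunc_times_integrable integrable_mult_right bdd_integrable)
      (auto simp: abs_mult intro!: mult_right_mono)
  finally show ?thesis by simp
qed

lemma T_trunc_le: assumes "unit_bdd f" "0 < \<rho>" shows "T_trunc \<rho> f x \<le> trunc_sup \<rho> * L1_bound"
proof -
  note f = unit_bdd_D[OF assms(1)]
  have "\<bar>T_trunc \<rho> f x\<bar> \<le> trunc_sup \<rho> * (LINT y|lborel. \<bar>f y\<bar>)" by (rule abs_T_trunc_le[OF f(1) assms(2)])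
  also have "\<dots> \<le> trunc_sup \<rho> * L1_bound"
    using unit_bdd_integral[OF assms(1)] trunc_sup_pos[OF assms(2)] f(2) by (intro mult_left_mono) auto
  finally show ?thesis by simp
qed

lemma T_trunc_Lipschitz: assumes "unit_bdd f" "0 < \<rho>"
  shows "\<bar>T_trunc \<rho> f x - T_trunc \<rho> f x'\<bar> \<le> C * \<beta> * \<rho> powr (- \<beta> - 1) * L1_bound * norm (x - x')"
proof -
  note f = unit_bdd_D[OF assms(1)]
  let ?L = "C * \<beta> * \<rho> powr (- \<beta> - 1)"
  have L: "0 \<le> ?L" using C_pos \<beta>_pos by simp
  have "T_trunc \<rho> f x - T_trunc \<rho> f x' = (LINT y|lborel. k_trunc \<rho> (x - y) * f y - k_trunc \<rho> (x' - y) * f y)"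
    unfolding T_trunc_def using f assms(2) by (intro Bochner_Integration.integral_diff[symmetric] k_trunc_times_integrable)
  also have "\<bar>\<dots>\<bar> \<le> (LINT y|lborel. \<bar>k_trunc \<rho> (x - y) * f y - k_trunc \<rho> (x' - y) * f y\<bar>)"
    by (rule integral_abs_bound)
  also have "\<dots> \<le> (LINT y|lborel. (?L * norm (x - x')) * f y)"
  proof (intro integral_mono integrable_abs Bochner_Integration.integrable_diff k_trunc_times_integrable
      integrable_mult_right bdd_integrable f assms)
    fix y
    have "\<bar>k_trunc \<rho> (x - y) * f y - k_trunc \<rho> (x' - y) * f y\<bar> = \<bar>k_trunc \<rho> (x - y) - k_trunc \<rho> (x' - y)\<bar> * f y"
      using f(2) by (simp add: abs_mult flip: left_diff_distrib)
    also have "\<dots> \<le> (?L * norm (x - x')) * f y"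
      using k_trunc_Lipschitz[OF assms(2), of "x - y" "x' - y"] f(2) by (intro mult_right_mono) auto
    finally show "\<bar>k_trunc \<rho> (x - y) * f y - k_trunc \<rho> (x' - y) * f y\<bar> \<le> (?L * norm (x - x')) * f y" .
  qed
  also have "\<dots> = (?L * norm (x - x')) * (LINT y|lborel. f y)" by simp
  also have "\<dots> \<le> (?L * norm (x - x')) * L1_bound"
    using mult_nonneg_nonneg[OF L norm_ge_zero] by (rule mult_left_mono[OF unit_bdd_integral[OF assms(1)]])
  finally show ?thesis by (simp add: mult_ac)
qed

lemma T_trunc_le_T: assumes "bdd f" "\<And>x. 0 \<le> f x" "0 < \<rho>" shows "T_trunc \<rho> f x \<le> T f x"
  unfolding T_trunc_def T_def
proof (intro integral_mono_AE k_trunc_times_integrable k_times_integrable assms)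
  have "AE y in lborel. y \<noteq> x" by (rule AE_lborel_singleton)
  then show "AE y in lborel. k_trunc \<rho> (x - y) * f y \<le> k (x - y) * f y"
    by eventually_elim (use assms k_trunc_le_k in \<open>auto intro!: mult_right_mono\<close>)
qed

lemma T_trunc_antimono: assumes "bdd f" "\<And>x. 0 \<le> f x" "0 < \<rho>" "\<rho> \<le> \<sigma>" shows "T_trunc \<sigma> f x \<le> T_trunc \<rho> f x"
  unfolding T_trunc_def using assms
  by (intro integral_mono k_trunc_times_integrable) (auto intro: mult_right_mono k_trunc_antimono)

lemma T_le_T_trunc_plus_T_near: assumes "bdd f" "\<And>x. 0 \<le> f x" "0 < \<rho>" shows "T f x \<le> T_trunc \<rho> f x + T_near \<rho> f x"
proof -
  have "T f x \<le> (LINT y|lborel. k_trunc \<rho> (x - y) * f y + k_near \<rho> (x - y) * f y)"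
    unfolding T_def
    using assms k_le_k_trunc_plus_k_near[of _ \<rho>]
    by (intro integral_mono k_times_integrable Bochner_Integration.integrable_add k_trunc_times_integrable k_near_times_integrable)
      (auto simp flip: distrib_right intro!: mult_right_mono)
  also have "\<dots> = T_trunc \<rho> f x + T_near \<rho> f x" unfolding T_trunc_def T_near_def
    using assms by (intro Bochner_Integration.integral_add k_trunc_times_integrable k_near_times_integrable)
  finally show ?thesis .
qed

section \<open>Truncation radii tending to 0 and the errors they cause\<close>

definition rad :: "nat \<Rightarrow> real" where "rad N = inverse (real (Suc N))"

lemma rad_pos: "0 < rad N" by (simp add: rad_def)

lemma rad_antimono: "N \<le> N' \<Longrightarrow> rad N' \<le> rad N" by (simp add: rad_def field_simps)

definition near_real :: "nat \<Rightarrow> real" where "near_real N = enn2real (near (rad N))"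

lemma near_real: "ennreal (near_real N) = near (rad N)" "0 \<le> near_real N"
proof -
  have "near (rad N) \<le> near 1" unfolding near_def
    using rad_antimono[of 0 N] by (intro nn_integral_mono ennreal_leI) (auto simp: k_near_def indicator_def rad_def)
  then have "near (rad N) < \<infinity>" using near_1_finite by (rule le_less_trans)
  then show "ennreal (near_real N) = near (rad N)" by (simp add: near_real_def less_top)
qed (simp add: near_real_def)

lemma near_real_tendsto_0: "near_real \<longlonglongrightarrow> 0"
proof -
  have "(\<lambda>N. ennreal (near_real N)) \<longlonglongrightarrow> ennreal 0"
    using near_tendsto_0 by (simp add: near_real rad_def)
  then show ?thesis by (subst (asm) tendsto_ennreal_iff) (auto simp: near_real)
qed

text \<open>With Tonelli the integral over \<open>x\<close> is taken first and yields the mass of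
  the near kernel, whatever \<open>y\<close> is. The potential thus has at most the product of that
  mass and the integral of \<open>f\<close>.\<close>

lemma T_near_integral: assumes "unit_bdd f"
  shows "integrable lborel (T_near (rad N) f)" "(LINT x|lborel. T_near (rad N) f x) \<le> near_real N * L1_bound"
proof -
  note f = unit_bdd_D[OF assms]
  have [measurable]: "f \<in> borel_measurable borel" using f by (auto intro: bdd_measurable)
  have Tn0: "0 \<le> T_near (rad N) f x" for x
    unfolding T_near_def using f by (intro Bochner_Integration.integral_nonneg) auto
  have Tm: "T_near (rad N) f \<in> borel_measurable borel" unfolding T_near_def[abs_def] by measurable
  have "(\<integral>\<^sup>+ x. ennreal (T_near (rad N) f x) \<partial>lborel) = (\<integral>\<^sup>+ x. \<integral>\<^sup>+ y. ennreal (k_near (rad N) (x - y) * f y) \<partial>lborel \<partial>lborel)"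
    unfolding T_near_def using f by (intro nn_integral_cong nn_integral_eq_integral[symmetric] k_near_times_integrable) auto
  also have "\<dots> = (\<integral>\<^sup>+ y. \<integral>\<^sup>+ x. ennreal (k_near (rad N) (x - y) * f y) \<partial>lborel \<partial>lborel)"
    by (rule lborel_pair.Fubini'[symmetric]) measurable
  also have "\<dots> = (\<integral>\<^sup>+ y. near (rad N) * ennreal (f y) \<partial>lborel)"
  proof (rule nn_integral_cong)
    fix y
    have "(\<integral>\<^sup>+ x. ennreal (k_near (rad N) (x - y) * f y) \<partial>lborel) = (\<integral>\<^sup>+ x. ennreal (k_near (rad N) (y - x)) * ennreal (f y) \<partial>lborel)"
      using f by (intro nn_integral_cong) (auto simp: ennreal_mult'' k_near_def k_commute[of _ y] norm_minus_commute indicator_def)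
    then show "(\<integral>\<^sup>+ x. ennreal (k_near (rad N) (x - y) * f y) \<partial>lborel) = near (rad N) * ennreal (f y)"
      by (simp add: nn_integral_multc k_near_integral)
  qed
  also have "\<dots> = ennreal (near_real N) * ennreal (LINT y|lborel. f y)"
    using f by (simp add: nn_integral_cmult near_real nn_integral_eq_integral[OF bdd_integrable[OF f(1)]])
  also have "\<dots> \<le> ennreal (near_real N) * ennreal L1_bound"
    using unit_bdd_integral[OF assms] by (intro mult_left_mono ennreal_leI) auto
  also have "\<dots> = ennreal (near_real N * L1_bound)" using near_real(2) by (simp add: ennreal_mult')
  finally have le: "(\<integral>\<^sup>+ x. ennreal (T_near (rad N) f x) \<partial>lborel) \<le> ennreal (near_real N * L1_bound)" .
  show int: "integrable lborel (T_near (rad N) f)"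
    using le Tn0 Tm by (intro integrableI_nonneg) (auto intro: le_less_trans)
  have "ennreal (LINT x|lborel. T_near (rad N) f x) \<le> ennreal (near_real N * L1_bound)"
    using le nn_integral_eq_integral[OF int] Tn0 by simp
  then show "(LINT x|lborel. T_near (rad N) f x) \<le> near_real N * L1_bound"
    using near_real(2)[of N] L1_bound_pos by (subst (asm) ennreal_le_iff) auto
qed

text \<open>Schur's test with weight 1 bounds the energy of the near kernel by
  \<open>near_real N\<close>. The error is the same for all admissible functions, which permits a
  limit along the sequence at fixed \<open>N\<close>.\<close>

lemma Q_le_T_trunc: assumes "unit_bdd f" shows "Q f f \<le> (LINT x|lborel. f x * T_trunc (rad N) f x) + near_real N"
proof -
  let ?I = "\<lambda>K. \<integral>\<^sup>+ x. \<integral>\<^sup>+ y. ennreal (f x * f y * K (x - y)) \<partial>lborel \<partial>lborel"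
  note f = unit_bdd_D[OF assms]
  have [measurable]: "f \<in> borel_measurable borel" "T_trunc (rad N) f \<in> borel_measurable borel"
    using f by (auto intro: bdd_measurable T_trunc_measurable)
  have Ttf: "bdd (\<lambda>x. f x * T_trunc (rad N) f x)"
  proof -
    obtain b where b: "0 < b" "\<And>x. \<bar>f x\<bar> \<le> b * indicator A x" using bdd_bound[OF f(1)] by blast
    show ?thesis
    proof (rule bddI[of _ "b * (trunc_sup (rad N) * L1_bound)"])
      fix x
      have "\<bar>f x * T_trunc (rad N) f x\<bar> \<le> (b * indicator A x) * (trunc_sup (rad N) * L1_bound)"
        unfolding abs_mult using b f T_trunc_le[OF assms rad_pos] T_trunc_nonneg[of f] by (intro mult_mono) auto
      then show "\<bar>f x * T_trunc (rad N) f x\<bar> \<le> b * (trunc_sup (rad N) * L1_bound) * indicator A x" by (simp add: mult_ac)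
    qed measurable
  qed
  have "ennreal (Q f f) \<le> (\<integral>\<^sup>+ x. \<integral>\<^sup>+ y. ennreal (f x * f y * k_trunc (rad N) (x - y)) + ennreal (f x * f y * k_near (rad N) (x - y)) \<partial>lborel \<partial>lborel)"
    unfolding Q_nn_integral[OF f(1,2)]
    using f k_le_k_trunc_plus_k_near
    by (intro nn_integral_mono) (auto simp flip: ennreal_plus distrib_left intro!: ennreal_leI mult_left_mono)
  also have "\<dots> = ?I (k_trunc (rad N)) +
     ?I (k_near (rad N))"
    by (simp add: nn_integral_add)
  also have "?I (k_trunc (rad N)) =
      (\<integral>\<^sup>+ x. ennreal (f x * T_trunc (rad N) f x) \<partial>lborel)"
  proof (rule nn_integral_cong)
    fix x
    have "(\<integral>\<^sup>+ y. ennreal (f x * f y * k_trunc (rad N) (x - y)) \<partial>lborel) = (\<integral>\<^sup>+ y. ennreal (f x * (k_trunc (rad N) (x - y) * f y)) \<partial>lborel)"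
      by (simp add: mult_ac)
    also have "\<dots> = ennreal (LINT y|lborel. f x * (k_trunc (rad N) (x - y) * f y))"
      using f by (intro nn_integral_eq_integral integrable_mult_right k_trunc_times_integrable rad_pos) auto
    finally show "(\<integral>\<^sup>+ y. ennreal (f x * f y * k_trunc (rad N) (x - y)) \<partial>lborel) = ennreal (f x * T_trunc (rad N) f x)"
      by (simp add: T_trunc_def)
  qed
  also have "\<dots> = ennreal (LINT x|lborel. f x * T_trunc (rad N) f x)"
    using f by (intro nn_integral_eq_integral bdd_integrable Ttf AE_I2 mult_nonneg_nonneg T_trunc_nonneg) auto
  also have "?I (k_near (rad N)) \<le>
     ennreal (1 / 2) * near (rad N) * (\<integral>\<^sup>+ x. ennreal ((f x)\<^sup>2) \<partial>lborel) +
    ennreal (1 / (2 * 1)) * near (rad N) * (\<integral>\<^sup>+ x. ennreal ((f x)\<^sup>2) \<partial>lborel)"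
  proof (rule weighted_Schur)
    show *: "(\<integral>\<^sup>+ y. ennreal (k_near (rad N) (x - y)) \<partial>lborel) \<le> near (rad N)" for x
      by (simp add: k_near_integral)
    have "k_near (rad N) (x - y) = k_near (rad N) (y - x)" for x y
      by (simp add: k_near_def k_commute[of x y] norm_minus_commute indicator_def)
    then show "(\<integral>\<^sup>+ x. ennreal (k_near (rad N) (x - y)) \<partial>lborel) \<le> near (rad N)" for y
      using *[of y] by simp
  qed (auto simp: f)
  also have "\<dots> \<le> ennreal (1 / 2) * ennreal (near_real N) * ennreal 1 + ennreal (1 / (2 * 1)) * ennreal (near_real N) * ennreal 1"
    unfolding near_real square_nn_integral[OF f(1)] using f(3) by (intro add_mono mult_left_mono ennreal_leI) auto
  also have "\<dots> = ennreal (1/2 * near_real N) + ennreal (1/2 * near_real N)"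
    using near_real(2)[of N] by (subst (1 2) ennreal_mult') (simp_all only: mult_1_right ennreal_1 zero_le_divide_1_iff zero_le_numeral simp_thms)
  also have "\<dots> = ennreal (near_real N)" using near_real(2)[of N] by (subst ennreal_plus[symmetric]) auto
  finally have "ennreal (Q f f) \<le> ennreal (LINT x|lborel. f x * T_trunc (rad N) f x) + ennreal (near_real N)"
    by (simp add: add_left_mono)
  also have "\<dots> = ennreal ((LINT x|lborel. f x * T_trunc (rad N) f x) + near_real N)"
    using f near_real(2) by (intro ennreal_plus[symmetric] Bochner_Integration.integral_nonneg mult_nonneg_nonneg T_trunc_nonneg) auto
  finally show ?thesis
    using f near_real(2) by (subst (asm) ennreal_le_iff)
      (auto intro!: add_nonneg_nonneg Bochner_Integration.integral_nonneg mult_nonneg_nonneg T_trunc_nonneg)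
qed

text \<open>Arzela-Ascoli argument: a diagonal sequence converges on a countable dense set, for all
  \<open>N\<close> at once, and the Lipschitz bound common to all functions carries the convergence
  to every point.\<close>

lemma convergent_subsequence:
  assumes f: "\<And>n. unit_bdd (f n)"
  obtains s :: "nat \<Rightarrow> nat" where "strict_mono s" "\<And>N x. convergent (\<lambda>n. T_trunc (rad N) (f (s n)) x)"
proof -
  obtain D :: "'a set" where D: "countable D" "\<And>X. open X \<Longrightarrow> X \<noteq> {} \<Longrightarrow> \<exists>d\<in>D. d \<in> X"
    by (rule countable_dense_setE) auto
  \<comment> \<open>The extraction needs one bound for all indices, but these bounds grow with
    \<open>N\<close>; the potentials are therefore divided by \<open>b N\<close>.\<close>
  define b where "b N = trunc_sup (rad N) * L1_bound" for N
  have b: "0 < b N" for N using trunc_sup_pos[OF rad_pos] L1_bound_pos by (simp add: b_def)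
  obtain s :: "nat \<Rightarrow> nat" where s: "strict_mono s"
      "\<And>p. p \<in> UNIV \<times> D \<Longrightarrow> \<exists>l. (\<lambda>n. T_trunc (rad (fst p)) (f (s n)) (snd p) / b (fst p)) \<longlonglongrightarrow> l"
  proof (rule function_convergent_subsequence[of "(UNIV::nat set) \<times> D"
        "\<lambda>n p. T_trunc (rad (fst p)) (f n) (snd p) / b (fst p)" 1])
    show "norm (T_trunc (rad (fst p)) (f n) (snd p) / b (fst p)) \<le> 1" for n p
      using b[of "fst p"] T_trunc_le[OF f rad_pos, of "fst p" n "snd p"] T_trunc_nonneg[of "f n" "rad (fst p)" "snd p"] unit_bdd_D(2)[OF f]
      by (simp add: b_def)
  qed (use D in auto)
  have "Cauchy (\<lambda>n. T_trunc (rad N) (f (s n)) x)" for N x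
  proof (rule metric_CauchyI)
    fix e :: real assume "0 < e"
    define L where "L = C * \<beta> * rad N powr (- \<beta> - 1) * L1_bound"
    have L: "0 < L" using C_pos \<beta>_pos L1_bound_pos rad_pos[of N] by (simp add: L_def)
    \<comment> \<open>Moving from \<open>x\<close> to a dense point costs \<open>e / 4\<close> for
      each of the two potentials, and their difference at that point costs
      \<open>e / 2\<close>.\<close>
    have "0 < e / (4 * L)" using \<open>0 < e\<close> L by (intro divide_pos_pos) auto
    then have "ball x (e / (4 * L)) \<noteq> {}" by simp
    then obtain d where d: "d \<in> D" "norm (x - d) < e / (4 * L)"
      using D(2)[of "ball x (e / (4 * L))"] by (auto simp: dist_norm)
    obtain l where "(\<lambda>n. T_trunc (rad N) (f (s n)) d / b N) \<longlonglongrightarrow> l" using s(2)[of "(N, d)"] d by auto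
    then have "(\<lambda>n. b N * (T_trunc (rad N) (f (s n)) d / b N)) \<longlonglongrightarrow> b N * l" by (intro tendsto_intros)
    then have "(\<lambda>n. T_trunc (rad N) (f (s n)) d) \<longlonglongrightarrow> b N * l" using b[of N] by simp
    then have "Cauchy (\<lambda>n. T_trunc (rad N) (f (s n)) d)" by (rule LIMSEQ_imp_Cauchy)
    then obtain m0 where m0: "\<And>m n. m \<ge> m0 \<Longrightarrow> n \<ge> m0 \<Longrightarrow> \<bar>T_trunc (rad N) (f (s m)) d - T_trunc (rad N) (f (s n)) d\<bar> < e / 2"
      using \<open>0 < e\<close> unfolding Cauchy_def dist_real_def by (meson half_gt_zero)
    have near: "\<bar>T_trunc (rad N) (f (s n)) x - T_trunc (rad N) (f (s n)) d\<bar> < e / 4" for n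
    proof -
      have "\<bar>T_trunc (rad N) (f (s n)) x - T_trunc (rad N) (f (s n)) d\<bar> \<le> L * norm (x - d)"
        unfolding L_def by (rule T_trunc_Lipschitz[OF f rad_pos])
      also have "\<dots> < L * (e / (4 * L))" using d L by (intro mult_strict_left_mono) auto
      finally show ?thesis using L by simp
    qed
    show "\<exists>m0. \<forall>m\<ge>m0. \<forall>n\<ge>m0. dist (T_trunc (rad N) (f (s m)) x) (T_trunc (rad N) (f (s n)) x) < e"
    proof (intro exI[of _ m0] allI impI)
      fix m n assume "m \<ge> m0" "n \<ge> m0"
      then show "dist (T_trunc (rad N) (f (s m)) x) (T_trunc (rad N) (f (s n)) x) < e"
        using m0[of m n] near[of m] near[of n] unfolding dist_real_def by linarith
    qed
  qed
  then show ?thesis using s(1) that by (simp add: Cauchy_convergent_iff)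
qed

end

section \<open>Existence of an eigenfunction\<close>

context riesz_set
begin

text \<open>Along a maximising sequence the truncated potentials converge pointwise. Their limits \<open>h N\<close>
  increase with \<open>N\<close> to the eigenfunction \<open>G\<close>, and no completeness of L2 is needed. The estimate \<open>E1\<close>
  is the eigenvalue equation up to the error of the truncation.\<close>

lemma eigenfunction_exists:
  assumes Apos: "0 < emeasure lborel A"
  obtains G :: "'a \<Rightarrow> ennreal" where "G \<in> borel_measurable borel"
    "(\<integral>\<^sup>+ x. (G x)\<^sup>2 * indicator A x \<partial>lborel) < \<infinity>"
    "\<not> (AE x in lborel. x \<in> A \<longrightarrow> G x = 0)"
    "\<And>x. ennreal M * G x = (\<integral>\<^sup>+ y. ennreal (k (x - y)) * G y * indicator A y \<partial>lborel)"
proof -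
  have Mp: "0 < M" using M_pos[OF Apos] .
  have "\<exists>f. unit_bdd f \<and> M - inverse (real (Suc n)) < Q f f" for n
    using M_approx[of "inverse (real (Suc n))"] by (metis unit_bdd_def inverse_positive_iff_positive of_nat_0_less_iff zero_less_Suc)
  then obtain f0 where f0: "\<And>n. unit_bdd (f0 n)" "\<And>n. M - inverse (real (Suc n)) < Q (f0 n) (f0 n)" by metis
  obtain s :: "nat \<Rightarrow> nat" where s: "strict_mono s" "\<And>N x. convergent (\<lambda>n. T_trunc (rad N) (f0 (s n)) x)"
    using convergent_subsequence[of f0] f0(1) by blast
  define f where "f n = f0 (s n)" for n
  have f: "unit_bdd (f n)" for n using f0 by (simp add: f_def)
  have fb: "bdd (f n)" and fn: "0 \<le> f n x" and f1: "(LINT x|lborel. (f n x)\<^sup>2) \<le> 1" for n x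
    using unit_bdd_D[OF f] by auto
  have QM: "Q (f n) (f n) \<le> M" for n using M_upper[OF fb fn f1] .
  have Qf: "(\<lambda>n. Q (f n) (f n)) \<longlonglongrightarrow> M"
  proof (rule tendsto_sandwich[of "\<lambda>n. M - inverse (real (Suc n))" _ _ "\<lambda>n. M"])
    show "\<forall>\<^sub>F n in sequentially. M - inverse (real (Suc n)) \<le> Q (f n) (f n)"
    proof (rule always_eventually, rule allI)
      fix n
      have "n \<le> s n" using s(1) by (rule seq_suble)
      then have "inverse (real (Suc (s n))) \<le> inverse (real (Suc n))" by (simp add: field_simps)
      then show "M - inverse (real (Suc n)) \<le> Q (f n) (f n)" using f0(2)[of "s n"] unfolding f_def by linarith
    qed
    show "(\<lambda>n. M - inverse (real (Suc n))) \<longlonglongrightarrow> M"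
      using tendsto_diff[OF tendsto_const LIMSEQ_inverse_real_of_nat, of M] by simp
  qed (use QM in auto)
  define h where "h N x = lim (\<lambda>n. T_trunc (rad N) (f n) x)" for N x
  have h: "(\<lambda>n. T_trunc (rad N) (f n) x) \<longlonglongrightarrow> h N x" for N x
    using s(2)[of N x] by (simp add: h_def f_def convergent_LIMSEQ_iff)
  have T_trunc_m [measurable]: "T_trunc (rad N) (f n) \<in> borel_measurable borel" for N n by (rule T_trunc_measurable[OF fb])
  have Tt0: "0 \<le> T_trunc (rad N) (f n) x" for N n x by (rule T_trunc_nonneg[OF fn])
  define c where "c N = trunc_sup (rad N)" for N
  have c: "0 < c N" for N using trunc_sup_pos[OF rad_pos] by (simp add: c_def)
  have T_trunc_up: "T_trunc (rad N) (f n) x \<le> c N * L1_bound" for N n x unfolding c_def by (rule T_trunc_le[OF f rad_pos])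
  have h_m [measurable]: "h N \<in> borel_measurable borel" for N
    by (rule borel_measurable_LIMSEQ_real[OF h]) measurable
  have h0: "0 \<le> h N x" for N x by (rule LIMSEQ_le_const[OF h]) (use Tt0 in auto)
  have h_up: "h N x \<le> c N * L1_bound" for N x by (rule LIMSEQ_le_const2[OF h]) (use T_trunc_up in auto)
  have h_mono: "h N x \<le> h N' x" if "N \<le> N'" for N N' x
    by (rule LIMSEQ_le[OF h h]) (use T_trunc_antimono[OF fb fn rad_pos rad_antimono[OF that]] in auto)
  define r where "r n = (\<lambda>x. M * f n x - indicator A x * T (f n) x)" for n
  have rb: "bdd (r n)" and r2: "(LINT x|lborel. (r n x)\<^sup>2) \<le> 2 * M * (M - Q (f n) (f n))" for n
    using residual_bound[OF Mp fb f1 r_def] by auto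
  have r2lim: "(\<lambda>n. LINT x|lborel. (r n x)\<^sup>2) \<longlonglongrightarrow> 0"
  proof (rule tendsto_sandwich[of "\<lambda>n. 0" _ _ "\<lambda>n. 2 * M * (M - Q (f n) (f n))"])
    show "(\<lambda>n. 2 * M * (M - Q (f n) (f n))) \<longlonglongrightarrow> 0"
      by (rule tendsto_eq_intros Qf refl | simp)+
  qed (use r2 in auto)
  have r1lim: "(\<lambda>n. LINT x|lborel. \<bar>r n x\<bar>) \<longlonglongrightarrow> 0"
  proof (rule tendstoI)
    fix e :: real assume e: "0 < e"
    define a where "a = measure lborel A"
    \<comment> \<open>With this weight both terms of \<open>abs_integral_le\<close> come out at most
      \<open>e\<close> before they are halved; the added 1 keeps the denominator positive.\<close>
    define d where "d = e / (a + 1)"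
    have a: "0 \<le> a" by (simp add: a_def)
    have d: "0 < d" using e a by (simp add: d_def add_nonneg_pos)
    have "eventually (\<lambda>n. (LINT x|lborel. (r n x)\<^sup>2) < d * e) sequentially"
      using r2lim d e by (intro order_tendstoD(2)[of _ 0]) auto
    then show "eventually (\<lambda>n. dist (LINT x|lborel. \<bar>r n x\<bar>) 0 < e) sequentially"
    proof eventually_elim
      case (elim n)
      have "d * a \<le> e" using a e by (simp add: d_def field_simps)
      moreover have "(LINT x|lborel. (r n x)\<^sup>2) / d < e" using elim d by (simp add: field_simps)
      ultimately have "(d * a + (LINT x|lborel. (r n x)\<^sup>2) / d) / 2 < e" by simp
      then show ?case using abs_integral_le[OF rb d, of n] by (simp add: a_def)
    qed
  qed
  have trunc_bdd: "bdd (\<lambda>x. indicator A x * T_trunc (rad N) (f n) x)" for N n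
    using Tt0 T_trunc_up by (intro bddI[of _ "c N * L1_bound"]) (auto simp: indicator_def)
  have h_bdd: "bdd (\<lambda>x. indicator A x * h N x)" for N
    using h0 h_up by (intro bddI[of _ "c N * L1_bound"]) (auto simp: indicator_def)
  let ?U = "\<lambda>N N' x. T_trunc (rad N) (\<lambda>y. indicator A y * h N' y) x"
  let ?V = "\<lambda>N n x. indicator A x * T_trunc (rad N) (f n) x"
  \<comment> \<open>\<open>M * f n\<close> is \<open>r n\<close> plus the potential of
    \<open>f n\<close> on \<open>A\<close>. The potential is replaced by its truncation at
    \<open>rad N'\<close>, with an error whose integral is at most
    \<open>near_real N' * L1_bound\<close>, and \<open>T_trunc (rad N)\<close> turns integrals into
    pointwise bounds with factor \<open>c N\<close>. Two indices are used because \<open>c N\<close>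
    must stay fixed while \<open>near_real N'\<close> tends to 0.\<close>
  have E1: "\<bar>M * h N x - ?U N N' x\<bar> \<le> c N * (near_real N' * L1_bound)" for N N' x
  proof (rule LIMSEQ_le)
    let ?u = "\<lambda>n. T_trunc (rad N) (\<lambda>y. indicator A y * T_trunc (rad N') (f n) y) x"
    have lim: "?u \<longlonglongrightarrow> ?U N N' x"
      unfolding T_trunc_def[of _ "\<lambda>y. indicator A y * _ y"]
    proof (rule integral_dominated_convergence[where w="\<lambda>y. (c N * (c N' * L1_bound)) * indicator A y"])
      show "integrable lborel (\<lambda>y. (c N * (c N' * L1_bound)) * indicator A y :: real)"
        by (intro integrable_mult_right indicator_integrable)
      show "AE y in lborel. (\<lambda>n. k_trunc (rad N) (x - y) * (indicator A y * T_trunc (rad N') (f n) y))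
          \<longlonglongrightarrow> k_trunc (rad N) (x - y) * (indicator A y * h N' y)"
        by (intro AE_I2 tendsto_intros h)
      show "AE y in lborel. norm (k_trunc (rad N) (x - y) * (indicator A y * T_trunc (rad N') (f n) y)) \<le> c N * (c N' * L1_bound) * indicator A y" for n
      proof (rule AE_I2)
        fix y
        have "k_trunc (rad N) (x - y) * T_trunc (rad N') (f n) y \<le> c N * (c N' * L1_bound)"
          using k_trunc_le[OF rad_pos, of N "x - y"] Tt0 T_trunc_up c by (intro mult_mono) (auto simp: c_def trunc_sup_def less_imp_le)
        then show "norm (k_trunc (rad N) (x - y) * (indicator A y * T_trunc (rad N') (f n) y)) \<le> c N * (c N' * L1_bound) * indicator A y"
          using Tt0[of N' n y] by (auto simp: indicator_def abs_mult)
      qed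
    qed measurable
    show "(\<lambda>n. \<bar>M * T_trunc (rad N) (f n) x - ?u n\<bar>) \<longlonglongrightarrow> \<bar>M * h N x - ?U N N' x\<bar>"
      by (intro tendsto_intros h lim)
    show "(\<lambda>n. c N * (LINT x|lborel. \<bar>r n x\<bar>) + c N * (near_real N' * L1_bound)) \<longlonglongrightarrow> c N * (near_real N' * L1_bound)"
      by (rule tendsto_eq_intros r1lim refl | simp)+
    show "\<exists>n0. \<forall>n\<ge>n0. \<bar>M * T_trunc (rad N) (f n) x - ?u n\<bar> \<le> c N * (LINT x|lborel. \<bar>r n x\<bar>) + c N * (near_real N' * L1_bound)"
    proof (intro exI[of _ 0] allI impI)
      fix n
      let ?w = "\<lambda>y. indicator A y * T (f n) y - indicator A y * T_trunc (rad N') (f n) y"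
      have wb: "bdd ?w" using bdd_lin[OF bdd_T[OF fb] trunc_bdd, of 1 n "-1" N' n] by simp
      have "M * T_trunc (rad N) (f n) x - ?u n =
          (LINT y|lborel. M * (k_trunc (rad N) (x - y) * f n y) - k_trunc (rad N) (x - y) * (indicator A y * T_trunc (rad N') (f n) y))"
        unfolding T_trunc_def[of "rad N"]
        by (subst Bochner_Integration.integral_diff) (auto intro!: integrable_mult_right k_trunc_times_integrable fb trunc_bdd rad_pos)
      also have "\<dots> = (LINT y|lborel. k_trunc (rad N) (x - y) * r n y + k_trunc (rad N) (x - y) * ?w y)"
        by (intro Bochner_Integration.integral_cong) (auto simp: r_def algebra_simps)
      also have "\<dots> = T_trunc (rad N) (r n) x + T_trunc (rad N) ?w x"
        unfolding T_trunc_def[of "rad N"] by (intro Bochner_Integration.integral_add k_trunc_times_integrable rb wb rad_pos)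
      finally have eq: "M * T_trunc (rad N) (f n) x - ?u n = T_trunc (rad N) (r n) x + T_trunc (rad N) ?w x" .
      have "\<bar>T_trunc (rad N) (r n) x\<bar> \<le> c N * (LINT x|lborel. \<bar>r n x\<bar>)"
        unfolding c_def by (rule abs_T_trunc_le[OF rb rad_pos])
      moreover have "\<bar>T_trunc (rad N) ?w x\<bar> \<le> c N * (near_real N' * L1_bound)"
      proof -
        have "(LINT y|lborel. \<bar>?w y\<bar>) \<le> (LINT y|lborel. T_near (rad N') (f n) y)"
        proof (rule integral_mono)
          show "integrable lborel (\<lambda>y. \<bar>?w y\<bar>)" using wb by (intro integrable_abs bdd_integrable)
          show "integrable lborel (T_near (rad N') (f n))" by (rule T_near_integral[OF f])
          fix y
          have "0 \<le> T_near (rad N') (f n) y" unfolding T_near_def using fn by (intro Bochner_Integration.integral_nonneg) auto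
          then show "\<bar>?w y\<bar> \<le> T_near (rad N') (f n) y"
            using T_trunc_le_T[OF fb fn rad_pos, of N' n y] T_le_T_trunc_plus_T_near[OF fb fn rad_pos, of n y N'] by (auto simp: indicator_def)
        qed
        also have "\<dots> \<le> near_real N' * L1_bound" by (rule T_near_integral[OF f])
        finally have "c N * (LINT y|lborel. \<bar>?w y\<bar>) \<le> c N * (near_real N' * L1_bound)" using c by (intro mult_left_mono) (auto simp: less_imp_le)
        then show ?thesis using abs_T_trunc_le[OF wb rad_pos, of N x] unfolding c_def by linarith
      qed
      ultimately show "\<bar>M * T_trunc (rad N) (f n) x - ?u n\<bar> \<le> c N * (LINT x|lborel. \<bar>r n x\<bar>) + c N * (near_real N' * L1_bound)"
        unfolding eq by linarith
    qed
  qed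
  \<comment> \<open>The supremum may be infinite. With values in \<open>ennreal\<close> the equation
    \<open>E3\<close> holds at every point by monotone convergence.\<close>
  define G where "G x = (SUP N. ennreal (h N x))" for x
  have G_m [measurable]: "G \<in> borel_measurable borel" unfolding G_def[abs_def] by measurable
  have incG: "incseq (\<lambda>N. ennreal (h N x))" for x by (auto simp: incseq_def intro!: ennreal_leI h_mono)
  \<comment> \<open>Here \<open>N'\<close> tends to infinity at fixed \<open>N\<close>. The
    truncated potentials of \<open>h N'\<close> converge to \<open>M * h N x\<close> by
    \<open>E1\<close> and increase to the integral by monotone convergence, so the two
    agree.\<close>
  have E2: "ennreal (M * h N x) = (\<integral>\<^sup>+ y. ennreal (k_trunc (rad N) (x - y)) * G y * indicator A y \<partial>lborel)" for N x
  proof -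
    have "(\<lambda>N'. ?U N N' x) \<longlonglongrightarrow> M * h N x"
    proof (rule LIM_zero_cancel, rule Lim_null_comparison)
      show "\<forall>\<^sub>F N' in sequentially. norm (?U N N' x - M * h N x) \<le> c N * (near_real N' * L1_bound)"
        using E1[of N x] by (intro always_eventually) (simp add: abs_minus_commute)
      show "(\<lambda>N'. c N * (near_real N' * L1_bound)) \<longlonglongrightarrow> 0" by (rule tendsto_eq_intros near_real_tendsto_0 refl | simp)+
    qed
    then have l1: "(\<lambda>N'. ennreal (?U N N' x)) \<longlonglongrightarrow> ennreal (M * h N x)" by (rule tendsto_ennrealI)
    have eq: "ennreal (?U N N' x) =
        (\<integral>\<^sup>+ y. ennreal (k_trunc (rad N) (x - y)) * indicator A y * ennreal (h N' y) \<partial>lborel)" for N'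
    proof -
      have "ennreal (?U N N' x) =
         (\<integral>\<^sup>+ y. ennreal (k_trunc (rad N) (x - y) * (indicator A y * h N' y)) \<partial>lborel)"
        unfolding T_trunc_def using h0 by (intro nn_integral_eq_integral[symmetric] k_trunc_times_integrable h_bdd rad_pos) auto
      also have "\<dots> = (\<integral>\<^sup>+ y. ennreal (k_trunc (rad N) (x - y)) * indicator A y * ennreal (h N' y) \<partial>lborel)"
        by (intro nn_integral_cong) (auto simp: indicator_def ennreal_mult')
      finally show ?thesis .
    qed
    have "(\<integral>\<^sup>+ y. ennreal (k_trunc (rad N) (x - y)) * G y * indicator A y \<partial>lborel) =
        (\<integral>\<^sup>+ y. (SUP N'. ennreal (k_trunc (rad N) (x - y)) * indicator A y * ennreal (h N' y)) \<partial>lborel)"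
      unfolding G_def
      by (intro nn_integral_cong) (subst SUP_mult_left_ennreal[symmetric], simp only: mult_ac)
    also have "\<dots> = (SUP N'. \<integral>\<^sup>+ y. ennreal (k_trunc (rad N) (x - y)) * indicator A y * ennreal (h N' y) \<partial>lborel)"
      using h_mono by (intro nn_integral_monotone_convergence_SUP)
        (auto simp: incseq_def le_fun_def intro!: mult_left_mono ennreal_leI)
    finally have sup: "(\<integral>\<^sup>+ y. ennreal (k_trunc (rad N) (x - y)) * G y * indicator A y \<partial>lborel) =
       (SUP N'. ennreal (?U N N' x))" by (simp only: eq)
    have "incseq (\<lambda>N'. ennreal (?U N N' x))"
      unfolding eq using h_mono by (auto simp: incseq_def intro!: nn_integral_mono mult_left_mono ennreal_leI)
    from LIMSEQ_SUP[OF this] show ?thesis unfolding sup using l1 LIMSEQ_unique by blast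
  qed
  \<comment> \<open>Now \<open>N\<close> grows: off the diagonal \<open>k_trunc (rad N)\<close>
    increases to \<open>k\<close> and equals it from some \<open>N\<close> on.\<close>
  have E3: "ennreal M * G x = (\<integral>\<^sup>+ y. ennreal (k (x - y)) * G y * indicator A y \<partial>lborel)" for x
  proof -
    have "ennreal M * G x = (SUP N. ennreal (M * h N x))"
      unfolding G_def using Mp by (subst SUP_mult_left_ennreal) (auto simp: ennreal_mult')
    also have "\<dots> = (SUP N. \<integral>\<^sup>+ y. ennreal (k_trunc (rad N) (x - y)) * (G y * indicator A y) \<partial>lborel)"
      unfolding E2 by (simp add: mult.assoc)
    also have "\<dots> = (\<integral>\<^sup>+ y. (SUP N. ennreal (k_trunc (rad N) (x - y)) * (G y * indicator A y)) \<partial>lborel)"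
      by (intro nn_integral_monotone_convergence_SUP[symmetric])
        (auto simp: incseq_def le_fun_def intro!: mult_right_mono ennreal_leI k_trunc_antimono rad_pos rad_antimono)
    also have "\<dots> = (\<integral>\<^sup>+ y. ennreal (k (x - y)) * (G y * indicator A y) \<partial>lborel)"
    proof (rule nn_integral_cong_AE)
      have "AE y in lborel. y \<noteq> x" by (rule AE_lborel_singleton)
      then show "AE y in lborel. (SUP N. ennreal (k_trunc (rad N) (x - y)) * (G y * indicator A y)) = ennreal (k (x - y)) * (G y * indicator A y)"
      proof eventually_elim
        case (elim y)
        have "(SUP N. ennreal (k_trunc (rad N) (x - y))) = ennreal (k (x - y))"
        proof (rule antisym)
          show "(SUP N. ennreal (k_trunc (rad N) (x - y))) \<le> ennreal (k (x - y))"
            using elim by (intro SUP_least ennreal_leI k_trunc_le_k rad_pos) auto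
          obtain N where "inverse (real (Suc N)) < norm (x - y)"
            using reals_Archimedean[of "norm (x - y)"] elim by auto
          then have "k_trunc (rad N) (x - y) = k (x - y)" by (intro k_trunc_eq_k) (simp add: rad_def)
          then show "ennreal (k (x - y)) \<le> (SUP N. ennreal (k_trunc (rad N) (x - y)))"
            by (metis SUP_upper UNIV_I)
        qed
        then show ?case by (simp add: SUP_mult_right_ennreal[symmetric])
      qed
    qed
    finally show ?thesis by (simp add: mult.assoc)
  qed
  have hI: "(\<lambda>n. LINT x|lborel. (?V N n x)\<^sup>2) \<longlonglongrightarrow> (LINT x|lborel. (indicator A x * h N x)\<^sup>2)" for N
  proof (rule integral_dominated_convergence[where w="\<lambda>y. (c N * L1_bound)\<^sup>2 * indicator A y"])
    show "integrable lborel (\<lambda>y. (c N * L1_bound)\<^sup>2 * indicator A y :: real)"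
      by (intro integrable_mult_right indicator_integrable)
    show "AE x in lborel. (\<lambda>n. (?V N n x)\<^sup>2) \<longlonglongrightarrow> (indicator A x * h N x)\<^sup>2"
      by (intro AE_I2 tendsto_intros h)
    show "AE x in lborel. norm ((?V N n x)\<^sup>2) \<le> (c N * L1_bound)\<^sup>2 * indicator A x" for n
      using Tt0 T_trunc_up by (intro AE_I2) (auto simp: indicator_def intro!: power_mono)
  qed measurable
  \<comment> \<open>On \<open>A\<close> the potential is \<open>M * f n x - r n x\<close>, so its
    square is at most twice the sum of the squares. The first part contributes
    \<open>2 * M\<^sup>2\<close>. The second contributes \<open>4 * M\<^sup>2\<close>, since
    \<open>r n\<close> has square integral at most \<open>2 * M * M\<close> because
    \<open>Q (f n) (f n)\<close> is nonnegative.\<close>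
  have hI_le: "(LINT x|lborel. (indicator A x * h N x)\<^sup>2) \<le> 6 * M\<^sup>2" for N
  proof (rule LIMSEQ_le_const2[OF hI], intro exI[of _ 0] allI impI)
    fix n
    have "(LINT x|lborel. (?V N n x)\<^sup>2) \<le>
        (LINT x|lborel. (2 * M\<^sup>2) * (f n x)\<^sup>2 + 2 * (r n x)\<^sup>2)"
    proof (rule integral_mono)
      show "integrable lborel (\<lambda>x. (2 * M\<^sup>2) * (f n x)\<^sup>2 + 2 * (r n x)\<^sup>2)"
        by (intro bdd_integrable bdd_lin bdd_square fb rb)
      fix x
      have "(?V N n x)\<^sup>2 \<le> (indicator A x * T (f n) x)\<^sup>2"
        using Tt0 T_trunc_le_T[OF fb fn rad_pos] by (intro power_mono mult_left_mono) auto
      also have "indicator A x * T (f n) x = M * f n x - r n x" by (simp add: r_def)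
      also have "(M * f n x - r n x)\<^sup>2 \<le> (2 * M\<^sup>2) * (f n x)\<^sup>2 + 2 * (r n x)\<^sup>2"
        using zero_le_power2[of "M * f n x + r n x"] by (simp add: power2_eq_square algebra_simps)
      finally show "(?V N n x)\<^sup>2 \<le> (2 * M\<^sup>2) * (f n x)\<^sup>2 + 2 * (r n x)\<^sup>2" .
    qed (intro bdd_integrable bdd_square trunc_bdd)
    also have "\<dots> = (2 * M\<^sup>2) * (LINT x|lborel. (f n x)\<^sup>2) + 2 * (LINT x|lborel. (r n x)\<^sup>2)"
      using Bochner_Integration.integral_add[OF integrable_mult_right[OF bdd_integrable[OF bdd_square[OF fb]]]
          integrable_mult_right[OF bdd_integrable[OF bdd_square[OF rb]]], of "2 * M\<^sup>2" n 2 n] by simp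
    also have "\<dots> \<le> (2 * M\<^sup>2) * 1 + 2 * (2 * M * M)"
    proof (intro add_mono mult_left_mono f1)
      have "0 \<le> Q (f n) (f n)" unfolding Q_def using fn
        by (intro Bochner_Integration.integral_nonneg mult_nonneg_nonneg T_nonneg) auto
      then have "2 * M * (M - Q (f n) (f n)) \<le> 2 * M * M" using Mp by (intro mult_left_mono) auto
      then show "(LINT x|lborel. (r n x)\<^sup>2) \<le> 2 * M * M" using r2[of n] by linarith
    qed auto
    also have "\<dots> = 6 * M\<^sup>2" by (simp add: power2_eq_square)
    finally show "(LINT x|lborel. (?V N n x)\<^sup>2) \<le> 6 * M\<^sup>2" .
  qed
  have E4: "(\<integral>\<^sup>+ x. (G x)\<^sup>2 * indicator A x \<partial>lborel) < \<infinity>"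
  proof -
    have sq: "(G x)\<^sup>2 * indicator A x = (SUP N. ennreal ((indicator A x * h N x)\<^sup>2))" for x
    proof (cases "x \<in> A")
      case True
      have "(\<lambda>N. ennreal (h N x)) \<longlonglongrightarrow> G x" unfolding G_def by (rule LIMSEQ_SUP[OF incG])
      then have "(\<lambda>N. ennreal (h N x) * ennreal (h N x)) \<longlonglongrightarrow> G x * G x"
        by (intro tendsto_mult_ennreal) auto
      also have "(\<lambda>N. ennreal (h N x) * ennreal (h N x)) = (\<lambda>N. ennreal ((indicator A x * h N x)\<^sup>2))"
        using h0 True by (auto simp: fun_eq_iff power2_eq_square ennreal_mult)
      finally have l: "(\<lambda>N. ennreal ((indicator A x * h N x)\<^sup>2)) \<longlonglongrightarrow> (G x)\<^sup>2 * indicator A x"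
        using True by (simp add: power2_eq_square)
      have "incseq (\<lambda>N. ennreal ((indicator A x * h N x)\<^sup>2))"
        using h0 h_mono by (auto simp: incseq_def intro!: ennreal_leI power_mono mult_left_mono)
      from LIMSEQ_SUP[OF this] l show ?thesis using LIMSEQ_unique by blast
    qed simp
    have "(\<integral>\<^sup>+ x. (G x)\<^sup>2 * indicator A x \<partial>lborel) = (SUP N. \<integral>\<^sup>+ x. ennreal ((indicator A x * h N x)\<^sup>2) \<partial>lborel)"
      unfolding sq using h0 h_mono by (intro nn_integral_monotone_convergence_SUP)
        (auto simp: incseq_def le_fun_def intro!: ennreal_leI power_mono mult_left_mono)
    also have "\<dots> \<le> ennreal (6 * M\<^sup>2)"
      using hI_le by (intro SUP_least) (auto simp: square_nn_integral[OF h_bdd] intro!: ennreal_leI)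
    also have "\<dots> < \<infinity>" by simp
    finally show ?thesis .
  qed
  \<comment> \<open>If \<open>G\<close> vanished on \<open>A\<close>, so would every
    \<open>h N\<close> almost everywhere, and the potentials truncated at a fixed radius would tend
    to 0 in square mean on \<open>A\<close>. The energy of \<open>f n\<close> would in the limit be
    at most \<open>M / 4 + near_real N\<close>, which is below \<open>3 * M / 4\<close>; yet it
    tends to \<open>M\<close>.\<close>
  have E5: "\<not> (AE x in lborel. x \<in> A \<longrightarrow> G x = 0)"
  proof
    assume G0: "AE x in lborel. x \<in> A \<longrightarrow> G x = 0"
    have "eventually (\<lambda>N. near_real N < M / 2) sequentially" using near_real_tendsto_0 Mp by (intro order_tendstoD(2)[of _ 0]) auto
    then obtain N where N: "near_real N < M / 2" by (auto simp: eventually_sequentially)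
    have "(LINT x|lborel. (indicator A x * h N x)\<^sup>2) = (LINT x|(lborel :: 'a measure). 0)"
    proof (rule integral_cong_AE)
      show "AE x in lborel. (indicator A x * h N x)\<^sup>2 = 0" using G0
      proof eventually_elim
        case (elim x)
        have "ennreal (h N x) \<le> G x" unfolding G_def by (rule SUP_upper) simp
        then show ?case using elim h0[of N x] by (auto simp: indicator_def)
      qed
    qed auto
    then have I0: "(\<lambda>n. LINT x|lborel. (?V N n x)\<^sup>2) \<longlonglongrightarrow> 0" using hI[of N] by simp
    have "M \<le> M / 4 + 0 / M + near_real N"
    proof (rule LIMSEQ_le[OF Qf])
      show "(\<lambda>n. M / 4 + (LINT x|lborel. (?V N n x)\<^sup>2) / M + near_real N) \<longlonglongrightarrow> M / 4 + 0 / M + near_real N"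
        using Mp by (intro tendsto_intros I0) auto
      show "\<exists>n0. \<forall>n\<ge>n0. Q (f n) (f n) \<le> M / 4 + (LINT x|lborel. (?V N n x)\<^sup>2) / M + near_real N"
      proof (intro exI[of _ 0] allI impI)
        fix n
        have "(LINT x|lborel. f n x * T_trunc (rad N) (f n) x) \<le> (LINT x|lborel. (M / 4) * (f n x)\<^sup>2 + (1 / M) * (?V N n x)\<^sup>2)"
        proof (rule integral_mono)
          show "integrable lborel (\<lambda>x. (M / 4) * (f n x)\<^sup>2 + (1 / M) * (?V N n x)\<^sup>2)"
            by (intro bdd_integrable bdd_lin bdd_square fb trunc_bdd)
          have fv: "f n x * T_trunc (rad N) (f n) x = f n x * ?V N n x" for x
            using bdd_outside[OF fb, of x n] by (auto simp: indicator_def)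
          show "integrable lborel (\<lambda>x. f n x * T_trunc (rad N) (f n) x)"
            unfolding fv by (intro bdd_integrable bdd_mult fb trunc_bdd)
          fix x
          have "0 \<le> (M * f n x - 2 * ?V N n x)\<^sup>2 / (4 * M)" using Mp by simp
          also have "\<dots> = (M / 4) * (f n x)\<^sup>2 + (1 / M) * (?V N n x)\<^sup>2 - f n x * ?V N n x"
            using Mp by (simp add: power2_eq_square field_simps)
          finally show "f n x * T_trunc (rad N) (f n) x \<le> (M / 4) * (f n x)\<^sup>2 + (1 / M) * (?V N n x)\<^sup>2" unfolding fv by simp
        qed
        also have "\<dots> = (M / 4) * (LINT x|lborel. (f n x)\<^sup>2) + (1 / M) * (LINT x|lborel. (?V N n x)\<^sup>2)"
          using Bochner_Integration.integral_add[OF integrable_mult_right[OF bdd_integrable[OF bdd_square[OF fb]]]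
              integrable_mult_right[OF bdd_integrable[OF bdd_square[OF trunc_bdd]]], of "M / 4" n "1 / M" N n] by simp
        also have "\<dots> \<le> M / 4 * 1 + (1 / M) * (LINT x|lborel. (?V N n x)\<^sup>2)"
          using Mp f1 by (intro add_mono mult_left_mono) auto
        finally show "Q (f n) (f n) \<le> M / 4 + (LINT x|lborel. (?V N n x)\<^sup>2) / M + near_real N"
          using Q_le_T_trunc[OF f, of n N] by simp
      qed
    qed
    then show False using N Mp by simp
  qed
  show ?thesis by (rule that[OF G_m E4 E5 E3])
qed

end

section \<open>Polarization\<close>

text \<open>The reflection in the hyperplane through \<open>v\<close> orthogonal to \<open>v\<close>. Polarization moves mass to
  the side of the origin, and every ball around the origin is unchanged by it.\<close>

definition reflect :: "'a::euclidean_space \<Rightarrow> 'a \<Rightarrow> 'a" where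
  "reflect v x = x + (2 - 2 * (x \<bullet> v) / (v \<bullet> v)) *\<^sub>R v"

definition polarize :: "'a::euclidean_space \<Rightarrow> ('a \<Rightarrow> real) \<Rightarrow> 'a \<Rightarrow> real" where
  "polarize v f x = (if x \<bullet> v \<le> v \<bullet> v then max (f x) (f (reflect v x)) else min (f x) (f (reflect v x)))"

definition polset :: "'a::euclidean_space \<Rightarrow> 'a set \<Rightarrow> 'a set" where
  "polset v A = {x. if x \<bullet> v \<le> v \<bullet> v then x \<in> A \<or> reflect v x \<in> A else x \<in> A \<and> reflect v x \<in> A}"

lemma reflect_inner: "v \<noteq> 0 \<Longrightarrow> reflect v x \<bullet> v = 2 * (v \<bullet> v) - x \<bullet> v"
  by (simp add: reflect_def inner_add_left field_simps)

lemma reflect_reflect: "v \<noteq> 0 \<Longrightarrow> reflect v (reflect v x) = x"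
proof -
  assume v: "v \<noteq> 0"
  have "reflect v (reflect v x) = x + ((2 - 2 * (x \<bullet> v) / (v \<bullet> v)) + (2 - 2 * (reflect v x \<bullet> v) / (v \<bullet> v))) *\<^sub>R v"
    by (simp only: reflect_def[of v "reflect v x"] scaleR_add_left) (simp add: reflect_def)
  also have "(2 - 2 * (x \<bullet> v) / (v \<bullet> v)) + (2 - 2 * (reflect v x \<bullet> v) / (v \<bullet> v)) = 0"
    using v by (simp add: reflect_inner field_simps)
  finally show ?thesis by simp
qed

lemma reflect_id: "v \<noteq> 0 \<Longrightarrow> x \<bullet> v = v \<bullet> v \<Longrightarrow> reflect v x = x"
  by (simp add: reflect_def)

text \<open>\<open>v \<bullet> v - x \<bullet> v\<close> divided by the norm of \<open>v\<close> is
  the signed distance of \<open>x\<close> from the hyperplane, positive on the side of the origin.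
  So the sign of the product decides which of \<open>y\<close> and its mirror image is nearer to
  \<open>x\<close>; the distance comparisons below all come from this identity.\<close>

lemma norm_diff_reflect_square:
  assumes v: "v \<noteq> 0"
  shows "(norm (x - reflect v y))\<^sup>2 = (norm (x - y))\<^sup>2 + 4 * ((v \<bullet> v - y \<bullet> v) * (v \<bullet> v - x \<bullet> v)) / (v \<bullet> v)"
proof -
  define c where "c = 2 - 2 * (y \<bullet> v) / (v \<bullet> v)"
  have cv: "c * (v \<bullet> v) = 2 * (v \<bullet> v) - 2 * (y \<bullet> v)" using v by (simp add: c_def field_simps)
  have "x - reflect v y = (x - y) - c *\<^sub>R v" by (simp add: reflect_def c_def)
  moreover have "(norm ((x - y) - c *\<^sub>R v))\<^sup>2 = (norm (x - y))\<^sup>2 - 2 * c * ((x - y) \<bullet> v) + c * (c * (v \<bullet> v))"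
    by (simp add: power2_norm_eq_inner inner_diff_left inner_diff_right algebra_simps inner_commute)
  ultimately have "(norm (x - reflect v y))\<^sup>2 = (norm (x - y))\<^sup>2 - 2 * c * ((x - y) \<bullet> v) + c * (c * (v \<bullet> v))"
    by (simp only:)
  also have "\<dots> = (norm (x - y))\<^sup>2 + c * (2 * (v \<bullet> v) - 2 * (x \<bullet> v))"
    unfolding cv by (simp add: inner_diff_left algebra_simps)
  also have "c * (2 * (v \<bullet> v) - 2 * (x \<bullet> v)) = 4 * ((v \<bullet> v - y \<bullet> v) * (v \<bullet> v - x \<bullet> v)) / (v \<bullet> v)"
    using v by (simp add: c_def field_simps)
  finally show ?thesis .
qed

lemma norm_reflect_square: "v \<noteq> 0 \<Longrightarrow> (norm (reflect v x))\<^sup>2 = (norm x)\<^sup>2 + 4 * (v \<bullet> v - x \<bullet> v)"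
  using norm_diff_reflect_square[of v 0 x] by simp

lemma norm_reflect_diff_reflect: "v \<noteq> 0 \<Longrightarrow> norm (reflect v x - reflect v y) = norm (x - y)"
proof -
  assume v: "v \<noteq> 0"
  have "(norm (reflect v x - reflect v y))\<^sup>2 = (norm (reflect v x - y))\<^sup>2 + 4 * ((v \<bullet> v - y \<bullet> v) * (x \<bullet> v - v \<bullet> v)) / (v \<bullet> v)"
    using norm_diff_reflect_square[OF v, of "reflect v x" y] by (simp add: reflect_inner[OF v])
  also have "(norm (reflect v x - y))\<^sup>2 = (norm (y - x))\<^sup>2 + 4 * ((v \<bullet> v - x \<bullet> v) * (v \<bullet> v - y \<bullet> v)) / (v \<bullet> v)"
    using norm_diff_reflect_square[OF v, of y x] by (simp add: norm_minus_commute)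
  also have "4 * ((v \<bullet> v - y \<bullet> v) * (x \<bullet> v - v \<bullet> v)) / (v \<bullet> v) = - (4 * ((v \<bullet> v - x \<bullet> v) * (v \<bullet> v - y \<bullet> v)) / (v \<bullet> v))"
    unfolding minus_divide_left by (simp add: algebra_simps)
  finally have "(norm (reflect v x - reflect v y))\<^sup>2 = (norm (x - y))\<^sup>2"
    by (simp add: norm_minus_commute)
  then show ?thesis by simp
qed

lemma norm_diff_reflect_commute: "v \<noteq> 0 \<Longrightarrow> norm (reflect v x - y) = norm (x - reflect v y)"
  using norm_reflect_diff_reflect[of v x "reflect v y"] by (simp add: reflect_reflect)

lemma norm_diff_le_reflect: assumes "v \<noteq> 0" "(x \<bullet> v \<le> v \<bullet> v) = (y \<bullet> v \<le> v \<bullet> v)"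
  shows "norm (x - y) \<le> norm (x - reflect v y)"
proof -
  have "0 \<le> (v \<bullet> v - y \<bullet> v) * (v \<bullet> v - x \<bullet> v)"
    using assms(2) by (cases "x \<bullet> v \<le> v \<bullet> v") (auto intro: mult_nonneg_nonneg mult_nonpos_nonpos)
  then have "(norm (x - y))\<^sup>2 \<le> (norm (x - reflect v y))\<^sup>2"
    unfolding norm_diff_reflect_square[OF assms(1)] by simp
  then show ?thesis by (rule power2_le_imp_le) simp
qed

lemma norm_diff_reflect_le: assumes "v \<noteq> 0" "(x \<bullet> v \<le> v \<bullet> v) \<noteq> (y \<bullet> v \<le> v \<bullet> v)"
  shows "norm (x - reflect v y) \<le> norm (x - y)"
proof -
  have "(v \<bullet> v - y \<bullet> v) * (v \<bullet> v - x \<bullet> v) \<le> 0"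
    using assms(2) by (cases "x \<bullet> v \<le> v \<bullet> v") (auto intro: mult_nonneg_nonpos mult_nonpos_nonneg)
  then have "4 * ((v \<bullet> v - y \<bullet> v) * (v \<bullet> v - x \<bullet> v)) / (v \<bullet> v) \<le> 0"
    by (intro divide_nonpos_nonneg) (auto simp: mult.commute)
  then have "(norm (x - reflect v y))\<^sup>2 \<le> (norm (x - y))\<^sup>2"
    unfolding norm_diff_reflect_square[OF assms(1)] by simp
  then show ?thesis by (rule power2_le_imp_le) simp
qed

lemma reflect_measurable [measurable]: "reflect v \<in> borel_measurable borel"
  unfolding reflect_def[abs_def] by measurable

lemma nn_integral_reflect: "v \<noteq> 0 \<Longrightarrow> g \<in> borel_measurable borel \<Longrightarrow>
    (\<integral>\<^sup>+ x. g (reflect v x) \<partial>lborel) = (\<integral>\<^sup>+ x. g x \<partial>lborel)"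
  by (intro nn_integral_isometric_involution) (auto simp: reflect_reflect norm_reflect_diff_reflect)

lemma polarize_measurable [measurable]: assumes [measurable]: "f \<in> borel_measurable borel" shows "polarize v f \<in> borel_measurable borel"
  unfolding polarize_def[abs_def] by measurable

lemma polarize_cases:
  assumes v: "v \<noteq> 0"
  shows "x \<bullet> v \<le> v \<bullet> v \<Longrightarrow> polarize v f x = max (f x) (f (reflect v x)) \<and> polarize v f (reflect v x) = min (f x) (f (reflect v x))"
    and "\<not> x \<bullet> v \<le> v \<bullet> v \<Longrightarrow> polarize v f x = min (f x) (f (reflect v x)) \<and> polarize v f (reflect v x) = max (f x) (f (reflect v x))"
proof -
  assume x: "x \<bullet> v \<le> v \<bullet> v"
  show "polarize v f x = max (f x) (f (reflect v x)) \<and> polarize v f (reflect v x) = min (f x) (f (reflect v x))"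
  \<comment> \<open>On the hyperplane the mirror image lies on the same closed side as
    \<open>x\<close>; the two formulas still hold because \<open>x\<close> is its own mirror
    image.\<close>
  proof (cases "x \<bullet> v = v \<bullet> v")
    case True
    then show ?thesis using v by (simp add: polarize_def reflect_id)
  next
    case False
    then show ?thesis using x v by (simp add: polarize_def reflect_inner reflect_reflect min.commute)
  qed
next
  assume "\<not> x \<bullet> v \<le> v \<bullet> v"
  then show "polarize v f x = min (f x) (f (reflect v x)) \<and> polarize v f (reflect v x) = max (f x) (f (reflect v x))"
    using v by (simp add: polarize_def reflect_inner reflect_reflect max.commute)
qed

lemma polarize_indicator: "polarize v (indicator A) = indicator (polset v A)"
  by (auto simp: fun_eq_iff polarize_def polset_def indicator_def)

lemma polset_measurable [measurable]: assumes [measurable]: "A \<in> sets borel" shows "polset v A \<in> sets borel"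
  unfolding polset_def by measurable

text \<open>Polarization only permutes the two values on each pair of mirror points. Adding to an
  integral its reflected copy produces these pairs without splitting space into half-spaces.\<close>

lemma polarize_square_integral:
  assumes v: "v \<noteq> 0" and [measurable]: "f \<in> borel_measurable borel"
  shows "(\<integral>\<^sup>+ x. ennreal ((polarize v f x)\<^sup>2) \<partial>lborel) = (\<integral>\<^sup>+ x. ennreal ((f x)\<^sup>2) \<partial>lborel)"
proof -
  have double: "2 * (\<integral>\<^sup>+ x. ennreal ((g x)\<^sup>2) \<partial>lborel) = (\<integral>\<^sup>+ x. ennreal ((g x)\<^sup>2 + (g (reflect v x))\<^sup>2) \<partial>lborel)"
    if [measurable]: "g \<in> borel_measurable borel" for g
  proof -
    have "(\<integral>\<^sup>+ x. ennreal ((g x)\<^sup>2 + (g (reflect v x))\<^sup>2) \<partial>lborel) =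
        (\<integral>\<^sup>+ x. ennreal ((g x)\<^sup>2) \<partial>lborel) + (\<integral>\<^sup>+ x. ennreal ((g (reflect v x))\<^sup>2) \<partial>lborel)"
      by (simp add: nn_integral_add)
    also have "(\<integral>\<^sup>+ x. ennreal ((g (reflect v x))\<^sup>2) \<partial>lborel) = (\<integral>\<^sup>+ x. ennreal ((g x)\<^sup>2) \<partial>lborel)"
      using nn_integral_reflect[OF v, of "\<lambda>x. ennreal ((g x)\<^sup>2)"] by simp
    finally show ?thesis by (simp add: mult_2)
  qed
  have "(polarize v f x)\<^sup>2 + (polarize v f (reflect v x))\<^sup>2 = (f x)\<^sup>2 + (f (reflect v x))\<^sup>2" for x
    using polarize_cases[OF v, of x f] by (cases "x \<bullet> v \<le> v \<bullet> v") (auto simp: max_def min_def)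
  then have "2 * (\<integral>\<^sup>+ x. ennreal ((polarize v f x)\<^sup>2) \<partial>lborel) = 2 * (\<integral>\<^sup>+ x. ennreal ((f x)\<^sup>2) \<partial>lborel)"
    by (simp only: double[OF assms(2)] double[OF polarize_measurable[OF assms(2)]])
  then show ?thesis by (simp add: ennreal_mult_cancel_left)
qed

lemma emeasure_polset:
  assumes v: "v \<noteq> 0" and [measurable]: "A \<in> sets borel"
  shows "emeasure lborel (polset v A) = emeasure lborel A"
proof -
  have sq: "ennreal ((indicator S x)\<^sup>2) = indicator S x" for S :: "'a set" and x by (simp add: indicator_def)
  show ?thesis using polarize_square_integral[OF v, of "indicator A"]
    unfolding polarize_indicator sq by simp
qed

lemma polset_subset_ball: assumes v: "v \<noteq> 0" "A \<subseteq> ball 0 R" shows "polset v A \<subseteq> ball 0 R"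
proof
  fix x assume x: "x \<in> polset v A"
  show "x \<in> ball 0 R"
  proof (cases "x \<in> A")
    case False
    with x have "x \<bullet> v \<le> v \<bullet> v" "reflect v x \<in> A" by (auto simp: polset_def split: if_splits)
    then have "(norm x)\<^sup>2 \<le> (norm (reflect v x))\<^sup>2" using norm_reflect_square[OF v(1), of x] by simp
    then have "norm x \<le> norm (reflect v x)" by (rule power2_le_imp_le) simp
    then show ?thesis using \<open>reflect v x \<in> A\<close> v(2) by (auto simp: subset_iff)
  qed (use v in auto)
qed

lemma two_point_rearrangement:
  fixes s t s' t' u w :: real
  assumes "s + t = s' + t'" "s \<le> s'" "w \<le> u"
  shows "s * u + t * w \<le> s' * u + t' * w"
proof -
  have "0 \<le> (s' - s) * (u - w)" using assms by (intro mult_nonneg_nonneg) auto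
  moreover have t: "t = s' + t' - s" using assms by simp
  ultimately show ?thesis unfolding t by (simp add: algebra_simps)
qed

text \<open>Rearrangement for two pairs: larger with larger and smaller with smaller gives the
  greatest sum of products, while the total over both pairings does not change.\<close>

lemma max_min_products:
  fixes a a' b b' :: real
  shows "a * b + a' * b' \<le> max a a' * max b b' + min a a' * min b b'"
    and "a * b' + a' * b \<le> max a a' * max b b' + min a a' * min b b'"
    and "max a a' * max b b' + min a a' * min b b' + (min a a' * max b b' + max a a' * min b b') = a * b + a' * b' + (a' * b + a * b')"
proof -
  have "0 \<le> (max a a' - min a a') * (max b b' - min b b')" by (intro mult_nonneg_nonneg) auto
  then show "a * b + a' * b' \<le> max a a' * max b b' + min a a' * min b b'"
    and "a * b' + a' * b \<le> max a a' * max b b' + min a a' * min b b'"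
    by (auto simp: max_def min_def algebra_simps)
qed (auto simp: max_def min_def algebra_simps)

lemma four_point_rearrangement:
  fixes a a' b b' u w :: real
  assumes "w \<le> u"
  shows "(a * b + a' * b') * u + (a' * b + a * b') * w \<le>
    (max a a' * max b b' + min a a' * min b b') * u + (min a a' * max b b' + max a a' * min b b') * w"
  by (rule two_point_rearrangement[OF max_min_products(3)[symmetric] max_min_products(1) assms])

section \<open>Energy and square integral under polarization\<close>

context riesz_kernel
begin

definition form :: "('a \<Rightarrow> real) \<Rightarrow> ennreal" where
  "form f = (\<integral>\<^sup>+ x. \<integral>\<^sup>+ y. ennreal (f x * f y * k (x - y)) \<partial>lborel \<partial>lborel)"

definition norm_sq :: "('a \<Rightarrow> real) \<Rightarrow> ennreal" where
  "norm_sq f = (\<integral>\<^sup>+ x. ennreal ((f x)\<^sup>2) \<partial>lborel)"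

text \<open>The least such \<open>m\<close> is the largest eigenvalue of the operator on \<open>A\<close>. Only nonnegative functions
  are needed because the kernel is nonnegative.\<close>

definition qbound :: "'a set \<Rightarrow> real \<Rightarrow> bool" where
  "qbound A m \<longleftrightarrow> (\<forall>f. f \<in> borel_measurable borel \<longrightarrow> (\<forall>x. 0 \<le> f x) \<longrightarrow> (\<forall>x. x \<notin> A \<longrightarrow> f x = 0) \<longrightarrow>
     form f \<le> ennreal m * norm_sq f)"

lemma qboundD: "qbound A m \<Longrightarrow> f \<in> borel_measurable borel \<Longrightarrow> (\<And>x. 0 \<le> f x) \<Longrightarrow> (\<And>x. x \<notin> A \<Longrightarrow> f x = 0) \<Longrightarrow>
     form f \<le> ennreal m * norm_sq f"
  by (auto simp: qbound_def)

text \<open>Equality from some \<open>n0\<close> on, rather than mere convergence, bounds the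
  integrand of \<open>form f\<close> at each pair of points by a single term of the supremum.
  Monotone convergence in both variables does the rest.\<close>

lemma form_le_SUP:
  fixes g :: "nat \<Rightarrow> 'a \<Rightarrow> real"
  assumes [measurable]: "\<And>n. g n \<in> borel_measurable borel" and g0: "\<And>n x. 0 \<le> g n x"
    and mono: "\<And>m n x. m \<le> n \<Longrightarrow> g m x \<le> g n x" and ev: "\<And>x. \<exists>n0. \<forall>n\<ge>n0. g n x = f x"
  shows "form f \<le> (SUP n. form (g n))"
proof -
  have "form f \<le> (\<integral>\<^sup>+ x. \<integral>\<^sup>+ y. (SUP n. ennreal (g n x * g n y * k (x - y))) \<partial>lborel \<partial>lborel)"
    unfolding form_def
  proof (intro nn_integral_mono)
    fix x y
    obtain n0 n1 where n: "\<forall>n\<ge>n0. g n x = f x" "\<forall>n\<ge>n1. g n y = f y" using ev by meson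
    have "g (max n0 n1) x = f x" "g (max n0 n1) y = f y"
      using n(1)[rule_format, of "max n0 n1"] n(2)[rule_format, of "max n0 n1"] by auto
    then have eq: "f x * f y * k (x - y) = g (max n0 n1) x * g (max n0 n1) y * k (x - y)" by (simp only:)
    show "ennreal (f x * f y * k (x - y)) \<le> (SUP n. ennreal (g n x * g n y * k (x - y)))"
      unfolding eq by (rule SUP_upper) (rule UNIV_I)
  qed
  also have "\<dots> = (\<integral>\<^sup>+ x. (SUP n. \<integral>\<^sup>+ y. ennreal (g n x * g n y * k (x - y)) \<partial>lborel) \<partial>lborel)"
    using g0 mono by (intro nn_integral_cong nn_integral_monotone_convergence_SUP)
      (auto simp: incseq_def le_fun_def intro!: ennreal_leI mult_right_mono mult_mono)
  also have "\<dots> = (SUP n. form (g n))"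
    unfolding form_def using g0 mono by (intro nn_integral_monotone_convergence_SUP)
      (auto simp: incseq_def le_fun_def intro!: nn_integral_mono ennreal_leI mult_right_mono mult_mono)
  finally show ?thesis .
qed

text \<open>Averaging over the four pairs of reflected points reduces the inequality to four points, where
  it holds since the kernel decreases with the distance.\<close>

lemma form_polarize:
  assumes v: "v \<noteq> 0" and [measurable]: "f \<in> borel_measurable borel" and f0: "\<And>x. 0 \<le> f x"
  shows "form f \<le> form (polarize v f)"
proof -
  define S where "S g x y = g x * g y * k (x - y) + g (reflect v x) * g y * k (reflect v x - y) +
      (g x * g (reflect v y) * k (x - reflect v y) + g (reflect v x) * g (reflect v y) * k (reflect v x - reflect v y))" for g x y
  have four: "4 * form g = (\<integral>\<^sup>+ x. \<integral>\<^sup>+ y. ennreal (S g x y) \<partial>lborel \<partial>lborel)"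
    if [measurable]: "g \<in> borel_measurable borel" and g0: "\<And>x. 0 \<le> g x" for g
  proof -
    have inner: "(\<integral>\<^sup>+ y. ennreal (g u * g (reflect v y) * k (u - reflect v y)) \<partial>lborel) = (\<integral>\<^sup>+ y. ennreal (g u * g y * k (u - y)) \<partial>lborel)" for u
      using nn_integral_reflect[OF v, of "\<lambda>y. ennreal (g u * g y * k (u - y))"] by simp
    have outer: "(\<integral>\<^sup>+ x. \<integral>\<^sup>+ y. ennreal (g (reflect v x) * g y * k (reflect v x - y)) \<partial>lborel \<partial>lborel) = form g"
      using nn_integral_reflect[OF v, of "\<lambda>x. \<integral>\<^sup>+ y. ennreal (g x * g y * k (x - y)) \<partial>lborel"] by (simp add: form_def)
    have "(\<integral>\<^sup>+ x. \<integral>\<^sup>+ y. ennreal (S g x y) \<partial>lborel \<partial>lborel) =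
       (\<integral>\<^sup>+ x. \<integral>\<^sup>+ y. ennreal (g x * g y * k (x - y)) \<partial>lborel \<partial>lborel) +
       (\<integral>\<^sup>+ x. \<integral>\<^sup>+ y. ennreal (g (reflect v x) * g y * k (reflect v x - y)) \<partial>lborel \<partial>lborel) +
       ((\<integral>\<^sup>+ x. \<integral>\<^sup>+ y. ennreal (g x * g (reflect v y) * k (x - reflect v y)) \<partial>lborel \<partial>lborel) +
       (\<integral>\<^sup>+ x. \<integral>\<^sup>+ y. ennreal (g (reflect v x) * g (reflect v y) * k (reflect v x - reflect v y)) \<partial>lborel \<partial>lborel))"
      using g0 by (simp add: S_def nn_integral_add)
    also have "\<dots> = form g + form g + (form g + form g)"
      unfolding inner outer by (simp add: form_def)
    finally show ?thesis by (simp add: algebra_simps flip: mult_2)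
  qed
  have p0: "0 \<le> polarize v f x" for x using f0 by (simp add: polarize_def le_max_iff_disj)
  \<comment> \<open>For \<open>y = x\<close> or \<open>y = reflect v x\<close> one of the kernels
    takes its conventional value 0 and the comparison could fail. For fixed \<open>x\<close> these
    are at most two points.\<close>
  have pw: "S f x y \<le> S (polarize v f) x y" if "y \<noteq> x" "y \<noteq> reflect v x" for x y
  proof -
    define a a' b b' where "a = f x" "a' = f (reflect v x)" "b = f y" "b' = f (reflect v y)"
    note ab = this
    define u where "u = k (x - y)"
    define w where "w = k (x - reflect v y)"
    have uw: "k (reflect v x - reflect v y) = u" "k (reflect v x - y) = w"
      unfolding u_def w_def k_eq norm_reflect_diff_reflect[OF v] norm_diff_reflect_commute[OF v, of x y] by (rule refl)+
    have Sg: "S g x y = (g x * g y + g (reflect v x) * g (reflect v y)) * u + (g (reflect v x) * g y + g x * g (reflect v y)) * w" for g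
      unfolding S_def uw by (simp add: u_def w_def algebra_simps)
    have ne: "x - y \<noteq> 0" "x - reflect v y \<noteq> 0" using that reflect_reflect[OF v, of y] by auto
    let ?p = "polarize v f x" and ?p' = "polarize v f (reflect v x)" and ?q = "polarize v f y" and ?q' = "polarize v f (reflect v y)"
    show ?thesis
    proof (cases "(x \<bullet> v \<le> v \<bullet> v) = (y \<bullet> v \<le> v \<bullet> v)")
      case True
      have wu: "w \<le> u" unfolding u_def w_def using norm_diff_le_reflect[OF v True] ne by (intro k_antimono) auto
      have "?p * ?q + ?p' * ?q' = max a a' * max b b' + min a a' * min b b'"
           "?p' * ?q + ?p * ?q' = min a a' * max b b' + max a a' * min b b'"
        using polarize_cases[OF v, of x f] polarize_cases[OF v, of y f] True by (auto simp: ab algebra_simps)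
      then show ?thesis
        unfolding Sg ab[symmetric] using four_point_rearrangement[OF wu, of a b a' b'] by (simp only:)
    next
      \<comment> \<open>On opposite sides the mirror image of \<open>y\<close> is the nearer one, so
        \<open>b\<close> and \<open>b'\<close> exchange roles together with \<open>u\<close> and
        \<open>w\<close>.\<close>
      case False
      have wu: "u \<le> w" unfolding u_def w_def using norm_diff_reflect_le[OF v False] ne by (intro k_antimono) auto
      have "?p' * ?q + ?p * ?q' = max a a' * max b b' + min a a' * min b b'"
           "?p * ?q + ?p' * ?q' = min a a' * max b b' + max a a' * min b b'"
        using polarize_cases[OF v, of x f] polarize_cases[OF v, of y f] False by (auto simp: ab algebra_simps)
      then have "(a * b' + a' * b) * w + (a' * b' + a * b) * u \<le>
         (?p' * ?q + ?p * ?q') * w + (?p * ?q + ?p' * ?q') * u"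
        using four_point_rearrangement[OF wu, of a b' a' b] by (simp only: max.commute[of b'] min.commute[of b'] add.commute mult.commute)
      then show ?thesis unfolding Sg ab[symmetric] by (simp add: add.commute)
    qed
  qed
  have "4 * form f \<le> 4 * form (polarize v f)"
    unfolding four[OF assms(2) f0] four[OF polarize_measurable[OF assms(2)] p0]
  proof (rule nn_integral_mono, rule nn_integral_mono_AE)
    fix x
    have "AE y in lborel. y \<noteq> x" "AE y in lborel. y \<noteq> reflect v x" by (rule AE_lborel_singleton)+
    then show "AE y in lborel. ennreal (S f x y) \<le> ennreal (S (polarize v f) x y)"
      by eventually_elim (intro ennreal_leI pw)
  qed
  then show ?thesis by (simp add: ennreal_mult_le_mult_iff)
qed

text \<open>The bound is pulled back: a function on \<open>A\<close> is compared with its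
  polarization, which lives on \<open>polset v A\<close>, has the same square integral and no less
  energy.\<close>

lemma qbound_polset:
  assumes v: "v \<noteq> 0" and q: "qbound (polset v A) m" shows "qbound A m"
  unfolding qbound_def
proof (intro allI impI)
  fix f :: "'a \<Rightarrow> real" assume f: "f \<in> borel_measurable borel" "\<forall>x. 0 \<le> f x" "\<forall>x. x \<notin> A \<longrightarrow> f x = 0"
  have "form f \<le> form (polarize v f)" using v f by (intro form_polarize) auto
  also have "\<dots> \<le> ennreal m * norm_sq (polarize v f)"
  proof (rule qboundD[OF q])
    show "polarize v f x = 0" if "x \<notin> polset v A" for x
      using that f(2,3) by (auto simp: polarize_def polset_def max_def min_def antisym split: if_splits)
  qed (use f in \<open>auto simp: polarize_def le_max_iff_disj\<close>)
  also have "norm_sq (polarize v f) = norm_sq f" unfolding norm_sq_def by (rule polarize_square_integral[OF v f(1)])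
  finally show "form f \<le> ennreal m * norm_sq f" .
qed

text \<open>The substitution \<open>z - x\<close> carries one ball to the other. Unlike a
  translation it is an involution, so the lemma on isometric involutions covers it.\<close>

lemma qbound_reflect_ball: assumes "qbound (ball z r) m" shows "qbound (ball 0 r) m"
  unfolding qbound_def
proof (intro allI impI)
  fix f :: "'a \<Rightarrow> real" assume f[measurable]: "f \<in> borel_measurable borel" and f0: "\<forall>x. 0 \<le> f x" "\<forall>x. x \<notin> ball 0 r \<longrightarrow> f x = 0"
  have "form (\<lambda>x. f (z - x)) \<le> ennreal m * norm_sq (\<lambda>x. f (z - x))"
    using f0 by (intro qboundD[OF assms]) (auto simp: dist_norm)
  also have "norm_sq (\<lambda>x. f (z - x)) = norm_sq f"
    unfolding norm_sq_def using nn_integral_reflect_translate[of "\<lambda>x. ennreal ((f x)\<^sup>2)" z] by simp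
  also have "form (\<lambda>x. f (z - x)) = form f"
  proof -
    have "form (\<lambda>x. f (z - x)) = (\<integral>\<^sup>+ x. \<integral>\<^sup>+ y. ennreal (f (z - x) * f (z - y) * k ((z - x) - (z - y))) \<partial>lborel \<partial>lborel)"
      unfolding form_def by (intro nn_integral_cong) (simp add: k_commute)
    also have "\<dots> = (\<integral>\<^sup>+ x. \<integral>\<^sup>+ y. ennreal (f (z - x) * f y * k ((z - x) - y)) \<partial>lborel \<partial>lborel)"
    proof (rule nn_integral_cong)
      fix x
      show "(\<integral>\<^sup>+ y. ennreal (f (z - x) * f (z - y) * k ((z - x) - (z - y))) \<partial>lborel) = (\<integral>\<^sup>+ y. ennreal (f (z - x) * f y * k ((z - x) - y)) \<partial>lborel)"
        using nn_integral_reflect_translate[of "\<lambda>y. ennreal (f (z - x) * f y * k ((z - x) - y))" z] by simp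
    qed
    also have "\<dots> = form f"
      unfolding form_def using nn_integral_reflect_translate[of "\<lambda>x. \<integral>\<^sup>+ y. ennreal (f x * f y * k (x - y)) \<partial>lborel" z] by simp
    finally show ?thesis .
  qed
  finally show "form f \<le> ennreal m * norm_sq f" .
qed

text \<open>With the weight \<open>s\<close> in Schur's test, the part of the function on \<open>D - B\<close> is controlled by \<open>m\<close>
  and not by \<open>e\<close>, so the square integral of that part need not be small.\<close>

lemma qbound_perturb:
  assumes q: "qbound B m" and m: "0 < m" and B [measurable]: "B \<in> sets borel" and Bf: "emeasure lborel B < \<infinity>" and e: "0 < e"
  obtains \<delta> where "0 < \<delta>" "\<And>D. D \<in> sets borel \<Longrightarrow> emeasure lborel (D - B) \<le> ennreal \<delta> \<Longrightarrow> qbound D (m + e)"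
proof -
  obtain c where c: "0 < c" "\<And>x. (\<integral>\<^sup>+ y. ennreal (k (x - y)) * indicator B y \<partial>lborel) \<le> ennreal c"
    using k_integral_bounded[OF B Bf] by metis
  \<comment> \<open>In the final sum \<open>norm_sq f2\<close> has the coefficient
    \<open>c / s + d\<close> and \<open>norm_sq f1\<close> has \<open>m + s * d\<close>. This
    \<open>s\<close> makes \<open>c / s\<close> equal to \<open>m / 2\<close>, and \<open>d\<close>
    is then chosen small enough to keep both coefficients at most \<open>m + e\<close>.\<close>
  define s where "s = 2 * c / m"
  define d where "d = min (m / 2) (e / s)"
  have s: "0 < s" using c m by (simp add: s_def)
  have d: "0 < d" "s * d \<le> e" "c / s + d \<le> m"
  proof -
    show "0 < d" using m e s by (simp add: d_def)
    have "d \<le> e / s" by (simp add: d_def)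
    then show "s * d \<le> e" using s by (simp add: field_simps)
    have "c / s = m / 2" using c m by (simp add: s_def)
    moreover have "d \<le> m / 2" unfolding d_def by (rule min.cobounded1)
    ultimately show "c / s + d \<le> m" by linarith
  qed
  obtain \<delta> where \<delta>: "0 < \<delta>" "\<And>D x. D \<in> sets borel \<Longrightarrow> emeasure lborel D \<le> ennreal \<delta> \<Longrightarrow>
      (\<integral>\<^sup>+ y. ennreal (k (x - y)) * indicator D y \<partial>lborel) \<le> ennreal d"
    using k_integral_small[OF d(1)] by metis
  show ?thesis
  proof (rule that[OF \<delta>(1)])
    fix D0 assume D0 [measurable]: "D0 \<in> sets borel" and small: "emeasure lborel (D0 - B) \<le> ennreal \<delta>"
    define D where "D = D0 - B"
    have D [measurable]: "D \<in> sets borel" by (simp add: D_def)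
    have kD: "(\<integral>\<^sup>+ y. ennreal (k (x - y)) * indicator D y \<partial>lborel) \<le> ennreal d" for x
      using \<delta>(2)[OF D] small by (simp add: D_def)
    show "qbound D0 (m + e)" unfolding qbound_def
    proof (intro allI impI)
      fix f :: "'a \<Rightarrow> real" assume f [measurable]: "f \<in> borel_measurable borel" and f0: "\<forall>x. 0 \<le> f x" and fD: "\<forall>x. x \<notin> D0 \<longrightarrow> f x = 0"
      define f1 where "f1 x = f x * indicator B x" for x
      define f2 where "f2 x = f x * indicator D x" for x
      have [measurable]: "f1 \<in> borel_measurable borel" "f2 \<in> borel_measurable borel"
        unfolding f1_def[abs_def] f2_def[abs_def] by measurable
      have f12: "f x = f1 x + f2 x" for x using fD by (auto simp: f1_def f2_def D_def indicator_def)
      have f1_0: "0 \<le> f1 x" and f2_0: "0 \<le> f2 x" for x using f0 by (auto simp: f1_def f2_def)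
      \<comment> \<open>The cut-offs change nothing, as \<open>f1\<close> and \<open>f2\<close>
        vanish outside \<open>B\<close> and \<open>D\<close>; they make the one-variable integrals
        at most \<open>d\<close> over \<open>D\<close> and at most \<open>c\<close> over
        \<open>B\<close>.\<close>
      let ?K1 = "\<lambda>x y. k (x - y) * indicator B x * indicator D y"
      let ?K2 = "\<lambda>x y. k (x - y) * indicator D x * indicator B y"
      let ?K3 = "\<lambda>x y. k (x - y) * indicator D x * indicator D y"
      have K1: "(\<integral>\<^sup>+ y. ennreal (k (x - y) * indicator X x * indicator D y) \<partial>lborel) \<le> ennreal d" for x X
        by (rule order_trans[OF _ kD[of x]], rule nn_integral_mono) (auto simp: indicator_def)
      have K2: "(\<integral>\<^sup>+ y. ennreal (k (x - y) * indicator X x * indicator B y) \<partial>lborel) \<le> ennreal c" for x X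
        by (rule order_trans[OF _ c(2)[of x]], rule nn_integral_mono) (auto simp: indicator_def)
      have K1': "(\<integral>\<^sup>+ x. ennreal (k (x - y) * indicator D x * indicator X y) \<partial>lborel) \<le> ennreal d" for y X
        using K1[of y X] by (simp add: k_commute[of _ y] mult_ac)
      have K2': "(\<integral>\<^sup>+ x. ennreal (k (x - y) * indicator B x * indicator X y) \<partial>lborel) \<le> ennreal c" for y X
        using K2[of y X] by (simp add: k_commute[of _ y] mult_ac)
      let ?I = "\<lambda>u v K. \<integral>\<^sup>+ x. \<integral>\<^sup>+ y. ennreal (u x * v y * K x y) \<partial>lborel \<partial>lborel"
      have i1: "?I f1 f2 ?K1 \<le> ennreal (s / 2) * ennreal d * norm_sq f1 + ennreal (1 / (2 * s)) * ennreal c * norm_sq f2"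
        unfolding norm_sq_def by (rule weighted_Schur[OF _ _ _ _ f1_0 f2_0 s K1 K2']) (auto simp: f1_0)
      have "0 < 1 / s" using s by simp
      from weighted_Schur[OF _ _ _ _ f2_0 f1_0 this K2[where X = D] K1'[where X = B]]
      have i2: "?I f2 f1 ?K2 \<le> ennreal (1 / s / 2) * ennreal c * norm_sq f2 + ennreal (1 / (2 * (1 / s))) * ennreal d * norm_sq f1"
        unfolding norm_sq_def by simp
      have i3: "?I f2 f2 ?K3 \<le> ennreal (1 / 2) * ennreal d * norm_sq f2 + ennreal (1 / (2 * 1)) * ennreal d * norm_sq f2"
        unfolding norm_sq_def by (rule weighted_Schur[OF _ _ _ _ f2_0 f2_0 _ K1 K1']) auto
      have i0: "form f1 \<le> ennreal m * norm_sq f1"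
        using f1_0 by (intro qboundD[OF q]) (auto simp: f1_def)
      have pw: "ennreal (f x * f y * k (x - y)) = ennreal (f1 x * f1 y * k (x - y)) + (ennreal (f1 x * f2 y * ?K1 x y) +
          (ennreal (f2 x * f1 y * ?K2 x y) + ennreal (f2 x * f2 y * ?K3 x y)))" for x y
      proof -
        have "f x * f y * k (x - y) = f1 x * f1 y * k (x - y) + (f1 x * f2 y * ?K1 x y + (f2 x * f1 y * ?K2 x y + f2 x * f2 y * ?K3 x y))"
          unfolding f12 by (auto simp: f1_def f2_def indicator_def algebra_simps)
        then show ?thesis using f1_0 f2_0 by (simp add: ennreal_plus del: ennreal_plus[symmetric])
      qed
      have "form f = form f1 + (?I f1 f2 ?K1 +
          (?I f2 f1 ?K2 + ?I f2 f2 ?K3))"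
        unfolding form_def pw by (simp add: nn_integral_add)
      also have "\<dots> \<le> ennreal m * norm_sq f1 + ((ennreal (s / 2) * ennreal d * norm_sq f1 + ennreal (1 / (2 * s)) * ennreal c * norm_sq f2) +
         ((ennreal (1 / s / 2) * ennreal c * norm_sq f2 + ennreal (1 / (2 * (1 / s))) * ennreal d * norm_sq f1) +
          (ennreal (1 / 2) * ennreal d * norm_sq f2 + ennreal (1 / (2 * 1)) * ennreal d * norm_sq f2)))"
        by (intro add_mono i0 i1 i2 i3)
      also have "\<dots> = (ennreal m + (ennreal (s / 2) * ennreal d + ennreal (1 / (2 * (1 / s))) * ennreal d)) * norm_sq f1 +
          (ennreal (1 / (2 * s)) * ennreal c + ennreal (1 / s / 2) * ennreal c + (ennreal (1 / 2) * ennreal d + ennreal (1 / (2 * 1)) * ennreal d)) * norm_sq f2"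
        by (simp only: distrib_left distrib_right ac_simps)
      also have "ennreal m + (ennreal (s / 2) * ennreal d + ennreal (1 / (2 * (1 / s))) * ennreal d) = ennreal (m + s * d)"
        using m s d by (subst (1 2) ennreal_mult[symmetric]) (auto simp flip: ennreal_plus)
      also have "ennreal (1 / (2 * s)) * ennreal c + ennreal (1 / s / 2) * ennreal c + (ennreal (1 / 2) * ennreal d + ennreal (1 / (2 * 1)) * ennreal d) = ennreal (c / s + d)"
        using c s d by (subst (1 2 3 4) ennreal_mult[symmetric]) (auto simp: field_simps simp flip: ennreal_plus)
      also have "ennreal (m + s * d) * norm_sq f1 + ennreal (c / s + d) * norm_sq f2 \<le> ennreal (m + e) * norm_sq f1 + ennreal (m + e) * norm_sq f2"
        by (rule add_mono) (use d e in \<open>auto intro!: mult_right_mono ennreal_leI\<close>)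
      also have "\<dots> = ennreal (m + e) * norm_sq f"
      proof -
        have "norm_sq f = (\<integral>\<^sup>+ x. ennreal ((f1 x)\<^sup>2) + ennreal ((f2 x)\<^sup>2) \<partial>lborel)"
          unfolding norm_sq_def by (intro nn_integral_cong) (use fD in \<open>auto simp: f1_def f2_def D_def indicator_def\<close>)
        also have "\<dots> = norm_sq f1 + norm_sq f2" unfolding norm_sq_def by (rule nn_integral_add) auto
        finally show ?thesis by (simp add: distrib_left)
      qed
      finally show "form f \<le> ennreal (m + e) * norm_sq f" .
    qed
  qed
qed

end

text \<open>The functions \<open>min (f x) n\<close> are bounded, increase with \<open>n\<close> and
  equal \<open>f x\<close> from some \<open>n\<close> on.\<close>

lemma (in riesz_set) qbound_M: "qbound A M"
  unfolding qbound_def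
proof (intro allI impI)
  fix f :: "'a \<Rightarrow> real" assume f [measurable]: "f \<in> borel_measurable borel" and f0: "\<forall>x. 0 \<le> f x" and fA: "\<forall>x. x \<notin> A \<longrightarrow> f x = 0"
  define g where "g n x = min (f x) (real n)" for n x
  have g [measurable]: "g n \<in> borel_measurable borel" for n unfolding g_def[abs_def] by measurable
  have g0: "0 \<le> g n x" for n x using f0 by (simp add: g_def)
  have gb: "bdd (g n)" for n using f0 fA by (intro bddI[of _ "real n"]) (auto simp: g_def indicator_def)
  have le: "form (g n) \<le> ennreal M * norm_sq f" for n
  proof -
    have "form (g n) = ennreal (Q (g n) (g n))" unfolding form_def by (rule Q_nn_integral[OF gb g0, symmetric])
    also have "\<dots> \<le> ennreal (M * (LINT x|lborel. (g n x)\<^sup>2))" by (intro ennreal_leI Q_le_nonneg gb g0)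
    also have "\<dots> = ennreal M * norm_sq (g n)"
      using M_nonneg by (simp add: ennreal_mult' norm_sq_def square_nn_integral[OF gb])
    also have "\<dots> \<le> ennreal M * norm_sq f"
      unfolding norm_sq_def using f0 g0 by (intro mult_left_mono nn_integral_mono ennreal_leI power_mono) (auto simp: g_def)
    finally show ?thesis .
  qed
  have "form f \<le> (SUP n. form (g n))"
  proof (rule form_le_SUP[OF g g0])
    show "g m x \<le> g n x" if "m \<le> n" for m n x using that by (auto simp: g_def)
    show "\<exists>n0. \<forall>n\<ge>n0. g n x = f x" for x
    proof -
      obtain n0 where "f x \<le> real n0" using real_arch_simple by blast
      then show ?thesis by (intro exI[of _ n0]) (auto simp: g_def min_def)
    qed
  qed
  also have "\<dots> \<le> ennreal M * norm_sq f" by (intro SUP_least le)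
  finally show "form f \<le> ennreal M * norm_sq f" .
qed

section \<open>Polarizing a set towards a ball\<close>

lemma norm_reflect_le: assumes "v \<noteq> 0" "\<not> x \<bullet> v \<le> v \<bullet> v" shows "norm (reflect v x) \<le> norm x"
  by (rule power2_le_imp_le) (use norm_reflect_square[OF assms(1), of x] assms(2) in auto)

lemma norm_le_reflect: assumes "v \<noteq> 0" "x \<bullet> v \<le> v \<bullet> v" shows "norm x \<le> norm (reflect v x)"
  by (rule power2_le_imp_le) (use norm_reflect_square[OF assms(1), of x] assms(2) in auto)

lemma polset_mem:
  assumes v: "v \<noteq> 0"
  shows "x \<bullet> v \<le> v \<bullet> v \<Longrightarrow> (x \<in> polset v A \<longleftrightarrow> x \<in> A \<or> reflect v x \<in> A) \<and> (reflect v x \<in> polset v A \<longleftrightarrow> x \<in> A \<and> reflect v x \<in> A)"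
    and "\<not> x \<bullet> v \<le> v \<bullet> v \<Longrightarrow> (x \<in> polset v A \<longleftrightarrow> x \<in> A \<and> reflect v x \<in> A) \<and> (reflect v x \<in> polset v A \<longleftrightarrow> x \<in> A \<or> reflect v x \<in> A)"
  using polarize_cases[OF v, of x "indicator A"] unfolding polarize_indicator
  by (cases "x \<in> A"; cases "reflect v x \<in> A"; auto simp: indicator_def split: if_splits)+

text \<open>Count points outside \<open>B\<close> on each pair of mirror points. If the far point
  lies in \<open>B\<close>, so does the near one, hence a moved point never leaves \<open>B\<close>.
  A pair with near point in \<open>B - A\<close> and far point in \<open>A - B\<close> loses its
  outside point; on all other pairs the count does not grow.\<close>

lemma polset_gain:
  fixes v :: "'a::euclidean_space"
  assumes v: "v \<noteq> 0" and A [measurable]: "A \<in> sets borel" and B [measurable]: "B \<in> sets borel" and B_def: "B = ball 0 r"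
  shows "emeasure lborel (polset v A - B) + emeasure lborel {x. x \<in> B - A \<and> reflect v x \<in> A - B} \<le> emeasure lborel (A - B)"
proof -
  define G where "G = {x. x \<in> B - A \<and> reflect v x \<in> A - B}"
  define D where "D = polset v A - B"
  have [measurable]: "G \<in> sets borel" "D \<in> sets borel" unfolding G_def D_def by measurable
  have double: "2 * emeasure lborel S = (\<integral>\<^sup>+ x. indicator S x + indicator S (reflect v x) \<partial>lborel)"
    if [measurable]: "S \<in> sets borel" for S :: "'a set"
    using nn_integral_reflect[OF v, of "indicator S"] by (simp add: nn_integral_add mult_2)
  have "2 * (emeasure lborel D + emeasure lborel G) =
      (\<integral>\<^sup>+ x. (indicator D x + indicator D (reflect v x)) + (indicator G x + indicator G (reflect v x)) \<partial>lborel)"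
    by (simp add: distrib_left double nn_integral_add)
  also have "\<dots> \<le> (\<integral>\<^sup>+ x. indicator (A - B) x + indicator (A - B) (reflect v x) \<partial>lborel)"
  proof (rule nn_integral_mono)
    fix x
    show "(indicator D x + indicator D (reflect v x)) + (indicator G x + indicator G (reflect v x)) \<le>
        (indicator (A - B) x + indicator (A - B) (reflect v x) :: ennreal)"
    proof (cases "x \<bullet> v \<le> v \<bullet> v")
      case True
      have "reflect v x \<in> B \<Longrightarrow> x \<in> B" using norm_le_reflect[OF v True] by (simp add: B_def)
      then show ?thesis using polset_mem(1)[OF v True, of A]
        by (auto simp: G_def D_def indicator_def reflect_reflect[OF v])
    next
      case False
      have "x \<in> B \<Longrightarrow> reflect v x \<in> B" using norm_reflect_le[OF v False] by (simp add: B_def)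
      then show ?thesis using polset_mem(2)[OF v False, of A]
        by (auto simp: G_def D_def indicator_def reflect_reflect[OF v])
    qed
  qed
  also have "\<dots> = 2 * emeasure lborel (A - B)" by (simp add: double)
  finally have "emeasure lborel D + emeasure lborel G \<le> emeasure lborel (A - B)"
    by (subst (asm) ennreal_mult_le_mult_iff) auto
  then show ?thesis by (simp only: G_def D_def)
qed

section \<open>Dependence of a reflection on its vector\<close>

lemma sgn_Lipschitz:
  fixes v w :: "'a::real_inner"
  assumes "0 < e" "e \<le> norm v" "e \<le> norm w"
  shows "norm (v /\<^sub>R norm v - w /\<^sub>R norm w) \<le> 2 / e * norm (v - w)"
proof -
  have n: "0 < norm v" "0 < norm w" using assms by linarith+
  have "v /\<^sub>R norm v - w /\<^sub>R norm w = (v - w) /\<^sub>R norm v + (inverse (norm v) - inverse (norm w)) *\<^sub>R w"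
    by (simp add: algebra_simps)
  also have "norm \<dots> \<le> norm (v - w) / norm v + \<bar>inverse (norm v) - inverse (norm w)\<bar> * norm w"
    by (rule order_trans[OF norm_triangle_ineq]) (simp add: divide_inverse mult.commute)
  also have "\<bar>inverse (norm v) - inverse (norm w)\<bar> * norm w = \<bar>norm w - norm v\<bar> / norm v"
  proof -
    have "inverse (norm v) - inverse (norm w) = (norm w - norm v) / (norm v * norm w)"
      using n by (simp add: field_simps)
    then show ?thesis using n by (simp add: abs_mult)
  qed
  also have "norm (v - w) / norm v + \<bar>norm w - norm v\<bar> / norm v \<le> norm (v - w) / norm v + norm (v - w) / norm v"
    using n norm_triangle_ineq3[of w v] by (intro add_left_mono divide_right_mono) (auto simp: norm_minus_commute)
  also have "\<dots> \<le> norm (v - w) / e + norm (v - w) / e"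
    using assms by (intro add_mono divide_left_mono mult_pos_pos) auto
  also have "\<dots> = 2 / e * norm (v - w)" by simp
  finally show ?thesis .
qed

text \<open>Written with the unit vector \<open>a\<close> of \<open>v\<close>, the reflection is
  \<open>x + 2 *\<^sub>R v - (2 * (x \<bullet> a)) *\<^sub>R a\<close>. The unit vector has
  Lipschitz constant \<open>2 / e\<close> and enters quadratically, so it contributes
  \<open>4 * norm x\<close> times that constant.\<close>

lemma reflect_Lipschitz:
  fixes v w x :: "'a::euclidean_space"
  assumes e: "0 < e" "e \<le> norm v" "e \<le> norm w"
  shows "norm (reflect v x - reflect w x) \<le> (2 + 8 * norm x / e) * norm (v - w)"
proof -
  define a b where "a = v /\<^sub>R norm v" and "b = w /\<^sub>R norm w"
  have n: "0 < norm v" "0 < norm w" using e by linarith+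
  have nab: "norm a = 1" "norm b = 1" using n by (auto simp: a_def b_def)
  have rv: "reflect u x = x + 2 *\<^sub>R u - (2 * (x \<bullet> (u /\<^sub>R norm u))) *\<^sub>R (u /\<^sub>R norm u)" for u
    by (simp add: reflect_def scaleR_diff_left divide_inverse power2_eq_square flip: power2_norm_eq_inner)
  have "reflect v x - reflect w x = 2 *\<^sub>R (v - w) - (2 *\<^sub>R ((x \<bullet> a) *\<^sub>R (a - b)) + 2 *\<^sub>R ((x \<bullet> (a - b)) *\<^sub>R b))"
    unfolding rv a_def[symmetric] b_def[symmetric] by (simp add: algebra_simps inner_diff_right)
  also have "norm \<dots> \<le> norm (2 *\<^sub>R (v - w)) + norm (2 *\<^sub>R ((x \<bullet> a) *\<^sub>R (a - b)) + 2 *\<^sub>R ((x \<bullet> (a - b)) *\<^sub>R b))"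
    by (rule norm_triangle_ineq4)
  also have "\<dots> \<le> norm (2 *\<^sub>R (v - w)) + (norm (2 *\<^sub>R ((x \<bullet> a) *\<^sub>R (a - b))) + norm (2 *\<^sub>R ((x \<bullet> (a - b)) *\<^sub>R b)))"
    by (intro add_left_mono norm_triangle_ineq)
  also have "\<dots> = 2 * norm (v - w) + (2 * (\<bar>x \<bullet> a\<bar> * norm (a - b)) + 2 * \<bar>x \<bullet> (a - b)\<bar>)"
    using nab by simp
  also have "\<dots> \<le> 2 * norm (v - w) + (2 * (norm x * norm (a - b)) + 2 * (norm x * norm (a - b)))"
    using Cauchy_Schwarz_ineq2[of x a] Cauchy_Schwarz_ineq2[of x "a - b"] nab
    by (intro add_mono mult_left_mono mult_right_mono) auto
  also have "\<dots> = 2 * norm (v - w) + 4 * norm x * norm (a - b)" by simp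
  also have "\<dots> \<le> 2 * norm (v - w) + 4 * norm x * (2 / e * norm (v - w))"
    unfolding a_def b_def using sgn_Lipschitz[OF e] by (intro add_left_mono mult_left_mono) auto
  also have "\<dots> = (2 + 8 * norm x / e) * norm (v - w)" by (simp add: distrib_right)
  finally show ?thesis .
qed

text \<open>The scaled vector is the foot of the perpendicular from the origin to the bisecting
  hyperplane of \<open>x\<close> and \<open>y\<close>. Equal norms would put the origin on that
  hyperplane and make the vector 0.\<close>

lemma reflect_between:
  fixes x y :: "'a::euclidean_space"
  assumes "norm x \<noteq> norm y"
  shows "reflect ((((norm y)\<^sup>2 - (norm x)\<^sup>2) / (2 * (norm (y - x))\<^sup>2)) *\<^sub>R (y - x)) x = y"
proof -
  define w where "w = y - x"
  define W where "W = w \<bullet> w"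
  define N where "N = (norm y)\<^sup>2 - (norm x)\<^sup>2"
  have ne: "w \<noteq> 0" using assms by (auto simp: w_def)
  have W: "0 < W" using ne by (simp add: W_def)
  have N: "N \<noteq> 0" using assms by (simp add: N_def)
  have Nw: "N = 2 * (x \<bullet> w) + W"
    unfolding N_def W_def w_def power2_norm_eq_inner by (simp add: inner_diff_left inner_diff_right inner_commute)
  define t where "t = N / (2 * W)"
  have t: "t \<noteq> 0" using N W by (simp add: t_def)
  have "reflect (t *\<^sub>R w) x = x + ((2 - 2 * (t * (x \<bullet> w)) / (t * (t * W))) * t) *\<^sub>R w"
    by (simp add: reflect_def W_def)
  also have "(2 - 2 * (t * (x \<bullet> w)) / (t * (t * W))) * t = 2 * t - 2 * (x \<bullet> w) / W"
    using t W by (simp add: field_simps)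
  also have "\<dots> = (N - 2 * (x \<bullet> w)) / W" using W by (simp add: t_def field_simps)
  also have "\<dots> = 1" using W by (simp add: Nw)
  finally show ?thesis by (simp add: t_def N_def W_def w_def power2_norm_eq_inner)
qed

text \<open>For fixed \<open>x\<close>, each \<open>y\<close> in \<open>S\<close> is the reflection
  of \<open>x\<close> by the vector of \<open>reflect_between\<close>, whose norm is estimated from
  both sides; then the volume bound for Lipschitz images applies. The factor 32 is the 8 of
  \<open>reflect_Lipschitz\<close> divided by the 1/4 of the inner radius.\<close>

lemma reflections_cover:
  fixes x :: "'a::euclidean_space"
  assumes \<eta>: "0 < \<eta>" and x: "norm x < r - \<eta>" and rR: "r \<le> R"
    and S [measurable]: "S \<in> sets borel" and Ss: "S \<subseteq> ball 0 R - ball 0 r"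
  shows "emeasure lborel S \<le> ennreal ((2 + 32 * R / \<eta>) ^ DIM('a)) *
    emeasure lborel {v. \<eta> / 4 < norm v \<and> norm v < R \<and> reflect v x \<in> S}"
proof (rule emeasure_Lipschitz_image[where f="\<lambda>v. reflect v x" and U="{v. \<eta> / 4 < norm v \<and> norm v < R}"])
  show "open {v::'a. \<eta> / 4 < norm v \<and> norm v < R}"
    by (intro open_Collect_conj open_Collect_less continuous_intros)
  have [measurable]: "(\<lambda>v. reflect v x) \<in> borel_measurable borel" unfolding reflect_def[abs_def] by measurable
  show "{v. \<eta> / 4 < norm v \<and> norm v < R \<and> reflect v x \<in> S} \<in> sets borel" by measurable
  show "S \<subseteq> (\<lambda>v. reflect v x) ` {v. \<eta> / 4 < norm v \<and> norm v < R \<and> reflect v x \<in> S}"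
  proof
    fix y assume y: "y \<in> S"
    have ny: "r \<le> norm y" "norm y < R" using y Ss by (auto simp: subset_iff)
    have ne: "norm x \<noteq> norm y" using x ny \<eta> by auto
    define v where "v = (((norm y)\<^sup>2 - (norm x)\<^sup>2) / (2 * (norm (y - x))\<^sup>2)) *\<^sub>R (y - x)"
    have rv: "reflect v x = y" unfolding v_def by (rule reflect_between[OF ne])
    define d where "d = norm (y - x)"
    have d: "norm y - norm x \<le> d" "d \<le> norm y + norm x" "0 < d"
      using ne norm_triangle_ineq2[of y x] norm_triangle_ineq4[of y x] by (auto simp: d_def)
    have nv: "norm v = (norm y - norm x) * (norm y + norm x) / (2 * d)"
    proof -
      have "(norm y)\<^sup>2 - (norm x)\<^sup>2 = (norm y - norm x) * (norm y + norm x)" by (simp add: power2_eq_square algebra_simps)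
      moreover have "0 \<le> (norm y - norm x) * (norm y + norm x)" using x ny \<eta> by (intro mult_nonneg_nonneg) auto
      ultimately show ?thesis using d by (simp add: v_def d_def[symmetric] power2_eq_square)
    qed
    \<comment> \<open>Since \<open>d\<close> is at most \<open>norm y + norm x\<close>, the norm of
      \<open>v\<close> is at least half of \<open>norm y - norm x\<close>, which exceeds
      \<open>\<eta>\<close>.\<close>
    have "\<eta> / 4 < norm v"
    proof -
      have "\<eta> * d \<le> (norm y - norm x) * (norm y + norm x)"
        using x ny \<eta> d by (intro mult_mono) auto
      then have "\<eta> / 2 \<le> norm v" unfolding nv using d by (simp add: field_simps)
      then show ?thesis using \<eta> by simp
    qed
    moreover have "norm v < R"
    proof -
      have "(norm y - norm x) * (norm y + norm x) \<le> d * (norm y + norm x)" using d by (intro mult_right_mono) auto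
      then have "norm v \<le> (norm y + norm x) / 2" unfolding nv using d by (simp add: field_simps)
      also have "\<dots> < R" using ny x rR \<eta> by simp
      finally show ?thesis .
    qed
    ultimately show "y \<in> (\<lambda>v. reflect v x) ` {v. \<eta> / 4 < norm v \<and> norm v < R \<and> reflect v x \<in> S}"
      using rv y by (auto simp: image_iff intro!: exI[of _ v])
  qed
  have R: "0 < R" using x rR \<eta> norm_ge_zero[of x] by linarith
  show "0 < 2 + 32 * R / \<eta>" using R \<eta> by (simp add: add_pos_pos)
  fix v w :: 'a assume vw: "v \<in> {v. \<eta> / 4 < norm v \<and> norm v < R}" "w \<in> {v. \<eta> / 4 < norm v \<and> norm v < R}"
  have "norm (reflect v x - reflect w x) \<le> (2 + 8 * norm x / (\<eta> / 4)) * norm (v - w)"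
    using vw \<eta> by (intro reflect_Lipschitz) auto
  also have "\<dots> \<le> (2 + 32 * R / \<eta>) * norm (v - w)"
    using x rR \<eta> by (intro mult_right_mono add_left_mono) (auto simp: field_simps)
  finally show "norm (reflect v x - reflect w x) \<le> (2 + 32 * R / \<eta>) * norm (v - w)" .
qed (use S in auto)

lemma ball_shrink:
  fixes z :: "'a::euclidean_space"
  assumes r: "0 < r" and d: "0 < d"
  obtains \<eta> where "0 < \<eta>" "\<eta> \<le> r" "measure lborel (ball (0::'a) r) - d < measure lborel (ball (0::'a) (r - \<eta>))"
proof -
  let ?c = "measure lborel (ball (0::'a) 1)"
  have eq: "measure lborel (ball (0::'a) s) = s ^ DIM('a) * ?c" if "0 \<le> s" for s
    using content_ball_conv_unit_ball[OF that, of "0::'a"] by (simp add: mult.commute)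
  have "(\<lambda>n. (r - r * inverse (real (Suc n))) ^ DIM('a) * ?c) \<longlonglongrightarrow> (r - r * 0) ^ DIM('a) * ?c"
    by (intro tendsto_intros LIMSEQ_inverse_real_of_nat)
  then have "(\<lambda>n. (r - r * inverse (real (Suc n))) ^ DIM('a) * ?c) \<longlonglongrightarrow> measure lborel (ball (0::'a) r)"
    using eq[of r] r by simp
  from order_tendstoD(1)[OF this, of "measure lborel (ball (0::'a) r) - d"] d
  obtain n where n: "measure lborel (ball (0::'a) r) - d < (r - r * inverse (real (Suc n))) ^ DIM('a) * ?c"
    by (auto simp: eventually_sequentially)
  have le: "r * inverse (real (Suc n)) \<le> r" using r by (simp add: field_simps)
  show ?thesis
    by (rule that[of "r * inverse (real (Suc n))"]) (use r n le eq[of "r - r * inverse (real (Suc n))"] in auto)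
qed

text \<open>The gain averaged over \<open>v\<close> is bounded below: for fixed \<open>x\<close> the map taking \<open>v\<close> to the reflection
  of \<open>x\<close> is Lipschitz and covers \<open>A - ball 0 r\<close>. Staying at distance \<open>\<eta>\<close> from the sphere keeps \<open>v\<close>
  away from 0, where that map is not Lipschitz.\<close>

lemma uniform_gain:
  fixes r R \<delta> :: real
  assumes r: "0 < r" and rR: "r \<le> R" and \<delta>: "0 < \<delta>"
  obtains g where "0 < g" "\<And>A :: 'a::euclidean_space set. A \<in> sets borel \<Longrightarrow> A \<subseteq> ball 0 R \<Longrightarrow>
      emeasure lborel A \<le> emeasure lborel (ball (0::'a) r) \<Longrightarrow> \<delta> \<le> measure lborel (A - ball 0 r) \<Longrightarrow>
      \<exists>v. v \<noteq> 0 \<and> ennreal g < emeasure lborel {x. x \<in> ball 0 r - A \<and> reflect v x \<in> A - ball 0 r}"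
proof -
  define B where "B = ball (0::'a) r"
  have B [measurable]: "B \<in> sets borel" by (simp add: B_def)
  have Bf: "emeasure lborel B < \<infinity>" unfolding B_def by (rule emeasure_lborel_ball_finite)
  obtain \<eta> where \<eta>: "0 < \<eta>" "\<eta> \<le> r" "measure lborel B - \<delta> / 2 < measure lborel (ball (0::'a) (r - \<eta>))"
    unfolding B_def by (rule ball_shrink[OF r, of "\<delta> / 2"]) (use \<delta> in auto)
  define B' where "B' = ball (0::'a) (r - \<eta>)"
  have B' [measurable]: "B' \<in> sets borel" and B'B: "B' \<subseteq> B" using \<eta> by (auto simp: B'_def B_def)
  define L where "L = (2 + 32 * R / \<eta>) ^ DIM('a)"
  have L: "0 < L" using r rR \<eta> by (simp add: L_def add_pos_pos)
  define V where "V = {v::'a. \<eta> / 4 < norm v \<and> norm v < R}"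
  have V [measurable]: "V \<in> sets borel" unfolding V_def by measurable
  have Vf: "emeasure lborel V < \<infinity>"
    by (rule emeasure_bounded_finite) (auto simp: V_def intro: boundedI[of _ R])
  define W where "W = measure lborel V"
  have W: "0 \<le> W" "emeasure lborel V = ennreal W"
    using Vf by (auto simp: W_def emeasure_eq_ennreal_measure less_top)
  \<comment> \<open>The double integral of \<open>F\<close> below is at least
    \<open>\<delta>\<^sup>2 / (2 * L)\<close>. If no gain exceeded \<open>g\<close>, it would be at
    most \<open>g * W\<close>, hence at most \<open>\<delta>\<^sup>2 / (4 * L)\<close>.\<close>
  define g where "g = \<delta>\<^sup>2 / (4 * L * (W + 1))"
  have g: "0 < g" using \<delta> L W by (simp add: g_def add_nonneg_pos)
  show ?thesis
  proof (rule that[OF g], rule ccontr)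
    fix A :: "'a set"
    assume A [measurable]: "A \<in> sets borel" and AR: "A \<subseteq> ball 0 R"
      and AB: "emeasure lborel A \<le> emeasure lborel (ball (0::'a) r)" and Ad: "\<delta> \<le> measure lborel (A - ball 0 r)"
      and neg: "\<nexists>v. v \<noteq> 0 \<and> ennreal g < emeasure lborel {x. x \<in> ball 0 r - A \<and> reflect v x \<in> A - ball 0 r}"
    have Af: "emeasure lborel A < \<infinity>" using AB Bf by (simp add: B_def)
    have fm: "X \<in> fmeasurable lborel" if "X \<in> sets borel" "X \<subseteq> A \<union> B" for X
    proof (rule fmeasurableI)
      have "emeasure lborel X \<le> emeasure lborel (A \<union> B)" using that by (intro emeasure_mono) auto
      also have "\<dots> \<le> emeasure lborel A + emeasure lborel B" by (intro emeasure_subadditive) auto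
      also have "\<dots> < \<infinity>" using Af Bf by simp
      finally show "emeasure lborel X < \<infinity>" .
    qed (use that in auto)
    have split: "measure lborel X = measure lborel (X \<inter> Y) + measure lborel (X - Y)"
      if "X \<in> sets borel" "Y \<in> sets borel" "emeasure lborel X < \<infinity>" for X Y :: "'a set"
    proof -
      have "emeasure lborel Z \<noteq> \<infinity>" if "Z \<subseteq> X" for Z
        using emeasure_mono[OF that, of lborel] \<open>emeasure lborel X < \<infinity>\<close> \<open>X \<in> sets borel\<close> by auto
      then have "measure lborel ((X \<inter> Y) \<union> (X - Y)) = measure lborel (X \<inter> Y) + measure lborel (X - Y)"
        using that by (intro measure_Union) auto
      then show ?thesis by (simp add: Int_Diff_Un)
    qed
    note m1 = split[OF A B Af]
    have m2: "measure lborel B = measure lborel (A \<inter> B) + measure lborel (B - A)"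
      using split[OF B A Bf] by (simp add: Int_commute)
    have m3: "measure lborel A \<le> measure lborel B"
      using AB Af Bf unfolding B_def[symmetric] by (simp add: emeasure_eq_ennreal_measure less_top)
    have "emeasure lborel (B - A) < \<infinity>" by (rule le_less_trans[OF emeasure_mono Bf]) auto
    then have "measure lborel (B - A) = measure lborel ((B - A) \<inter> B') + measure lborel (B - A - B')"
      by (intro split) auto
    moreover have "measure lborel (B - A - B') \<le> measure lborel (B - B')"
      by (rule measure_mono_fmeasurable[OF _ _ fm]) auto
    ultimately have m4: "measure lborel (B - A) \<le> measure lborel ((B - A) \<inter> B') + measure lborel (B - B')"
      by linarith
    have "B \<inter> B' = B'" using B'B by auto
    then have m5: "measure lborel (B - B') = measure lborel B - measure lborel B'"
      using split[OF B B' Bf] by simp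
    \<comment> \<open>As \<open>A\<close> has no more volume than \<open>B\<close>, the set
      \<open>B - A\<close> is at least as large as \<open>A - B\<close>, hence at least
      \<open>\<delta>\<close>; the shell \<open>B - B'\<close> takes away less than half of
      that.\<close>
    have half: "\<delta> / 2 \<le> measure lborel ((B - A) \<inter> B')"
      using m1 m2 m3 m4 m5 \<eta>(3) Ad by (simp add: B_def[symmetric] B'_def[symmetric])
    have [measurable]: "(\<lambda>(v, x). reflect v x) \<in> borel_measurable (borel \<Otimes>\<^sub>M borel)"
      unfolding reflect_def by measurable
    \<comment> \<open>Integrated over \<open>x\<close> for fixed \<open>v\<close> in
      \<open>V\<close>, this is the gain of the polarization by \<open>v\<close>. Integrated over
      \<open>v\<close> for fixed \<open>x\<close> in \<open>(B - A) \<inter> B'\<close>, it is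
      bounded below by \<open>reflections_cover\<close>. Tonelli compares the two.\<close>
    define F where "F v x = (indicator V v * indicator (B - A) x * indicator (A - B) (reflect v x) :: ennreal)" for v x
    have Fm [measurable]: "(\<lambda>(v, x). F v x) \<in> borel_measurable (lborel \<Otimes>\<^sub>M lborel)"
      unfolding F_def by measurable
    have "(\<integral>\<^sup>+ v. \<integral>\<^sup>+ x. F v x \<partial>lborel \<partial>lborel) \<le> (\<integral>\<^sup>+ v. ennreal g * indicator V v \<partial>lborel)"
    proof (rule nn_integral_mono)
      fix v :: 'a
      have "(\<integral>\<^sup>+ x. F v x \<partial>lborel) = (\<integral>\<^sup>+ x. indicator V v * indicator {x. x \<in> B - A \<and> reflect v x \<in> A - B} x \<partial>lborel)"
        by (intro nn_integral_cong) (auto simp: F_def indicator_def)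
      also have "\<dots> = indicator V v * emeasure lborel {x. x \<in> B - A \<and> reflect v x \<in> A - B}"
        by (subst nn_integral_cmult_indicator) auto
      also have "\<dots> \<le> ennreal g * indicator V v"
      proof (cases "v \<in> V")
        case True
        then have "v \<noteq> 0" using \<eta> by (auto simp: V_def)
        then show ?thesis using neg True by (auto simp: B_def not_less)
      qed simp
      finally show "(\<integral>\<^sup>+ x. F v x \<partial>lborel) \<le> ennreal g * indicator V v" .
    qed
    also have "\<dots> = ennreal g * ennreal W" by (simp add: nn_integral_cmult W)
    finally have up: "(\<integral>\<^sup>+ v. \<integral>\<^sup>+ x. F v x \<partial>lborel \<partial>lborel) \<le> ennreal g * ennreal W" .
    have "ennreal (measure lborel ((B - A) \<inter> B')) * ennreal (measure lborel (A - B)) =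
        (\<integral>\<^sup>+ x. indicator ((B - A) \<inter> B') x * emeasure lborel (A - B) \<partial>lborel)"
    proof -
      have "emeasure lborel ((B - A) \<inter> B') = ennreal (measure lborel ((B - A) \<inter> B'))"
        "emeasure lborel (A - B) = ennreal (measure lborel (A - B))"
        by (intro emeasure_eq_measure2 fm; auto)+
      then show ?thesis by (simp add: nn_integral_multc)
    qed
    also have "\<dots> \<le> (\<integral>\<^sup>+ x. ennreal L * (\<integral>\<^sup>+ v. F v x \<partial>lborel) \<partial>lborel)"
    proof (rule nn_integral_mono)
      fix x
      show "indicator ((B - A) \<inter> B') x * emeasure lborel (A - B) \<le> ennreal L * (\<integral>\<^sup>+ v. F v x \<partial>lborel)"
      proof (cases "x \<in> (B - A) \<inter> B'")
        case True
        then have nx: "norm x < r - \<eta>" by (simp add: B'_def)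
        have "emeasure lborel (A - B) \<le> ennreal L * emeasure lborel {v. \<eta> / 4 < norm v \<and> norm v < R \<and> reflect v x \<in> A - B}"
          unfolding L_def using AR by (intro reflections_cover[OF \<eta>(1) nx rR]) (auto simp: B_def)
        also have "emeasure lborel {v. \<eta> / 4 < norm v \<and> norm v < R \<and> reflect v x \<in> A - B} =
            (\<integral>\<^sup>+ v. indicator {v. \<eta> / 4 < norm v \<and> norm v < R \<and> reflect v x \<in> A - B} v \<partial>lborel)"
        proof -
          have [measurable]: "(\<lambda>v. reflect v x) \<in> borel_measurable borel" unfolding reflect_def[abs_def] by measurable
          show ?thesis by (rule nn_integral_indicator[symmetric]) measurable
        qed
        also have "\<dots> = (\<integral>\<^sup>+ v. F v x \<partial>lborel)"
          using True by (intro nn_integral_cong) (auto simp: F_def V_def indicator_def)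
        finally show ?thesis using True by simp
      qed simp
    qed
    also have "\<dots> = ennreal L * (\<integral>\<^sup>+ x. \<integral>\<^sup>+ v. F v x \<partial>lborel \<partial>lborel)"
      by (rule nn_integral_cmult) measurable
    also have "(\<integral>\<^sup>+ x. \<integral>\<^sup>+ v. F v x \<partial>lborel \<partial>lborel) = (\<integral>\<^sup>+ v. \<integral>\<^sup>+ x. F v x \<partial>lborel \<partial>lborel)"
      by (rule lborel_pair.Fubini'[OF Fm])
    also have "ennreal L * \<dots> \<le> ennreal L * (ennreal g * ennreal W)" by (intro mult_left_mono up) auto
    also have "\<dots> = ennreal (L * (g * W))" using L g W by (simp add: ennreal_mult)
    finally have "measure lborel ((B - A) \<inter> B') * measure lborel (A - B) \<le> L * (g * W)"
      using L g W by (simp add: ennreal_le_iff flip: ennreal_mult)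
    moreover have "\<delta> / 2 * \<delta> \<le> measure lborel ((B - A) \<inter> B') * measure lborel (A - B)"
      using half Ad \<delta> by (intro mult_mono) (auto simp: B_def)
    moreover have "L * (g * W) < \<delta> / 2 * \<delta>"
    proof -
      have "L * (g * W) = \<delta>\<^sup>2 / 4 * (W / (W + 1))" using L by (simp add: g_def)
      also have "\<dots> \<le> \<delta>\<^sup>2 / 4 * 1" using W by (intro mult_left_mono) auto
      also have "\<dots> < \<delta> / 2 * \<delta>" using \<delta> by (simp add: power2_eq_square)
      finally show ?thesis .
    qed
    ultimately show False by linarith
  qed
qed

text \<open>The volume outside the ball drops by at least \<open>g\<close> with each polarization
  while it exceeds \<open>\<delta>\<close>, so it reaches \<open>\<delta>\<close> after finitely
  many; \<open>step\<close> then carries \<open>P\<close> back to \<open>A\<close>.\<close>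

lemma polarization_induct:
  fixes P :: "'a::euclidean_space set \<Rightarrow> bool"
  assumes r: "0 < r" and \<delta>: "0 < \<delta>"
    and step: "\<And>A v. v \<noteq> 0 \<Longrightarrow> P (polset v A) \<Longrightarrow> P A"
    and base: "\<And>A. A \<in> sets borel \<Longrightarrow> emeasure lborel (A - ball 0 r) \<le> ennreal \<delta> \<Longrightarrow> P A"
    and A: "A \<in> sets borel" "bounded A" "emeasure lborel A \<le> emeasure lborel (ball (0::'a) r)"
  shows "P A"
proof -
  obtain R0 where R0: "A \<subseteq> ball 0 R0" using bounded_subset_ballD[OF A(2), of 0] by auto
  define R where "R = max r R0"
  have AR: "A \<subseteq> ball 0 R" using R0 by (auto simp: R_def)
  have rR: "r \<le> R" by (simp add: R_def)
  obtain g where g: "0 < g" "\<And>A :: 'a set. A \<in> sets borel \<Longrightarrow> A \<subseteq> ball 0 R \<Longrightarrow>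
      emeasure lborel A \<le> emeasure lborel (ball (0::'a) r) \<Longrightarrow> \<delta> \<le> measure lborel (A - ball 0 r) \<Longrightarrow>
      \<exists>v. v \<noteq> 0 \<and> ennreal g < emeasure lborel {x. x \<in> ball 0 r - A \<and> reflect v x \<in> A - ball 0 r}"
    by (rule uniform_gain[OF r rR \<delta>]) blast
  \<comment> \<open>\<open>n\<close> limits the number of polarizations still to come. All polarized
    sets stay in the same ball of radius \<open>R\<close>, so one \<open>g\<close> serves every
    step.\<close>
  have "P A" if "A \<in> sets borel" "A \<subseteq> ball 0 R" "emeasure lborel A \<le> emeasure lborel (ball (0::'a) r)"
      "measure lborel (A - ball 0 r) < real n * g" for n A
    using that
  proof (induction n arbitrary: A)
    case 0
    then show ?case by (simp add: not_less[symmetric])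
  next
    case (Suc n)
    note [measurable] = Suc.prems(1)
    have fin: "emeasure lborel A < \<infinity>" using Suc.prems(3) emeasure_lborel_ball_finite by (rule le_less_trans)
    have fin': "emeasure lborel (A - ball 0 r) < \<infinity>"
      by (rule le_less_trans[OF emeasure_mono fin]) auto
    show ?case
    proof (cases "measure lborel (A - ball 0 r) \<le> \<delta>")
      case True
      then have "emeasure lborel (A - ball 0 r) \<le> ennreal \<delta>"
        using fin' by (simp add: emeasure_eq_ennreal_measure less_top ennreal_leI)
      then show ?thesis using Suc.prems(1) by (rule base[rotated])
    next
      case False
      then obtain v where v: "v \<noteq> 0" and gv: "ennreal g < emeasure lborel {x. x \<in> ball 0 r - A \<and> reflect v x \<in> A - ball 0 r}"
        using g(2)[OF Suc.prems(1-3)] by auto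
      have pm: "polset v A \<in> sets borel" by measurable
      have "emeasure lborel (polset v A - ball 0 r) + ennreal g \<le> emeasure lborel (A - ball 0 r)"
        by (rule order_trans[OF add_left_mono[OF less_imp_le[OF gv]] polset_gain[OF v]]) auto
      moreover have "emeasure lborel (polset v A - ball 0 r) < \<infinity>"
        by (rule le_less_trans[OF emeasure_mono[of _ "polset v A"]]) (use pm fin in \<open>auto simp: emeasure_polset[OF v]\<close>)
      ultimately have "ennreal (measure lborel (polset v A - ball 0 r) + g) \<le> ennreal (measure lborel (A - ball 0 r))"
        using fin' g(1) by (simp add: emeasure_eq_ennreal_measure less_top)
      then have "measure lborel (polset v A - ball 0 r) + g \<le> measure lborel (A - ball 0 r)"
        by (subst (asm) ennreal_le_iff) auto
      then have "measure lborel (polset v A - ball 0 r) < real n * g"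
        using Suc.prems(4) by (simp add: distrib_right)
      then have "P (polset v A)"
        using Suc.prems v by (intro Suc.IH pm polset_subset_ball) (auto simp: emeasure_polset)
      then show ?thesis by (rule step[OF v])
    qed
  qed
  moreover obtain n where "measure lborel (A - ball 0 r) / g < real n" using reals_Archimedean2 by blast
  then have "measure lborel (A - ball 0 r) < real n * g" using g(1) by (simp add: field_simps)
  ultimately show ?thesis using A AR by blast
qed

section \<open>Comparison of a set with the ball\<close>

context riesz_kernel
begin

text \<open>Bounded sets come first, since the gain per polarization depends on \<open>R\<close>;
  there the loss \<open>e\<close> is sent to 0 with the set fixed. A general \<open>A\<close> is
  exhausted by its intersections with balls, whose volume may be smaller, hence the inequality of
  volumes in the hypothesis.\<close>

lemma qbound_from_ball:
  assumes q: "qbound (ball 0 r) m" and m: "0 < m" and r: "0 < r"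
    and A [measurable]: "A \<in> sets borel" and le: "emeasure lborel A \<le> emeasure lborel (ball (0::'a) r)"
  shows "qbound A m"
proof -
  have bounded_case: "qbound A m" if A: "A \<in> sets borel" "bounded A" "emeasure lborel A \<le> emeasure lborel (ball (0::'a) r)" for A
  proof -
    have eps: "qbound A (m + e)" if e: "0 < e" for e
    proof -
      obtain \<delta> where \<delta>: "0 < \<delta>" "\<And>D. D \<in> sets borel \<Longrightarrow> emeasure lborel (D - ball 0 r) \<le> ennreal \<delta> \<Longrightarrow> qbound D (m + e)"
        by (rule qbound_perturb[OF q m _ emeasure_lborel_ball_finite e]) auto
      show ?thesis
        by (rule polarization_induct[where P="\<lambda>A. qbound A (m + e)", OF r \<delta>(1) _ \<delta>(2) A]) (rule qbound_polset)
    qed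
    show ?thesis unfolding qbound_def
    proof (intro allI impI)
      fix f :: "'a \<Rightarrow> real" assume f: "f \<in> borel_measurable borel" "\<forall>x. 0 \<le> f x" "\<forall>x. x \<notin> A \<longrightarrow> f x = 0"
      have le: "form f \<le> ennreal (m + e) * norm_sq f" if "0 < e" for e
        using f by (intro qboundD[OF eps[OF that]]) auto
      show "form f \<le> ennreal m * norm_sq f"
      proof (cases "norm_sq f = \<infinity>")
        case True
        then show ?thesis using m by (simp add: ennreal_mult_top)
      next
        case False
        then obtain s where s: "0 \<le> s" "norm_sq f = ennreal s" by (cases "norm_sq f") auto
        show ?thesis
        proof (rule ennreal_le_epsilon)
          fix e :: real assume e: "0 < e"
          \<comment> \<open>Division by \<open>s + 1\<close> keeps the loss below \<open>e\<close>
            after multiplication by the square integral \<open>s\<close>.\<close>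
          have "form f \<le> ennreal (m + e / (s + 1)) * ennreal s" using le[of "e / (s + 1)"] e s by (simp add: add_nonneg_pos)
          also have "\<dots> = ennreal (m * s + e * (s / (s + 1)))"
            using m e s by (subst ennreal_mult[symmetric]) (auto simp: field_simps)
          also have "\<dots> \<le> ennreal (m * s + e * 1)"
            using e s by (intro ennreal_leI add_left_mono mult_left_mono) auto
          also have "\<dots> = ennreal m * norm_sq f + ennreal e"
            using m e s by (simp add: ennreal_plus ennreal_mult)
          finally show "form f \<le> ennreal m * norm_sq f + ennreal e" .
        qed
      qed
    qed
  qed
  show ?thesis unfolding qbound_def
  proof (intro allI impI)
    fix f :: "'a \<Rightarrow> real" assume f [measurable]: "f \<in> borel_measurable borel" and f0: "\<forall>x. 0 \<le> f x" "\<forall>x. x \<notin> A \<longrightarrow> f x = 0"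
    define g where "g n x = f x * indicator (cball 0 (real n)) x" for n :: nat and x
    have g [measurable]: "g n \<in> borel_measurable borel" for n
      unfolding g_def[abs_def] by (intro borel_measurable_times f borel_measurable_indicator) auto
    have g0: "0 \<le> g n x" for n x using f0 by (simp add: g_def)
    have "form f \<le> (SUP n. form (g n))"
    proof (rule form_le_SUP[OF g g0])
      show "g i x \<le> g j x" if "i \<le> j" for i j x using that f0 by (auto simp: g_def indicator_def)
      show "\<exists>n0. \<forall>n\<ge>n0. g n x = f x" for x
      proof -
        obtain n0 where "norm x \<le> real n0" using real_arch_simple by blast
        then show ?thesis by (intro exI[of _ n0]) (auto simp: g_def)
      qed
    qed
    also have "\<dots> \<le> ennreal m * norm_sq f"
    proof (rule SUP_least)
      fix n :: nat
      have "emeasure lborel (A \<inter> cball 0 (real n)) \<le> emeasure lborel A" by (intro emeasure_mono) auto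
      then have "qbound (A \<inter> cball 0 (real n)) m"
        using le by (intro bounded_case) (auto intro: bounded_subset[OF bounded_cball])
      then have "form (g n) \<le> ennreal m * norm_sq (g n)"
        by (rule qboundD) (use f0 in \<open>auto simp: g_def indicator_def\<close>)
      also have "\<dots> \<le> ennreal m * norm_sq f"
        unfolding norm_sq_def using f0 by (intro mult_left_mono nn_integral_mono ennreal_leI) (auto simp: g_def indicator_def)
      finally show "form (g n) \<le> ennreal m * norm_sq f" .
    qed
    finally show "form f \<le> ennreal m * norm_sq f" .
  qed
qed

end

section \<open>The largest eigenvalue\<close>

locale riesz_operator = riesz_kernel "riesz_const \<alpha> (real CARD('n))" "real CARD('n) - \<alpha>" k
  for \<alpha> and k :: "real ^ 'n \<Rightarrow> real"
begin

lemma riesz_potential_eq: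
  "riesz_potential \<alpha> \<Omega> f x = (LINT y | lebesgue_on \<Omega>. complex_of_real (k (x - y)) * f y)"
  by (simp add: riesz_potential_def k_eq)

text \<open>Taking moduli in the eigenvalue equation shows that, for positive \<open>l\<close>,
  \<open>l * F x\<close> is at most the potential of \<open>F\<close>, because the kernel is
  nonnegative. Integration against \<open>F\<close> compares \<open>l\<close> times the square
  integral with the energy, and the square integral is positive and finite, so it can be divided
  out.\<close>

lemma eigenvalue_le:
  assumes \<Omega>: "\<Omega> \<in> sets lebesgue" and B [measurable]: "B \<in> sets borel" and B\<Omega>: "B \<subseteq> \<Omega>"
    and null: "AE x in lebesgue. x \<in> \<Omega> \<longrightarrow> x \<in> B"
    and q: "qbound B m" and m: "0 < m" and ev: "riesz_eigenvalue \<alpha> \<Omega> (complex_of_real l)"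
  shows "l \<le> m"
proof (cases "l \<le> 0")
  case True
  then show ?thesis using m by simp
next
  case False
  obtain f where f: "f \<in> L2_on \<Omega>" and f0: "\<not> (AE x in lebesgue_on \<Omega>. f x = 0)"
      and fe: "AE x in lebesgue_on \<Omega>. riesz_potential \<alpha> \<Omega> f x = complex_of_real l * f x"
    using ev by (auto simp: riesz_eigenvalue_def)
  have fm [measurable]: "f \<in> borel_measurable (lebesgue_on \<Omega>)" and fi: "integrable (lebesgue_on \<Omega>) (\<lambda>x. (norm (f x))\<^sup>2)"
    using f by (auto simp: L2_on_def)
  define F0 where "F0 x = (if x \<in> \<Omega> then norm (f x) else 0)" for x
  have F0m: "F0 \<in> borel_measurable lebesgue"
    unfolding F0_def[abs_def] borel_measurable_if[OF \<Omega>] by measurable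
  then obtain F1 where F1 [measurable]: "F1 \<in> borel_measurable lborel" and F01: "AE x in lborel. F0 x = F1 x"
    using completion_ex_borel_measurable_real by blast
  \<comment> \<open>A Borel version of the modulus of \<open>f\<close>, cut to \<open>B\<close>; it
    differs from \<open>F0\<close> only on a null set.\<close>
  define F where "F x = indicator B x * \<bar>F1 x\<bar>" for x
  have F [measurable]: "F \<in> borel_measurable borel" unfolding F_def[abs_def] using F1 by measurable
  have Fn: "0 \<le> F x" for x by (simp add: F_def)
  have nullb: "AE x in lborel. x \<in> \<Omega> \<longrightarrow> x \<in> B" using null by (simp add: AE_completion_iff)
  have FF0: "AE x in lborel. F x = F0 x" using F01 nullb
  proof eventually_elim
    case (elim x)
    then show ?case using B\<Omega> by (auto simp: F_def elim(1)[symmetric] F0_def indicator_def)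
  qed
  have FF0': "AE x in lebesgue. F0 x = F x"
    using FF0 by (simp add: AE_completion_iff eq_commute)
  have nn: "(\<integral>\<^sup>+ x. ennreal (u x * v (norm (f x))) \<partial>lebesgue_on \<Omega>) = (\<integral>\<^sup>+ x. ennreal (u x * v (F x)) \<partial>lborel)"
    if [measurable]: "u \<in> borel_measurable borel" "v \<in> borel_measurable borel" and "v 0 = 0" for u v :: "_ \<Rightarrow> real"
  proof -
    have "(\<integral>\<^sup>+ x. ennreal (u x * v (norm (f x))) \<partial>lebesgue_on \<Omega>) = (\<integral>\<^sup>+ x. ennreal (u x * v (norm (f x))) * indicator \<Omega> x \<partial>lebesgue)"
      using \<Omega> by (intro nn_integral_restrict_space) auto
    also have "\<dots> = (\<integral>\<^sup>+ x. ennreal (u x * v (F x)) \<partial>lebesgue)"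
      using FF0' that(3) by (intro nn_integral_cong_AE) (auto elim!: eventually_mono simp: F0_def indicator_def)
    also have "\<dots> = (\<integral>\<^sup>+ x. ennreal (u x * v (F x)) \<partial>lborel)" by (rule nn_integral_completion)
    finally show ?thesis .
  qed
  have sq: "norm_sq F = (\<integral>\<^sup>+ x. ennreal ((norm (f x))\<^sup>2) \<partial>lebesgue_on \<Omega>)"
    using nn[of "\<lambda>_. 1" "\<lambda>t. t\<^sup>2"] by (simp add: norm_sq_def)
  have "norm_sq F < \<infinity>" unfolding sq using integrableD(2)[OF fi] by (simp add: less_top)
  moreover have "norm_sq F \<noteq> 0"
  proof
    assume "norm_sq F = 0"
    then have "AE x in lebesgue_on \<Omega>. ennreal ((norm (f x))\<^sup>2) = 0"
      unfolding sq by (subst (asm) nn_integral_0_iff_AE) auto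
    then show False using f0 by auto
  qed
  moreover have "ennreal l * norm_sq F \<le> ennreal m * norm_sq F"
  proof -
    have pot: "AE x in lborel. ennreal (l * F x) \<le> (\<integral>\<^sup>+ y. ennreal (k (x - y) * F y) \<partial>lborel)"
    proof -
      have "AE x in lborel. x \<in> \<Omega> \<longrightarrow> riesz_potential \<alpha> \<Omega> f x = complex_of_real l * f x"
        using fe \<Omega> by (simp add: AE_restrict_space_iff AE_completion_iff)
      then show ?thesis using FF0
      proof eventually_elim
        case (elim x)
        show ?case
        proof (cases "x \<in> \<Omega>")
          case True
          let ?g = "\<lambda>y. complex_of_real (k (x - y)) * f y"
          have "ennreal (l * F x) = ennreal (norm (riesz_potential \<alpha> \<Omega> f x))"
            using elim True False by (simp add: F0_def norm_mult)
          also have "\<dots> \<le> (\<integral>\<^sup>+ y. ennreal (norm (?g y)) \<partial>lebesgue_on \<Omega>)"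
          \<comment> \<open>Where the integral diverges, its Bochner value is 0 and the bound is
            immediate.\<close>
          proof (cases "integrable (lebesgue_on \<Omega>) ?g")
            case True
            then show ?thesis unfolding riesz_potential_eq by (rule integral_norm_bound_ennreal)
          next
            case False
            then show ?thesis unfolding riesz_potential_eq by (simp add: not_integrable_integral_eq)
          qed
          also have "\<dots> = (\<integral>\<^sup>+ y. ennreal (k (x - y) * norm (f y)) \<partial>lebesgue_on \<Omega>)"
            by (simp add: norm_mult)
          also have "\<dots> = (\<integral>\<^sup>+ y. ennreal (k (x - y) * F y) \<partial>lborel)"
            by (rule nn[of "\<lambda>y. k (x - y)" "\<lambda>t. t"]) auto
          finally show ?thesis .
        next
          case False
          then show ?thesis using elim by (simp add: F0_def)
        qed
      qed
    qed
    have "ennreal l * norm_sq F = (\<integral>\<^sup>+ x. ennreal (F x) * ennreal (l * F x) \<partial>lborel)"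
      unfolding norm_sq_def using False Fn
      by (subst nn_integral_cmult[symmetric]) (auto intro!: nn_integral_cong simp: ennreal_mult power2_eq_square mult_ac)
    also have "\<dots> \<le> (\<integral>\<^sup>+ x. ennreal (F x) * (\<integral>\<^sup>+ y. ennreal (k (x - y) * F y) \<partial>lborel) \<partial>lborel)"
      using pot by (intro nn_integral_mono_AE) (auto elim!: eventually_mono intro: mult_left_mono)
    also have "\<dots> = form F"
      unfolding form_def using Fn
      by (intro nn_integral_cong) (auto simp: nn_integral_cmult[symmetric] ennreal_mult mult_ac)
    also have "\<dots> \<le> ennreal m * norm_sq F"
      using q F Fn by (rule qboundD) (simp add: F_def)
    finally show ?thesis .
  qed
  ultimately have "ennreal l \<le> ennreal m"
    by (metis ennreal_mult_le_mult_iff infinity_ennreal_def less_irrefl mult.commute)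
  then show ?thesis using m by (simp add: ennreal_le_iff)
qed

lemma eigenvalue_exists:
  assumes \<Omega>: "\<Omega> \<in> sets lebesgue" and B [measurable]: "B \<in> sets borel" and B\<Omega>: "B \<subseteq> \<Omega>"
    and null: "AE x in lebesgue. x \<in> \<Omega> \<longrightarrow> x \<in> B"
    and pos: "0 < emeasure lborel B" and fin: "emeasure lborel B < \<infinity>"
  obtains M where "0 < M" "qbound B M" "riesz_eigenvalue \<alpha> \<Omega> (complex_of_real M)"
proof -
  interpret S: riesz_set "riesz_const \<alpha> (real CARD('n))" "real CARD('n) - \<alpha>" k B
    by unfold_locales (use fin in auto)
  obtain G where G [measurable]: "G \<in> borel_measurable borel"
    and G2: "(\<integral>\<^sup>+ x. (G x)\<^sup>2 * indicator B x \<partial>lborel) < \<infinity>"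
    and G0: "\<not> (AE x in lborel. x \<in> B \<longrightarrow> G x = 0)"
    and GM: "\<And>x. ennreal S.M * G x = (\<integral>\<^sup>+ y. ennreal (k (x - y)) * G y * indicator B y \<partial>lborel)"
    using S.eigenfunction_exists[OF pos] by blast
  have Mp: "0 < S.M" by (rule S.M_pos[OF pos])
  \<comment> \<open>\<open>enn2real\<close> sends infinity to 0; by \<open>Gfin\<close> this alters
    \<open>G\<close> only on a null subset of \<open>B\<close>.\<close>
  define h where "h x = indicator B x * enn2real (G x)" for x
  have h [measurable]: "h \<in> borel_measurable borel" unfolding h_def[abs_def] by measurable
  have h0: "0 \<le> h x" for x by (simp add: h_def)
  define g where "g x = complex_of_real (h x)" for x
  have g [measurable]: "g \<in> borel_measurable borel" unfolding g_def[abs_def] by measurable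
  have Gfin: "AE x in lborel. x \<in> B \<longrightarrow> G x < \<infinity>"
  proof -
    have "AE x in lborel. (G x)\<^sup>2 * indicator B x \<noteq> \<infinity>"
      by (rule nn_integral_PInf_AE) (use G2 in auto)
    then show ?thesis
      by eventually_elim (auto simp: indicator_def power2_eq_square less_top ennreal_mult_eq_top_iff)
  qed
  have lift: "g \<in> borel_measurable (lebesgue_on \<Omega>)"
    by (intro measurable_restrict_space1 measurable_completion) (use g in simp)
  have int\<Omega>: "integral\<^sup>L (lebesgue_on \<Omega>) u = integral\<^sup>L lborel u" "integrable (lebesgue_on \<Omega>) u \<longleftrightarrow> integrable lborel u"
    if [measurable]: "u \<in> borel_measurable borel" and u0: "\<And>x. x \<notin> B \<Longrightarrow> u x = 0" for u :: "real ^ 'n \<Rightarrow> 'b::{banach, second_countable_topology}"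
  proof -
    have eq: "(\<lambda>x. indicator \<Omega> x *\<^sub>R u x) = u" using u0 B\<Omega> by (auto simp: fun_eq_iff indicator_def)
    show "integral\<^sup>L (lebesgue_on \<Omega>) u = integral\<^sup>L lborel u"
      using \<Omega> by (subst integral_restrict_space) (auto simp: eq integral_completion)
    show "integrable (lebesgue_on \<Omega>) u \<longleftrightarrow> integrable lborel u"
      using \<Omega> by (subst integrable_restrict_space) (auto simp: eq integrable_completion)
  qed
  have "g \<in> L2_on \<Omega>"
  proof -
    have "integrable lborel (\<lambda>x. (norm (g x))\<^sup>2)"
    proof (rule integrableI_nonneg)
      have "(\<integral>\<^sup>+ x. ennreal ((norm (g x))\<^sup>2) \<partial>lborel) \<le> (\<integral>\<^sup>+ x. (G x)\<^sup>2 * indicator B x \<partial>lborel)"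
      proof (rule nn_integral_mono)
        fix x
        show "ennreal ((norm (g x))\<^sup>2) \<le> (G x)\<^sup>2 * indicator B x"
        proof (cases "G x")
          case (real t)
          then show ?thesis by (auto simp: g_def h_def indicator_def ennreal_power)
        next
          case top
          then show ?thesis by (auto simp: g_def h_def)
        qed
      qed
      then show "(\<integral>\<^sup>+ x. ennreal ((norm (g x))\<^sup>2) \<partial>lborel) < \<infinity>" using G2 by (rule le_less_trans)
    qed auto
    then have "integrable (lebesgue_on \<Omega>) (\<lambda>x. (norm (g x))\<^sup>2)"
      by (subst int\<Omega>(2)) (auto simp: g_def h_def)
    then show ?thesis using lift by (auto simp: L2_on_def)
  qed
  moreover have "\<not> (AE x in lebesgue_on \<Omega>. g x = 0)"
  proof
    assume "AE x in lebesgue_on \<Omega>. g x = 0"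
    then have "AE x in lborel. x \<in> \<Omega> \<longrightarrow> g x = 0"
      using \<Omega> by (simp add: AE_restrict_space_iff AE_completion_iff)
    then have "AE x in lborel. x \<in> B \<longrightarrow> G x = 0" using Gfin
    proof eventually_elim
      case (elim x)
      then show ?case using B\<Omega> by (auto simp: g_def h_def enn2real_eq_0_iff subset_iff)
    qed
    then show False using G0 by contradiction
  qed
  moreover have "AE x in lebesgue_on \<Omega>. riesz_potential \<alpha> \<Omega> g x = complex_of_real S.M * g x"
  proof -
    \<comment> \<open>This holds at every \<open>x\<close>: where \<open>G x\<close> is infinite,
      \<open>enn2real\<close> makes the right side 0, and the divergent Bochner integral on the left
      is 0 as well.\<close>
    have pot: "riesz_potential \<alpha> \<Omega> g x = complex_of_real (S.M * enn2real (G x))" for x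
    proof -
      have "riesz_potential \<alpha> \<Omega> g x = (LINT y|lborel. complex_of_real (k (x - y)) * g y)"
        unfolding riesz_potential_eq by (rule int\<Omega>(1)) (auto simp: g_def h_def)
      also have "\<dots> = (LINT y|lborel. complex_of_real (k (x - y) * h y))" by (simp add: g_def)
      also have "\<dots> = complex_of_real (LINT y|lborel. k (x - y) * h y)" by (rule integral_complex_of_real)
      also have "(LINT y|lborel. k (x - y) * h y) = enn2real (\<integral>\<^sup>+ y. ennreal (k (x - y) * h y) \<partial>lborel)"
        by (rule integral_eq_nn_integral) (use h0 in auto)
      also have "(\<integral>\<^sup>+ y. ennreal (k (x - y) * h y) \<partial>lborel) = (\<integral>\<^sup>+ y. ennreal (k (x - y)) * G y * indicator B y \<partial>lborel)"
        using Gfin by (intro nn_integral_cong_AE)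
          (auto elim!: eventually_mono simp: h_def indicator_def ennreal_mult)
      also have "\<dots> = ennreal S.M * G x" by (rule GM[symmetric])
      also have "enn2real (ennreal S.M * G x) = S.M * enn2real (G x)"
        using Mp by (simp add: enn2real_mult)
      finally show ?thesis .
    qed
    have "AE x in lebesgue. x \<in> \<Omega> \<longrightarrow> riesz_potential \<alpha> \<Omega> g x = complex_of_real S.M * g x"
      using null by eventually_elim (auto simp: pot g_def h_def)
    then show ?thesis using \<Omega> by (simp add: AE_restrict_space_iff)
  qed
  ultimately have "riesz_eigenvalue \<alpha> \<Omega> (complex_of_real S.M)" unfolding riesz_eigenvalue_def by blast
  then show ?thesis using that Mp S.qbound_M by blast
qed

text \<open>\<open>M\<close> is an eigenvalue, and every real eigenvalue is at most every positive
  \<open>m\<close> with \<open>qbound B m\<close>, in particular at most \<open>M\<close>. So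
  \<open>GREATEST\<close> is well defined and is the least such bound, a form in which different
  sets can be compared.\<close>

lemma lambda1_characterization:
  assumes "\<Omega> \<in> sets lebesgue" "B \<in> sets borel" "B \<subseteq> \<Omega>" "AE x in lebesgue. x \<in> \<Omega> \<longrightarrow> x \<in> B"
    and "0 < emeasure lborel B" "emeasure lborel B < \<infinity>"
  shows "0 < riesz_lambda1 \<alpha> \<Omega>" and "qbound B (riesz_lambda1 \<alpha> \<Omega>)"
    and "\<And>m. qbound B m \<Longrightarrow> 0 < m \<Longrightarrow> riesz_lambda1 \<alpha> \<Omega> \<le> m"
proof -
  obtain M where M: "0 < M" "qbound B M" "riesz_eigenvalue \<alpha> \<Omega> (complex_of_real M)"
    using eigenvalue_exists[OF assms] by blast
  have le: "l \<le> m" if "riesz_eigenvalue \<alpha> \<Omega> (complex_of_real l)" "qbound B m" "0 < m" for l m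
    using eigenvalue_le[OF assms(1-4) that(2,3,1)] .
  have eq: "riesz_lambda1 \<alpha> \<Omega> = M"
    unfolding riesz_lambda1_def using M le by (intro Greatest_equality) auto
  show "0 < riesz_lambda1 \<alpha> \<Omega>" "qbound B (riesz_lambda1 \<alpha> \<Omega>)" using M eq by auto
  show "riesz_lambda1 \<alpha> \<Omega> \<le> m" if "qbound B m" "0 < m" for m using le[OF M(3) that] eq by simp
qed

end

lemma riesz_const_pos: "0 < \<alpha> \<Longrightarrow> \<alpha> < d \<Longrightarrow> 0 < riesz_const \<alpha> d"
  by (simp add: riesz_const_def Gamma_real_pos)

text \<open>A Lebesgue set is a Borel set together with a part of a Borel null set. The estimates
  above, stated for Borel sets, are applied to this Borel part.\<close>

lemma lebesgue_inner_borel: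
  fixes \<Omega> :: "'a::euclidean_space set"
  assumes "\<Omega> \<in> sets lebesgue"
  obtains B where "B \<in> sets borel" "B \<subseteq> \<Omega>" "AE x in lebesgue. x \<in> \<Omega> \<longrightarrow> x \<in> B"
    "emeasure lborel B = emeasure lebesgue \<Omega>"
proof -
  obtain B N N' where *: "\<Omega> = B \<union> N" "N \<subseteq> N'" "N' \<in> null_sets lborel" "B \<in> sets lborel"
    using sets_completionE[OF assms] by metis
  have N': "N' \<in> null_sets lebesgue" using *(3) by (rule null_sets_completionI)
  have N: "N \<in> null_sets lebesgue" using *(2,3) by (meson null_sets_completion_subset null_sets_completionI completion.complete2)
  show ?thesis
  proof (rule that[of B])
    show "AE x in lebesgue. x \<in> \<Omega> \<longrightarrow> x \<in> B"
      by (rule AE_I'[OF N]) (use * in auto)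
    show "emeasure lborel B = emeasure lebesgue \<Omega>"
      using * N by (simp add: emeasure_Un_null_set)
  qed (use * in auto)
qed

theorem lemma3p2:
  fixes \<alpha> r :: real and z :: "real ^ 'n" and \<Omega> \<Omega>s :: "(real ^ 'n) set"
  assumes "0 < \<alpha>" and "\<alpha> < real CARD('n)"
    and "0 < r" and "\<Omega>s = ball z r \<or> \<Omega>s = cball z r"
    and "\<Omega> \<in> sets lebesgue"
    and "emeasure lebesgue \<Omega> = emeasure lebesgue \<Omega>s"
  shows "0 < riesz_lambda1 \<alpha> \<Omega> \<and> riesz_lambda1 \<alpha> \<Omega> \<le> riesz_lambda1 \<alpha> \<Omega>s"
proof -
  define k where "k = (\<lambda>z :: real ^ 'n. riesz_const \<alpha> (real CARD('n)) * norm z powr - (real CARD('n) - \<alpha>))"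
  interpret riesz_operator \<alpha> k
    by unfold_locales (use assms in \<open>auto simp: riesz_const_pos k_def\<close>)
  have ball_eq: "emeasure lborel (ball z r) = emeasure lebesgue \<Omega>s"
    using assms(3,4) by (auto simp: emeasure_ball emeasure_cball)
  have ball_pos: "0 < emeasure lborel (ball z r)" and ball_fin: "emeasure lborel (ball z r) < \<infinity>"
    using assms(3) emeasure_lborel_ball_finite[of z r] by (auto simp: emeasure_ball unit_ball_vol_pos)
  have nulls: "AE x in lebesgue. x \<in> \<Omega>s \<longrightarrow> x \<in> ball z r"
  proof (rule AE_I')
    show "sphere z r \<in> null_sets lebesgue" by (metis negligible_iff_null_sets negligible_sphere)
  qed (use assms(4) in auto)
  have "\<Omega>s \<in> sets lebesgue" "ball z r \<subseteq> \<Omega>s" using assms(4) by auto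
  note ball = lambda1_characterization[OF this(1) _ this(2) nulls ball_pos ball_fin]
  obtain B where B: "B \<in> sets borel" "B \<subseteq> \<Omega>" "AE x in lebesgue. x \<in> \<Omega> \<longrightarrow> x \<in> B"
    "emeasure lborel B = emeasure lebesgue \<Omega>"
    using lebesgue_inner_borel[OF assms(5)] by blast
  have B_eq: "emeasure lborel B = emeasure lborel (ball z r)" using B(4) assms(6) ball_eq by simp
  note omega = lambda1_characterization[OF assms(5) B(1-3)]
  \<comment> \<open>Polarization favours the side of the origin, so the ball is first centred
    there.\<close>
  have "qbound (ball 0 r) (riesz_lambda1 \<alpha> \<Omega>s)"
    by (rule qbound_reflect_ball[OF ball(2)]) simp
  then have "qbound B (riesz_lambda1 \<alpha> \<Omega>s)"
    by (rule qbound_from_ball) (use ball(1) assms(3) B(1) B_eq in \<open>auto simp: emeasure_ball\<close>)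
  then show ?thesis using omega ball(1) B_eq ball_pos ball_fin by auto
qed


end
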